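(* There are constants $a>0$, $0<b<c$, $1<\alpha<2$ so that, with $x=L(p_j)-M(j+1)$ and $T=\exp(\sqrt{c\log x})$, the twin prime remainder $R_E$ takes on the form $$-R_E=\sum_{p_j<n<x,\ n\mid L_j(x)}\mu(n)2^{\nu(n)}\left\{\frac{x}{n}\right\}+O(1)$$ $$=O\left(\frac{x^{1+\frac{a}{\log T}}\log^3T}{T}\right)+O\left(\frac{x\log^3x}{T}\right)+O\left(x^{1-\frac{b}{\log T}}(\log T)^3(\log x)^{\alpha}\right)+O\left(x^{1+\frac{a}{\log T}}\frac{(\log T)^2(\log x)^{\alpha}}{T}\right)$$ $$=O\left(x\exp(-\sqrt{c\log x})(\log x)^3\right).$$
   Context: $p$ always denotes a prime and $p_j$ is the $j$th prime ($p_1=2,p_2=3,p_3=5,\dots$). $L(p_j)=\prod_{5\le p\le p_j}p$, $M(j+1)=\frac16(p_{j+1}^2-1)$, and $x=L(p_j)-M(j+1)$, which tends to infinity with $j$. $L_j(x)=\prod_{p_j<p\le x}p$. $\mu$ is the Möbius function, $\nu(n)$ is the number of distinct prime divisors of $n$, and $\{y\}=y-[y]$ is the fractional part of $y$, where $[\cdot]$ is the greatest integer function. The twin prime remainder $R_E$ is the error term arising when $[x/n]=x/n-\{x/n\}$ is substituted into the Legendre-type formula $$\pi_2(6x+1)=L(p_j)\prod_{5\le p\le p_j}\left(1-\frac2p\right)+\sum_{n\le x,\ n\mid L_j(x)}\mu(n)2^{\nu(n)}\left[\frac{x}{n}\right]+O(1),$$ where $\pi_2(6x+1)$ counts twin prime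 pairs $6m\pm1$ below $6x+1$; it is given by the first displayed expression of the claim (fractional-part sum plus $O(1)$). All $O$-estimates are as $j\to\infty$. *)

theory Defs
  imports
    "HOL-Analysis.Analysis"
    "HOL-Library.Infinite_Set"
    "HOL-Library.Landau_Symbols"
    "HOL-Computational_Algebra.Computational_Algebra"
begin

(* Primes are numbered from 1 (nth_prime 1 = 2); index 0 is a junk duplicate of index 1. *)
definition nth_prime :: "nat \<Rightarrow> nat" where
  "nth_prime j = enumerate {p. prime p} (j - 1)"

definition moebius_mu :: "nat \<Rightarrow> int" where
  "moebius_mu n = (if squarefree n then (- 1) ^ card (prime_factors n) else 0)"

definition num_prime_divisors :: "nat \<Rightarrow> nat" where
  "num_prime_divisors n = card (prime_factors n)"

(* L(p_j), as a function of j *)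
definition L_prod :: "nat \<Rightarrow> nat" where
  "L_prod j = \<Prod>{p. prime p \<and> 5 \<le> p \<and> p \<le> nth_prime j}"

(* Real-valued, since the division by 6 is inexact for nth_prime j = 2, 3; it is exact afterwards. *)
definition M_shift :: "nat \<Rightarrow> real" where
  "M_shift j = (real (nth_prime j) ^ 2 - 1) / 6"

(* Negative for small j, tends to infinity with j. *)
definition x_param :: "nat \<Rightarrow> real" where
  "x_param j = real (L_prod j) - M_shift (j + 1)"

(* L_j(x) *)
definition L_tail :: "nat \<Rightarrow> real \<Rightarrow> nat" where
  "L_tail j x = \<Prod>{p. prime p \<and> nth_prime j < p \<and> real p \<le> x}"

(* pi_2: number of pairs of twin primes 6 m - 1, 6 m + 1 up to y *)
definition twin_prime_count :: "real \<Rightarrow> nat" where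
  "twin_prime_count y =
     card {m::nat. 1 \<le> m \<and> prime (6 * m - 1) \<and> prime (6 * m + 1) \<and> real (6 * m + 1) \<le> y}"

(* Right-hand side, without its O(1), of the Legendre-type formula for pi_2 (6 x + 1). *)
definition legendre_rhs :: "nat \<Rightarrow> real" where
  "legendre_rhs j =
     real (L_prod j) * (\<Prod>p | prime p \<and> 5 \<le> p \<and> p \<le> nth_prime j. 1 - 2 / real p)
     + (\<Sum>n | real n \<le> x_param j \<and> n dvd L_tail j (x_param j).
          of_int (moebius_mu n) * 2 ^ num_prime_divisors n * of_int \<lfloor>x_param j / real n\<rfloor>)"

(* The same expression with every floor [x/n] replaced by x/n. *)
definition legendre_main :: "nat \<Rightarrow> real" where
  "legendre_main j =
     real (L_prod j) * (\<Prod>p | prime p \<and> 5 \<le> p \<and> p \<le> nth_prime j. 1 - 2 / real p)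
     + (\<Sum>n | real n \<le> x_param j \<and> n dvd L_tail j (x_param j).
          of_int (moebius_mu n) * 2 ^ num_prime_divisors n * (x_param j / real n))"

(* The remainder R_E is the error made by the substitution [x/n] = x/n - {x/n}. It is only
   determined up to the unspecified O(1) of the Legendre-type formula, so it is a predicate on
   functions of j rather than a single function. *)
definition twin_prime_remainder :: "(nat \<Rightarrow> real) \<Rightarrow> bool" where
  "twin_prime_remainder R \<longleftrightarrow> (\<lambda>j. R j - (legendre_rhs j - legendre_main j)) \<in> O(\<lambda>_. 1)"

(* Whenever the Legendre-type formula holds, pi_2 (6 x + 1) minus the main term is a remainder in
   this sense. The formula is deliberately not an assumption of the definition. *)
lemma twin_prime_remainder_twin_prime_count:
  assumes "(\<lambda>j. real (twin_prime_count (6 * x_param j + 1)) - legendre_rhs j) \<in> O(\<lambda>_. 1)"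
  shows "twin_prime_remainder
           (\<lambda>j. real (twin_prime_count (6 * x_param j + 1)) - legendre_main j)"
  using assms unfolding twin_prime_remainder_def by (simp add: algebra_simps)

end

theory Submission
  imports
    Defs
    "HOL-Complex_Analysis.Complex_Analysis"
    "HOL-Number_Theory.Prime_Powers"
    "HOL-Real_Asymp.Real_Asymp"
begin

text \<open>
  Put \<open>z = p\<^sub>j\<close> and let \<open>f n = \<mu> n * 2 ^ \<nu> n\<close> for squarefree \<open>n\<close> all of whose prime factors exceed \<open>z\<close>.
  Up to a bounded term, \<open>- R\<^sub>E\<close> is the sum of \<open>f n * frac (x / n)\<close> over \<open>n \<le> x\<close>, and \<open>z\<close> is at most a power of
  \<open>ln x\<close> by Chebyshev's lower bound for the number of primes. The Dirichlet series of \<open>f\<close> is \<open>1 / \<zeta> s ^ 2\<close> times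
  a factor which is holomorphic and of size \<open>z ^ O(1)\<close> slightly to the left of \<open>Re s = 1\<close>. The classical zero-free region of
  \<open>\<zeta>\<close> and the Perron integral with kernel \<open>1 / (s * (s + 1))\<close> therefore bound the Riesz means of \<open>f\<close> by
  \<open>x * exp (- k * sqrt (ln x))\<close>; differencing, and then Abel summation, carries this bound to the summatory function of
  \<open>f\<close> and to the sum with fractional parts. The last bound of the theorem is thus obtained directly, and it yields the
  intermediate one with \<open>E2 = - R\<^sub>E\<close> and \<open>E1 = E3 = E4 = 0\<close>.
\<close>

section \<open>The regularised zeta function\<close>

text \<open>The real constraint is uniformity in z, which grows with x. Therefore the Dirichlet
  series of f is never formed: coefficients are cut off at primes up to some N, every sum over them
  is finite, and N is chosen large only after x, z and the height T are fixed. Two losses shape the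
  constants. The bound for 1 / \<zeta> loses a small power of T, squared T^(1/2); this is affordable
  because the shifted contour is otherwise of order x / T^2, while the truncation error is of order
  x / T in any case (up to logarithms). The primes up to z cost a factor z^24, a power of ln x,
  which is swallowed by lowering the exponent k. The kernel 1 / (s * (s + 1)) decays quadratically,
  so its truncation error stays regular at n = x, where the kernel 1 / s would need separate care;
  the price is the differencing step. Working with (s - 1) * \<zeta> s, which equals 1 at s = 1,
  spares every contour the detour around a pole. The constant c of the theorem is free, so it is
  read off from the exponent that the estimates yield.\<close>

text \<open>\<open>zeta_reg s = (s - 1) * \<zeta> s\<close>: for \<open>Re s > 1\<close> the terms \<open>(s - 1) / n powr s\<close> are corrected by a
  telescoping sum with value 1, which makes the series converge for \<open>Re s > 0\<close>.\<close>
definition zeta_term :: "nat \<Rightarrow> complex \<Rightarrow> complex" where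
  "zeta_term n s = (s - 1) * of_nat (Suc n) powr (- s) - of_nat (Suc n) powr (1 - s)
     + of_nat (Suc (Suc n)) powr (1 - s)"

definition zeta_reg :: "complex \<Rightarrow> complex" where
  "zeta_reg s = 1 + (\<Sum>n. zeta_term n s)"

text \<open>A sum over an index set without an order of summation: sieving out the multiples of a
  prime then means removing a reindexed copy of the index set.\<close>

definition zeta_dir :: "complex \<Rightarrow> complex" where
  "zeta_dir s = (\<Sum>\<^sub>\<infinity>n\<in>{1..}. of_nat n powr (- s))"

lemma norm_of_nat_powr: "n \<ge> 1 \<Longrightarrow> norm (of_nat n powr s :: complex) = real n powr Re s"
  using norm_powr_real_powr[of "of_nat n" s] by simp

lemma segment_of_real:
  assumes "a \<le> b" "z \<in> closed_segment (of_real a) (of_real b :: complex)"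
  obtains u where "z = of_real u" "a \<le> u" "u \<le> b"
proof -
  have "z \<in> of_real ` closed_segment a b"
    using assms closed_segment_of_real by metis
  with assms(1) that show ?thesis by (auto simp: closed_segment_eq_real_ivl)
qed

lemma powr_diff_bound:
  fixes s :: complex
  assumes "0 < a" "a \<le> b" "0 \<le> Re s"
  shows "norm (of_real b powr (- s) - of_real a powr (- s)) \<le> norm s * a powr (- Re s - 1) * (b - a)"
proof -
  let ?S = "closed_segment (of_real a) (of_real b :: complex)"
  have "norm (of_real b powr (- s) - of_real a powr (- s))
      \<le> (norm s * a powr (- Re s - 1)) * norm (of_real b - of_real a :: complex)"
  proof (rule field_differentiable_bound[where S = ?S and f' = "\<lambda>z. - s * z powr (- s - 1)"])
    fix z assume z: "z \<in> ?S"
    obtain u where u: "z = of_real u" "a \<le> u" "u \<le> b" using segment_of_real[OF assms(2) z] .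
    have nz: "z \<notin> \<real>\<^sub>\<le>\<^sub>0" using u assms by (auto simp: complex_nonpos_Reals_iff)
    then show "((\<lambda>z. z powr (- s)) has_field_derivative - s * z powr (- s - 1)) (at z within ?S)"
      by (auto intro!: derivative_eq_intros)
    have "norm (z powr (- s - 1)) = u powr (- Re s - 1)"
      using norm_powr_real_powr[of z "- s - 1"] u assms by simp
    also have "\<dots> \<le> a powr (- Re s - 1)"
      using u assms by (intro powr_mono2') auto
    finally show "norm (- s * z powr (- s - 1)) \<le> norm s * a powr (- Re s - 1)"
      by (simp add: norm_mult mult_left_mono)
  qed auto
  then show ?thesis using assms by (simp flip: of_real_diff)
qed

text \<open>With m = n + 1, \<open>zeta_term n s\<close> is the increment over [m, m + 1] of the
  function \<open>?h\<close>, whose derivative (s - 1) * (m powr (- s) - u powr (- s)) vanishes at u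
  = m and stays small by \<open>powr_diff_bound\<close>. This gains one power of m over the terms of
  the Dirichlet series, hence convergence up to Re s > 0.\<close>

lemma norm_zeta_term:
  assumes "0 \<le> Re s"
  shows "norm (zeta_term n s) \<le> norm (s - 1) * norm s * real (Suc n) powr (- Re s - 1)"
proof -
  define m where "m = real (Suc n)"
  have m: "m > 0" by (simp add: m_def)
  let ?S = "closed_segment (of_real m) (of_real (m + 1) :: complex)"
  let ?h = "\<lambda>z::complex. (s - 1) * of_real m powr (- s) * z + z powr (1 - s)"
  have "norm (?h (of_real (m + 1)) - ?h (of_real m))
      \<le> (norm (s - 1) * (norm s * m powr (- Re s - 1))) * norm (of_real (m + 1) - of_real m :: complex)"
  proof (rule field_differentiable_bound[where S = ?S
        and f' = "\<lambda>z. (s - 1) * (of_real m powr (- s) - z powr (- s))"])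
    fix z assume z: "z \<in> ?S"
    obtain u where u: "z = of_real u" "m \<le> u" "u \<le> m + 1" using segment_of_real[OF _ z] by auto
    have nz: "z \<notin> \<real>\<^sub>\<le>\<^sub>0" using u m by (auto simp: complex_nonpos_Reals_iff)
    have e: "1 - s - 1 = - s" by simp
    show "(?h has_field_derivative (s - 1) * (of_real m powr (- s) - z powr (- s))) (at z within ?S)"
      using nz by (auto intro!: derivative_eq_intros simp: e algebra_simps)
    have "norm (of_real m powr (- s) - z powr (- s)) \<le> norm s * m powr (- Re s - 1) * (u - m)"
      using powr_diff_bound[OF m u(2) assms] u(1) by (simp add: norm_minus_commute)
    also have "\<dots> \<le> norm s * m powr (- Re s - 1) * 1"
      using u by (intro mult_left_mono) auto
    finally show "norm ((s - 1) * (of_real m powr (- s) - z powr (- s))) \<le> norm (s - 1) * (norm s * m powr (- Re s - 1))"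
      by (simp add: norm_mult mult_left_mono)
  qed auto
  moreover have "?h (of_real (m + 1)) - ?h (of_real m) = zeta_term n s"
    by (simp add: zeta_term_def m_def algebra_simps)
  ultimately show ?thesis by (simp add: m_def mult_ac)
qed

lemma summable_Suc_powr: "e > 1 \<Longrightarrow> summable (\<lambda>n. real (Suc n) powr (- e))"
  by (subst summable_Suc_iff) (simp add: summable_real_powr_iff)

lemma summable_zeta_term:
  assumes "0 < Re s" shows "summable (\<lambda>n. zeta_term n s)"
proof (rule summable_comparison_test')
  show "summable (\<lambda>n. norm (s - 1) * norm s * real (Suc n) powr (- (Re s + 1)))"
    using assms by (intro summable_mult summable_Suc_powr) auto
  show "norm (zeta_term n s) \<le> norm (s - 1) * norm s * real (Suc n) powr (- (Re s + 1))" for n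
    using norm_zeta_term[of s n] assms by simp
qed

lemma holomorphic_zeta_term: "zeta_term n holomorphic_on A"
  unfolding zeta_term_def by (intro holomorphic_intros)

lemma holomorphic_zeta_reg: "zeta_reg holomorphic_on {s. Re s > 0}"
proof -
  have op: "open {s::complex. Re s > 0}" by (simp add: open_halfspace_Re_gt)
  show ?thesis
  proof (rule holomorphic_uniform_sequence[where f = "\<lambda>N s. 1 + (\<Sum>n<N. zeta_term n s)", OF op])
    show "(\<lambda>s. 1 + (\<Sum>n<N. zeta_term n s)) holomorphic_on {s. Re s > 0}" for N
      by (intro holomorphic_intros holomorphic_zeta_term)
    fix z :: complex assume "z \<in> {s. Re s > 0}"
    then have z: "Re z > 0" by simp
    define d where "d = Re z / 2"
    have sub: "Re s \<ge> d" "norm s \<le> norm z + d" if "s \<in> cball z d" for s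
    proof -
      have "\<bar>Re z - Re s\<bar> \<le> d" "norm (s - z) \<le> d"
        using that abs_Re_le_cmod[of "z - s"] by (auto simp: dist_norm norm_minus_commute)
      then show "Re s \<ge> d" "norm s \<le> norm z + d"
        using norm_triangle_ineq[of z "s - z"] by (auto simp: d_def abs_if split: if_splits)
    qed
    have "uniform_limit (cball z d) (\<lambda>N s. \<Sum>n<N. zeta_term n s) (\<lambda>s. \<Sum>n. zeta_term n s) sequentially"
    proof (rule Weierstrass_m_test[where M = "\<lambda>n. (norm z + d + 1) * (norm z + d) * real (Suc n) powr (- (d + 1))"])
      show "summable (\<lambda>n. (norm z + d + 1) * (norm z + d) * real (Suc n) powr (- (d + 1)))"
        using z by (intro summable_mult summable_Suc_powr) (auto simp: d_def)
      fix n s assume s: "s \<in> cball z d"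
      have "norm (zeta_term n s) \<le> norm (s - 1) * norm s * real (Suc n) powr (- Re s - 1)"
        using sub[OF s] z by (intro norm_zeta_term) (auto simp: d_def)
      also have "\<dots> \<le> (norm z + d + 1) * (norm z + d) * real (Suc n) powr (- (d + 1))"
        using sub[OF s] z norm_triangle_ineq4[of s 1]
        by (intro mult_mono powr_mono) (auto simp: d_def)
      finally show "norm (zeta_term n s) \<le> (norm z + d + 1) * (norm z + d) * real (Suc n) powr (- (d + 1))" .
    qed
    then have "uniform_limit (cball z d) (\<lambda>N s. 1 + (\<Sum>n<N. zeta_term n s)) zeta_reg sequentially"
      unfolding zeta_reg_def by (intro uniform_limit_intros)
    moreover have "cball z d \<subseteq> {s. Re s > 0}" using sub z by (force simp: d_def)
    ultimately show "\<exists>d>0. cball z d \<subseteq> {s. Re s > 0} \<and>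
        uniform_limit (cball z d) (\<lambda>N s. 1 + (\<Sum>n<N. zeta_term n s)) zeta_reg sequentially"
      using z by (intro exI[of _ d]) (auto simp: d_def)
  qed
qed

text \<open>The residue of the zeta function at its pole. It keeps \<open>zeta_reg\<close> away from
  0 near s = 1, where the Euler product says nothing about points with Re s \<le> 1.\<close>

lemma zeta_reg_1: "zeta_reg 1 = 1"
proof -
  have "zeta_term n 1 = 0" for n
    using of_nat_neq_0[of n, where 'a = complex] of_nat_neq_0[of "Suc n", where 'a = complex]
    by (simp add: zeta_term_def powr_0 del: of_nat_Suc)
  then show ?thesis by (simp add: zeta_reg_def)
qed

text \<open>Quadratic growth is crude but enough: at large heights the bound enters only through its
  logarithm. For Re s \<ge> 1/2 all terms are dominated by a multiple of (n + 1) powr (-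
  3/2).\<close>

lemma norm_zeta_reg:
  obtains C where "C \<ge> 1" "\<And>s. Re s \<ge> 1/2 \<Longrightarrow> norm (zeta_reg s) \<le> C * (norm s + 1)\<^sup>2"
proof -
  define K where "K = (\<Sum>n. real (Suc n) powr (- (3/2)))"
  have sK: "summable (\<lambda>n. real (Suc n) powr (- (3/2)))" by (rule summable_Suc_powr) simp
  have K0: "K \<ge> 0" unfolding K_def by (intro suminf_nonneg sK) auto
  show ?thesis
  proof (rule that[of "1 + K"])
    fix s :: complex assume s: "Re s \<ge> 1/2"
    let ?g = "\<lambda>n. norm (s - 1) * norm s * real (Suc n) powr (- (3/2))"
    have le: "norm (zeta_term n s) \<le> ?g n" for n
    proof -
      have "norm (zeta_term n s) \<le> norm (s - 1) * norm s * real (Suc n) powr (- Re s - 1)"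
        using s by (intro norm_zeta_term) auto
      also have "\<dots> \<le> ?g n" using s by (intro mult_left_mono powr_mono) auto
      finally show ?thesis .
    qed
    have sg: "summable ?g" by (intro summable_mult sK)
    have sn: "summable (\<lambda>n. norm (zeta_term n s))"
      by (rule summable_comparison_test'[OF sg]) (use le in auto)
    have "norm (\<Sum>n. zeta_term n s) \<le> (\<Sum>n. norm (zeta_term n s))" by (rule summable_norm[OF sn])
    also have "\<dots> \<le> (\<Sum>n. ?g n)" by (intro suminf_le le sn sg)
    also have "\<dots> = norm (s - 1) * norm s * K" unfolding K_def by (rule suminf_mult[OF sK])
    also have "\<dots> \<le> (norm s + 1) * (norm s + 1) * K"
      using K0 norm_triangle_ineq4[of s 1] by (intro mult_right_mono mult_mono) auto
    finally have a: "norm (\<Sum>n. zeta_term n s) \<le> (norm s + 1)\<^sup>2 * K" by (simp add: power2_eq_square)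
    have "norm (zeta_reg s) \<le> 1 + norm (\<Sum>n. zeta_term n s)"
      unfolding zeta_reg_def using norm_triangle_ineq[of 1 "\<Sum>n. zeta_term n s"] by simp
    moreover have "(1::real) \<le> (norm s + 1)\<^sup>2" by (simp add: one_le_power)
    moreover have "(1 + K) * (norm s + 1)\<^sup>2 = (norm s + 1)\<^sup>2 + (norm s + 1)\<^sup>2 * K" by algebra
    ultimately show "norm (zeta_reg s) \<le> (1 + K) * (norm s + 1)\<^sup>2"
      using a by linarith
  qed (use K0 in auto)
qed

lemma abs_summable_of_nat_powr:
  assumes "Re s > 1"
  shows "(\<lambda>n. norm (of_nat n powr (- s) :: complex)) summable_on {1..}"
proof -
  have "summable (\<lambda>n. norm (real (Suc n) powr (- Re s)))"
    using summable_Suc_powr[OF assms] by (simp del: of_nat_Suc)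
  then have "(\<lambda>n. real (Suc n) powr (- Re s)) summable_on UNIV"
    by (rule norm_summable_imp_summable_on)
  also have "(\<lambda>n. real (Suc n) powr (- Re s)) = (\<lambda>n. norm (of_nat n powr (- s) :: complex)) \<circ> Suc"
    by (auto simp: norm_of_nat_powr fun_eq_iff simp del: of_nat_Suc)
  finally have "(\<lambda>n. norm (of_nat n powr (- s) :: complex)) summable_on (range Suc)"
    by (rule summable_on_reindex[OF inj_Suc, THEN iffD2])
  also have "range Suc = {1..}" by (auto simp: image_iff Suc_le_eq gr0_conv_Suc)
  finally show ?thesis .
qed

lemma summable_on_of_nat_powr:
  assumes "Re s > 1" "A \<subseteq> {1..}"
  shows "(\<lambda>n. of_nat n powr (- s) :: complex) summable_on A"
    "(\<lambda>n. norm (of_nat n powr (- s) :: complex)) summable_on A"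
  using abs_summable_of_nat_powr[OF assms(1)] assms(2)
    summable_on_subset_banach abs_summable_summable by metis+

text \<open>The corrections telescope: N of them, together with the leading 1, leave only the
  boundary term (N + 1) powr (1 - s), which tends to 0 for Re s > 1.\<close>

lemma zeta_reg_eq:
  assumes "Re s > 1"
  shows "zeta_reg s = (s - 1) * zeta_dir s"
proof -
  have "(\<lambda>n. of_nat n powr (- s) :: complex) summable_on {1..}"
    using summable_on_of_nat_powr[OF assms] by blast
  then have "((\<lambda>n. of_nat n powr (- s)) has_sum zeta_dir s) {1..}"
    unfolding zeta_dir_def by simp
  also have "{1..} = range Suc" by (auto simp: image_iff Suc_le_eq gr0_conv_Suc)
  finally have "((\<lambda>n. of_nat n powr (- s)) \<circ> Suc has_sum zeta_dir s) UNIV"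
    by (subst has_sum_reindex[symmetric]) auto
  then have "(\<lambda>n. of_nat (Suc n) powr (- s)) sums zeta_dir s"
    by (auto dest!: has_sum_imp_sums simp: o_def)
  then have "(\<lambda>N. (s - 1) * (\<Sum>n<N. of_nat (Suc n) powr (- s))) \<longlonglongrightarrow> (s - 1) * zeta_dir s"
    unfolding sums_def by (intro tendsto_intros)
  moreover have "(\<lambda>N. of_nat (Suc N) powr (1 - s) :: complex) \<longlonglongrightarrow> 0"
  proof (rule tendsto_norm_zero_cancel)
    have "(\<lambda>N. real (Suc N) powr (1 - Re s)) \<longlonglongrightarrow> 0"
      by (rule tendsto_neg_powr) (use assms filterlim_compose[OF filterlim_real_sequentially filterlim_Suc] in auto)
    then show "(\<lambda>N. norm (of_nat (Suc N) powr (1 - s) :: complex)) \<longlonglongrightarrow> 0"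
      by (simp add: norm_of_nat_powr del: of_nat_Suc)
  qed
  ultimately have "(\<lambda>N. (s - 1) * (\<Sum>n<N. of_nat (Suc n) powr (- s)) + of_nat (Suc N) powr (1 - s)) \<longlonglongrightarrow> (s - 1) * zeta_dir s + 0"
    by (rule tendsto_add)
  moreover have "(s - 1) * (\<Sum>n<N. of_nat (Suc n) powr (- s)) + of_nat (Suc N) powr (1 - s)
      = 1 + (\<Sum>n<N. zeta_term n s)" for N
    by (induction N) (simp_all add: zeta_term_def algebra_simps)
  ultimately have "(\<lambda>N. 1 + (\<Sum>n<N. zeta_term n s)) \<longlonglongrightarrow> (s - 1) * zeta_dir s" by simp
  moreover have "(\<lambda>N. 1 + (\<Sum>n<N. zeta_term n s)) \<longlonglongrightarrow> zeta_reg s"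
    unfolding zeta_reg_def using assms by (intro tendsto_intros summable_LIMSEQ summable_zeta_term) auto
  ultimately show ?thesis using LIMSEQ_unique by blast
qed

section \<open>Euler products\<close>

definition zeta_re :: "real \<Rightarrow> real" where
  "zeta_re \<sigma> = (\<Sum>\<^sub>\<infinity>n\<in>{1..}. real n powr (- \<sigma>))"

definition euler_inv :: "nat \<Rightarrow> complex \<Rightarrow> complex" where
  "euler_inv N s = (\<Prod>p | prime p \<and> p \<le> N. 1 - of_nat p powr (- s))"

lemma finite_primes_le [simp]: "finite {p::nat. prime p \<and> p \<le> N}" "finite {p::nat. prime p \<and> a < p \<and> p \<le> N}"
  by (auto intro: finite_subset[of _ "{..N}"])

lemma summable_on_powr_real:
  assumes "\<sigma> > 1" "A \<subseteq> {1..}"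
  shows "(\<lambda>n. real n powr (- \<sigma>)) summable_on A"
proof -
  have "(\<lambda>n. norm (of_nat n powr (- complex_of_real \<sigma>) :: complex)) summable_on A"
    using assms by (intro summable_on_of_nat_powr) auto
  also have "?this \<longleftrightarrow> ?thesis"
    using assms by (intro summable_on_cong) (auto simp: norm_of_nat_powr)
  finally show ?thesis .
qed

lemma norm_infsum_powr_le:
  assumes "Re s > 1" "A \<subseteq> {1..}"
  shows "norm (\<Sum>\<^sub>\<infinity>n\<in>A. of_nat n powr (- s) :: complex) \<le> (\<Sum>\<^sub>\<infinity>n\<in>A. real n powr (- Re s))"
proof -
  have "norm (\<Sum>\<^sub>\<infinity>n\<in>A. of_nat n powr (- s) :: complex) \<le> (\<Sum>\<^sub>\<infinity>n\<in>A. norm (of_nat n powr (- s) :: complex))"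
    using summable_on_of_nat_powr[OF assms] by (intro norm_infsum_bound)
  also have "\<dots> = (\<Sum>\<^sub>\<infinity>n\<in>A. real n powr (- Re s))"
    using assms by (intro infsum_cong) (auto simp: norm_of_nat_powr)
  finally show ?thesis .
qed

lemma infsum_powr_of_real:
  assumes "\<sigma> > 1" "A \<subseteq> {1..}"
  shows "(\<Sum>\<^sub>\<infinity>n\<in>A. complex_of_real (real n powr (- \<sigma>))) = of_real (\<Sum>\<^sub>\<infinity>n\<in>A. real n powr (- \<sigma>))"
  by (intro infsumI has_sum_of_real has_sum_infsum summable_on_powr_real assms)

lemma zeta_dir_of_real: "\<sigma> > 1 \<Longrightarrow> zeta_dir (of_real \<sigma>) = of_real (zeta_re \<sigma>)"
proof -
  assume s: "\<sigma> > 1"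
  have "of_real (zeta_re \<sigma>) = (\<Sum>\<^sub>\<infinity>n\<in>{1..}. complex_of_real (real n powr (- \<sigma>)))"
    unfolding zeta_re_def by (rule infsum_powr_of_real[symmetric]) (use s in auto)
  also have "\<dots> = zeta_dir (of_real \<sigma>)"
    unfolding zeta_dir_def by (intro infsum_cong) (simp flip: powr_of_real)
  finally show ?thesis by simp
qed

lemma zeta_re_pos: assumes "\<sigma> > 1" shows "zeta_re \<sigma> \<ge> 1"
proof -
  have "(\<Sum>\<^sub>\<infinity>n\<in>{1::nat}. real n powr (- \<sigma>)) \<le> zeta_re \<sigma>"
    unfolding zeta_re_def using assms by (intro infsum_mono2 summable_on_powr_real) auto
  then show ?thesis by simp
qed

lemma of_nat_powr_mult: "(of_nat (m * n) :: complex) powr s = of_nat m powr s * of_nat n powr s"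
  using powr_times_real[of "of_nat m" "of_nat n" s] by simp

text \<open>The sieve of Eratosthenes. Since p is not in P, multiplication by p maps the set of
  survivors into itself, and the factor 1 - p powr (- s) subtracts exactly the terms of that
  image.\<close>

lemma euler_product_partial:
  assumes "Re s > 1" "finite P" "\<And>p. p \<in> P \<Longrightarrow> prime (p::nat)"
  shows "(\<Prod>p\<in>P. 1 - of_nat p powr (- s)) * zeta_dir s
       = (\<Sum>\<^sub>\<infinity>n\<in>{n. n \<ge> 1 \<and> (\<forall>p\<in>P. \<not> p dvd n)}. of_nat n powr (- s))"
  using assms(2,3)
proof (induction P)
  case empty
  then show ?case by (simp add: zeta_dir_def atLeast_def)
next
  case (insert p P)
  define A where "A = {n. n \<ge> 1 \<and> (\<forall>p\<in>P. \<not> p dvd n)}"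
  let ?f = "\<lambda>n::nat. of_nat n powr (- s) :: complex"
  have p: "prime p" using insert by auto
  have sub: "(*) p ` A \<subseteq> A"
  proof
    fix n assume "n \<in> (*) p ` A"
    then obtain m where m: "n = p * m" "m \<in> A" by auto
    have "\<not> q dvd p * m" if "q \<in> P" for q
    proof
      assume "q dvd p * m"
      moreover have q: "prime q" "q \<noteq> p" using that insert by auto
      ultimately have "q dvd m" using primes_dvd_imp_eq[OF q(1) p] by (auto simp: prime_dvd_mult_iff)
      then show False using m that by (auto simp: A_def)
    qed
    then show "n \<in> A" using m p prime_gt_0_nat[OF p] by (auto simp: A_def)
  qed
  have eq: "{n. n \<ge> 1 \<and> (\<forall>q\<in>insert p P. \<not> q dvd n)} = A - (*) p ` A"
  proof -
    have "n \<in> (*) p ` A" if "n \<in> A" "p dvd n" for n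
    proof -
      obtain m where m: "n = p * m" using \<open>p dvd n\<close> by blast
      have "m \<in> A" using \<open>n \<in> A\<close> m by (auto simp: A_def intro!: Suc_leI)
      with m show ?thesis by blast
    qed
    then show ?thesis by (auto simp: A_def)
  qed
  have sA: "A \<subseteq> {1..}" by (auto simp: A_def)
  have "(\<Sum>\<^sub>\<infinity>n\<in>(*) p ` A. ?f n) = (\<Sum>\<^sub>\<infinity>n\<in>A. of_nat p powr (- s) * ?f n)"
    using prime_gt_0_nat[OF p] by (subst infsum_reindex) (auto simp: inj_on_def o_def of_nat_powr_mult simp del: of_nat_mult)
  also have "\<dots> = of_nat p powr (- s) * (\<Sum>\<^sub>\<infinity>n\<in>A. ?f n)" by (rule infsum_cmult_right') 
  finally have im: "(\<Sum>\<^sub>\<infinity>n\<in>(*) p ` A. ?f n) = of_nat p powr (- s) * (\<Sum>\<^sub>\<infinity>n\<in>A. ?f n)" .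
  have "(\<Prod>q\<in>insert p P. 1 - of_nat q powr (- s)) * zeta_dir s = (1 - of_nat p powr (- s)) * (\<Sum>\<^sub>\<infinity>n\<in>A. ?f n)"
    using insert by (simp add: A_def)
  also have "\<dots> = (\<Sum>\<^sub>\<infinity>n\<in>A. ?f n) - (\<Sum>\<^sub>\<infinity>n\<in>(*) p ` A. ?f n)" unfolding im by (simp add: left_diff_distrib)
  also have "\<dots> = (\<Sum>\<^sub>\<infinity>n\<in>A - (*) p ` A. ?f n)"
    using sub sA assms(1) by (intro infsum_Diff[symmetric] summable_on_of_nat_powr) auto
  finally show ?case unfolding eq .
qed

definition zeta_tail :: "real \<Rightarrow> nat \<Rightarrow> real" where
  "zeta_tail \<sigma> N = (\<Sum>\<^sub>\<infinity>n\<in>{N<..}. real n powr (- \<sigma>))"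

lemma zeta_tail_tendsto: assumes "\<sigma> > 1" shows "zeta_tail \<sigma> \<longlonglongrightarrow> 0"
proof -
  let ?f = "\<lambda>n. real n powr (- \<sigma>)"
  have eq: "zeta_tail \<sigma> N = zeta_re \<sigma> - sum ?f {1..N}" for N
  proof -
    have "{N<..} = {1..} - {1..N}" by auto
    then have "zeta_tail \<sigma> N = infsum ?f {1..} - infsum ?f {1..N}"
      unfolding zeta_tail_def using assms by (simp only:) (intro infsum_Diff summable_on_powr_real; auto)
    then show ?thesis by (simp add: zeta_re_def)
  qed
  have "(?f has_sum zeta_re \<sigma>) {1..}"
    unfolding zeta_re_def using summable_on_powr_real[OF assms] by (intro has_sum_infsum) auto
  also have "{1..} = range Suc" by (auto simp: image_iff Suc_le_eq gr0_conv_Suc)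
  finally have "(?f \<circ> Suc has_sum zeta_re \<sigma>) UNIV"
    by (subst has_sum_reindex[symmetric]) auto
  then have "(\<lambda>N. \<Sum>n<N. ?f (Suc n)) \<longlonglongrightarrow> zeta_re \<sigma>"
    by (auto dest!: has_sum_imp_sums simp: o_def sums_def)
  moreover have "(\<Sum>n<N. ?f (Suc n)) = sum ?f {1..N}" for N
    by (rule sum.reindex_bij_witness[of _ "\<lambda>n. n - 1" Suc]) auto
  ultimately have "(\<lambda>N. sum ?f {1..N}) \<longlonglongrightarrow> zeta_re \<sigma>" by simp
  then have "(\<lambda>N. zeta_re \<sigma> - sum ?f {1..N}) \<longlonglongrightarrow> zeta_re \<sigma> - zeta_re \<sigma>" by (intro tendsto_intros)
  then show ?thesis by (simp add: eq[abs_def])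
qed

text \<open>Apart from 1, a number without prime factors up to N exceeds N, so what remains after
  sieving lies in the tail of the series.\<close>

lemma euler_inv_zeta:
  assumes "Re s > 1"
  shows "norm (euler_inv N s * zeta_dir s - 1) \<le> zeta_tail (Re s) N"
proof -
  define A where "A = {n::nat. n \<ge> 1 \<and> (\<forall>p\<in>{p. prime p \<and> p \<le> N}. \<not> p dvd n)}"
  let ?f = "\<lambda>n::nat. of_nat n powr (- s) :: complex"
  have A: "A \<subseteq> {1..}" "1 \<in> A" by (auto simp: A_def)
  have sub: "A - {1} \<subseteq> {N<..}"
  proof
    fix n assume n: "n \<in> A - {1}"
    then obtain p where "prime p" "p dvd n" by (metis DiffD2 insertI1 prime_factor_nat)
    moreover have "n \<ge> 1" using n A by auto
    then have "p \<le> n" using \<open>p dvd n\<close> by (intro dvd_imp_le) auto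
    ultimately show "n \<in> {N<..}" using n by (force simp: A_def)
  qed
  have "euler_inv N s * zeta_dir s = (\<Sum>\<^sub>\<infinity>n\<in>A. ?f n)"
    unfolding euler_inv_def A_def by (rule euler_product_partial[OF assms]) auto
  then have "euler_inv N s * zeta_dir s - 1 = (\<Sum>\<^sub>\<infinity>n\<in>A. ?f n) - (\<Sum>\<^sub>\<infinity>n\<in>{1}. ?f n)" by simp
  also have "\<dots> = (\<Sum>\<^sub>\<infinity>n\<in>A-{1}. ?f n)"
    using A assms by (intro infsum_Diff[symmetric] summable_on_of_nat_powr) auto
  finally have "norm (euler_inv N s * zeta_dir s - 1) = norm (\<Sum>\<^sub>\<infinity>n\<in>A-{1}. ?f n)" by simp
  also have "\<dots> \<le> (\<Sum>\<^sub>\<infinity>n\<in>A-{1}. real n powr (- Re s))"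
    using A assms by (intro norm_infsum_powr_le) auto
  also have "\<dots> \<le> zeta_tail (Re s) N"
    unfolding zeta_tail_def using assms sub A
    by (intro infsum_mono2 summable_on_powr_real) auto
  finally show ?thesis .
qed

lemma prime_powr_less_1: "prime p \<Longrightarrow> \<sigma> > 0 \<Longrightarrow> real p powr (- \<sigma>) < 1"
  using prime_gt_1_nat[of p] powr_less_one[of "real p" "- \<sigma>"] by simp

text \<open>The sieved sum on the real axis is at least its term for n = 1, so the product of the 1
  - p powr (- \<sigma>) times \<open>zeta_re \<sigma>\<close> is at least 1.\<close>

lemma prod_inverse_primes_le:
  assumes "\<sigma> > 1" "finite P" "\<And>p. p \<in> P \<Longrightarrow> prime (p::nat)"
  shows "(\<Prod>p\<in>P. 1 / (1 - real p powr (- \<sigma>))) \<le> zeta_re \<sigma>"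
proof -
  let ?E = "\<Prod>p\<in>P. 1 - real p powr (- \<sigma>)"
  define A where "A = {n::nat. n \<ge> 1 \<and> (\<forall>p\<in>P. \<not> p dvd n)}"
  have A: "A \<subseteq> {1..}" "1 \<in> A" using assms(3) by (auto simp: A_def dest: assms(3))
  have "complex_of_real (?E * zeta_re \<sigma>) = (\<Prod>p\<in>P. 1 - of_nat p powr (- of_real \<sigma>)) * zeta_dir (of_real \<sigma>)"
    using assms by (simp add: zeta_dir_of_real flip: powr_of_real)
  also have "\<dots> = (\<Sum>\<^sub>\<infinity>n\<in>A. of_nat n powr (- of_real \<sigma>))"
    unfolding A_def by (rule euler_product_partial) (use assms in auto)
  also have "\<dots> = (\<Sum>\<^sub>\<infinity>n\<in>A. complex_of_real (real n powr (- \<sigma>)))"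
    by (intro infsum_cong) (simp flip: powr_of_real)
  also have "\<dots> = complex_of_real (\<Sum>\<^sub>\<infinity>n\<in>A. real n powr (- \<sigma>))"
    by (rule infsum_powr_of_real) (use assms A in auto)
  finally have "?E * zeta_re \<sigma> = (\<Sum>\<^sub>\<infinity>n\<in>A. real n powr (- \<sigma>))" by (simp only: of_real_eq_iff)
  also have "\<dots> \<ge> (\<Sum>\<^sub>\<infinity>n\<in>{1::nat}. real n powr (- \<sigma>))"
    using assms A by (intro infsum_mono2 summable_on_powr_real) auto
  finally have "?E * zeta_re \<sigma> \<ge> 1" by simp
  moreover have "?E > 0" using assms prime_powr_less_1[of _ \<sigma>] by (intro prod_pos) auto
  ultimately have "1 / ?E \<le> zeta_re \<sigma>" by (simp add: field_simps)
  then show ?thesis by (simp add: prod_dividef)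
qed

lemma norm_euler_inv_le:
  assumes "Re s > 1" shows "norm (euler_inv N s) \<le> zeta_re (Re s)"
proof -
  have "norm (euler_inv N s) \<le> (\<Prod>p | prime p \<and> p \<le> N. 1 / (1 - real p powr (- Re s)))"
    unfolding euler_inv_def prod_norm[symmetric]
  proof (intro prod_mono conjI norm_ge_zero)
    fix p assume "p \<in> {p. prime p \<and> p \<le> N}"
    then have p: "prime p" "p \<ge> 1" using prime_ge_1_nat by auto
    define x where "x = real p powr (- Re s)"
    have x: "0 \<le> x" "x < 1" using prime_powr_less_1[OF p(1), of "Re s"] assms by (auto simp: x_def)
    have "norm (1 - of_nat p powr (- s) :: complex) \<le> 1 + x"
      using norm_triangle_ineq4[of 1 "of_nat p powr (- s) :: complex"] p by (simp add: norm_of_nat_powr x_def)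
    also have "\<dots> \<le> 1 / (1 - x)"
      using x by (simp add: field_simps)
    finally show "norm (1 - of_nat p powr (- s) :: complex) \<le> 1 / (1 - real p powr (- Re s))" by (simp add: x_def)
  qed
  also have "\<dots> \<le> zeta_re (Re s)" using assms by (intro prod_inverse_primes_le) auto
  finally show ?thesis .
qed

text \<open>Each partial product for 1 / \<zeta> is bounded in modulus by \<open>zeta_re\<close>,
  because \<bar>1 - w\<bar> \<le> 1 + \<bar>w\<bar> \<le> 1 / (1 - \<bar>w\<bar>); letting N tend to
  infinity gives the quantitative nonvanishing to the right of Re s = 1.\<close>

lemma norm_zeta_dir_ge:
  assumes "Re s > 1" shows "norm (zeta_dir s) * zeta_re (Re s) \<ge> 1"
proof -
  have "(\<lambda>N. 1 - zeta_tail (Re s) N) \<longlonglongrightarrow> 1 - 0"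
    by (intro tendsto_intros zeta_tail_tendsto assms)
  moreover have "1 - zeta_tail (Re s) N \<le> norm (zeta_dir s) * zeta_re (Re s)" for N
  proof -
    have "1 - zeta_tail (Re s) N \<le> norm (euler_inv N s * zeta_dir s)"
      using euler_inv_zeta[OF assms, of N] norm_triangle_ineq2[of 1 "1 - euler_inv N s * zeta_dir s"]
      by (simp add: norm_minus_commute)
    also have "\<dots> \<le> norm (zeta_dir s) * zeta_re (Re s)"
      using norm_euler_inv_le[OF assms, of N]
      by (subst norm_mult, subst mult.commute) (intro mult_left_mono; simp)
    finally show ?thesis .
  qed
  ultimately show ?thesis by (intro LIMSEQ_le_const2) auto
qed

lemma zeta_dir_nonzero: "Re s > 1 \<Longrightarrow> zeta_dir s \<noteq> 0"
  using norm_zeta_dir_ge by fastforce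

lemma zeta_reg_nonzero: "Re s > 1 \<Longrightarrow> zeta_reg s \<noteq> 0"
  using zeta_dir_nonzero by (auto simp: zeta_reg_eq)

lemma euler_inv_tendsto:
  assumes "Re s > 1" shows "(\<lambda>N. euler_inv N s) \<longlonglongrightarrow> (s - 1) / zeta_reg s"
proof -
  have "(\<lambda>N. norm (euler_inv N s * zeta_dir s - 1)) \<longlonglongrightarrow> 0"
    by (rule tendsto_sandwich[OF _ _ tendsto_const zeta_tail_tendsto[OF assms]])
      (use euler_inv_zeta[OF assms] in auto)
  then have "(\<lambda>N. euler_inv N s * zeta_dir s) \<longlonglongrightarrow> 1"
    by (simp add: tendsto_norm_zero_iff LIM_zero_iff)
  then have "(\<lambda>N. euler_inv N s * zeta_dir s / zeta_dir s) \<longlonglongrightarrow> 1 / zeta_dir s"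
    using zeta_dir_nonzero[OF assms] by (intro tendsto_intros)
  moreover have "s \<noteq> 1" using assms by auto
  ultimately show ?thesis using zeta_dir_nonzero[OF assms] by (simp add: zeta_reg_eq[OF assms])
qed

text \<open>The pole at 1 is simple. The factor 9 is (\<sigma> + 1)^2 at \<sigma> = 2 in the
  quadratic growth bound.\<close>

lemma zeta_re_le:
  obtains C where "C \<ge> 1" "\<And>\<sigma>. 1 < \<sigma> \<Longrightarrow> \<sigma> \<le> 2 \<Longrightarrow> zeta_re \<sigma> \<le> C / (\<sigma> - 1)"
proof -
  obtain C where C: "C \<ge> 1" "\<And>s. Re s \<ge> 1/2 \<Longrightarrow> norm (zeta_reg s) \<le> C * (norm s + 1)\<^sup>2"
    using norm_zeta_reg by blast
  show ?thesis
  proof (rule that[of "9 * C"])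
    fix \<sigma> :: real assume s: "1 < \<sigma>" "\<sigma> \<le> 2"
    have "(\<sigma> - 1) * zeta_re \<sigma> = norm (zeta_reg (of_real \<sigma>))"
    proof -
      have "zeta_reg (of_real \<sigma>) = of_real ((\<sigma> - 1) * zeta_re \<sigma>)"
        using s by (simp add: zeta_reg_eq zeta_dir_of_real)
      then show ?thesis using s zeta_re_pos[of \<sigma>] by (simp only: norm_of_real) simp
    qed
    also have "\<dots> \<le> C * (\<sigma> + 1)\<^sup>2" using C(2)[of "of_real \<sigma>"] s by simp
    also have "\<dots> \<le> C * 3\<^sup>2" using s C by (intro mult_left_mono power_mono) auto
    finally show "zeta_re \<sigma> \<le> 9 * C / (\<sigma> - 1)" using s by (simp add: field_simps)
  qed (use C in auto)
qed

section \<open>The 3-4-1 inequality\<close>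

lemma cos_341_nonneg: "3 + 4 * cos x + cos (2 * x) \<ge> (0::real)"
proof -
  have "3 + 4 * cos x + cos (2 * x) = 2 * (1 + cos x)\<^sup>2"
    unfolding cos_double_cos by (simp add: power2_eq_square algebra_simps)
  then show ?thesis by simp
qed

text \<open>The real part of the power series of - Ln (1 - w). The term k = 0 is 1 / 0, which is
  0.\<close>

lemma ln_norm_one_minus_sums:
  fixes w :: complex
  assumes "norm w < 1"
  shows "(\<lambda>k. Re (w ^ k) / real k) sums (- ln (norm (1 - w)))"
proof -
  have "(\<lambda>n. - ((- (- w)) ^ n) / of_nat n) sums Ln (1 + (- w))"
    using assms by (intro Ln_series') simp
  then have "(\<lambda>n. - (w ^ n) / of_nat n) sums Ln (1 - w)" by simp
  then have "(\<lambda>n. Re (- (w ^ n) / of_nat n)) sums Re (Ln (1 - w))" by (rule sums_Re)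
  then have "(\<lambda>n. - Re (- (w ^ n) / of_nat n)) sums (- Re (Ln (1 - w)))" by (rule sums_minus)
  moreover have "1 - w \<noteq> 0" using assms by auto
  ultimately show ?thesis by (simp add: Re_divide_of_nat)
qed

text \<open>The contribution of p to the logarithm of \<zeta>(\<sigma>)^3 * \<bar>\<zeta>(\<sigma> +
  i t)\<bar>^4 * \<bar>\<zeta>(\<sigma> + 2 i t)\<bar>.\<close>

definition log341 :: "real \<Rightarrow> real \<Rightarrow> nat \<Rightarrow> real" where
  "log341 t \<sigma> p = - 3 * ln (norm (1 - of_nat p powr (- Complex \<sigma> 0) :: complex))
     - 4 * ln (norm (1 - of_nat p powr (- Complex \<sigma> t) :: complex))
     - ln (norm (1 - of_nat p powr (- Complex \<sigma> (2 * t)) :: complex))"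

lemma Re_powr_power:
  assumes "p \<ge> 1"
  shows "Re ((of_nat p powr (- Complex \<sigma> t)) ^ k) = real p powr (- \<sigma> * real k) * cos (real k * t * ln (real p))"
proof -
  have "(of_nat p powr (- Complex \<sigma> t) :: complex) = exp (- Complex \<sigma> t * of_real (ln (real p)))"
    using assms by (simp add: powr_def Ln_of_nat)
  then have "(of_nat p powr (- Complex \<sigma> t)) ^ k = exp (of_nat k * (- Complex \<sigma> t * of_real (ln (real p))))"
    by (simp only: exp_of_nat_mult)
  then have "Re ((of_nat p powr (- Complex \<sigma> t)) ^ k) = exp (- (real k * \<sigma> * ln (real p))) * cos (real k * t * ln (real p))"
    by (simp add: Re_exp mult_ac)
  moreover have "exp (- (real k * \<sigma> * ln (real p))) = real p powr (- \<sigma> * real k)"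
    using assms by (simp add: powr_def mult_ac)
  ultimately show ?thesis by simp
qed

lemma log341_sums:
  assumes "p \<ge> 2" "\<sigma> > 0"
  shows "(\<lambda>k. real p powr (- \<sigma> * real k) * (3 + 4 * cos (real k * t * ln (real p)) + cos (2 * (real k * t * ln (real p)))) / real k)
     sums log341 t \<sigma> p"
proof -
  let ?w = "\<lambda>u. of_nat p powr (- Complex \<sigma> u) :: complex"
  let ?c = "\<lambda>u k. Re (?w u ^ k) / real k"
  have lt: "norm (?w u) < 1" for u
    using assms powr_less_one[of "real p" "- \<sigma>"] by (simp add: norm_of_nat_powr)
  have "(\<lambda>k. 3 * ?c 0 k + 4 * ?c t k + ?c (2 * t) k) sums
     (3 * (- ln (norm (1 - ?w 0))) + 4 * (- ln (norm (1 - ?w t))) + - ln (norm (1 - ?w (2 * t))))"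
    by (intro sums_add sums_mult ln_norm_one_minus_sums lt)
  also have "3 * (- ln (norm (1 - ?w 0))) + 4 * (- ln (norm (1 - ?w t))) + - ln (norm (1 - ?w (2 * t))) = log341 t \<sigma> p"
    by (simp add: log341_def)
  also have "(\<lambda>k. 3 * ?c 0 k + 4 * ?c t k + ?c (2 * t) k) =
     (\<lambda>k. real p powr (- \<sigma> * real k) * (3 + 4 * cos (real k * t * ln (real p)) + cos (2 * (real k * t * ln (real p)))) / real k)"
    using assms by (simp add: Re_powr_power add_divide_distrib distrib_left mult_ac)
  finally show ?thesis .
qed

text \<open>In the expansion of the logarithms each p powr (- \<sigma> k) / k is multiplied by the
  nonnegative trigonometric polynomial 3 + 4 cos + cos, and these powers decrease in
  \<sigma>.\<close>

lemma log341_antimono: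
  assumes "p \<ge> 2" "0 < \<sigma>" "\<sigma> \<le> \<sigma>'"
  shows "log341 t \<sigma>' p \<le> log341 t \<sigma> p"
proof (rule sums_le[OF _ log341_sums log341_sums])
  fix k
  have "real p powr (- \<sigma>' * real k) \<le> real p powr (- \<sigma> * real k)"
    using assms by (intro powr_mono mult_right_mono) auto
  then show "real p powr (- \<sigma>' * real k) * (3 + 4 * cos (real k * t * ln (real p)) + cos (2 * (real k * t * ln (real p)))) / real k
    \<le> real p powr (- \<sigma> * real k) * (3 + 4 * cos (real k * t * ln (real p)) + cos (2 * (real k * t * ln (real p)))) / real k"
    by (intro divide_right_mono mult_right_mono cos_341_nonneg) auto
qed (use assms in auto)


text \<open>Dividing f by its value at the point moves the argument of Ln to 1, away from the branch
  cut; the constant ln (norm (f ?s)) is added back afterwards.\<close>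

lemma DERIV_ln_norm:
  fixes f :: "complex \<Rightarrow> complex"
  assumes "f holomorphic_on A" "open A" "Complex x u \<in> A" "f (Complex x u) \<noteq> 0"
  shows "((\<lambda>x. ln (norm (f (Complex x u)))) has_real_derivative
           Re (deriv f (Complex x u) / f (Complex x u))) (at x)"
proof -
  let ?s = "Complex x u"
  have eq: "Complex y u = of_real y + \<i> * of_real u" for y by (simp add: complex_eq_iff)
  have df: "(f has_field_derivative deriv f ?s) (at (of_real x + \<i> * of_real u))"
    using holomorphic_derivI[OF assms(1,2,3)] by (simp add: eq)
  have "((\<lambda>z. f (z + \<i> * of_real u)) has_field_derivative deriv f ?s * 1) (at (of_real x))"
    by (rule DERIV_chain2[where f = f and g = "\<lambda>z. z + \<i> * of_real u", OF df]) (auto intro!: derivative_eq_intros)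
  then have "((\<lambda>z. f (z + \<i> * of_real u) / f ?s) has_field_derivative deriv f ?s / f ?s) (at (of_real x))"
    by (intro DERIV_cdivide) simp
  moreover have one: "f (of_real x + \<i> * of_real u) / f ?s = 1" using assms(4) by (simp add: eq)
  moreover have "(Ln has_field_derivative 1) (at (f (of_real x + \<i> * of_real u) / f ?s))"
    unfolding one by (auto intro!: derivative_eq_intros)
  ultimately have "((\<lambda>z. Ln (f (z + \<i> * of_real u) / f ?s)) has_field_derivative deriv f ?s / f ?s) (at (of_real x))"
    using DERIV_chain2[of Ln 1 "\<lambda>z. f (z + \<i> * of_real u) / f ?s"] by fastforce
  then have "((\<lambda>y. Ln (f (of_real y + \<i> * of_real u) / f ?s)) has_vector_derivative deriv f ?s / f ?s) (at x)"
    by (rule has_vector_derivative_real_field)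
  then have "((\<lambda>y. Re (Ln (f (of_real y + \<i> * of_real u) / f ?s))) has_vector_derivative Re (deriv f ?s / f ?s)) (at x)"
    by (rule bounded_linear.has_vector_derivative[OF bounded_linear_Re])
  then have d: "((\<lambda>y. Re (Ln (f (Complex y u) / f ?s))) has_real_derivative Re (deriv f ?s / f ?s)) (at x)"
    unfolding has_real_derivative_iff_has_vector_derivative[symmetric] eq[symmetric] .
  from DERIV_add[OF d DERIV_const[of "ln (norm (f ?s))"]]
  have *: "((\<lambda>y. Re (Ln (f (Complex y u) / f ?s)) + ln (norm (f ?s))) has_real_derivative Re (deriv f ?s / f ?s)) (at x)"
    by simp
  have "isCont (\<lambda>y. complex_of_real y + \<i> * of_real u) x" by (intro continuous_intros)
  from isCont_o2[OF this DERIV_isCont[OF df]]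
  have "isCont (\<lambda>y. f (of_real y + \<i> * of_real u)) x" .
  then have "(\<lambda>y. f (Complex y u)) \<midarrow>x\<rightarrow> f (Complex x u)" by (simp add: isCont_def eq)
  then have "\<forall>\<^sub>F y in at x. f (Complex y u) \<noteq> 0" using assms(4) by (rule tendsto_imp_eventually_ne)
  then have "\<forall>\<^sub>F y in nhds x. f (Complex y u) \<noteq> 0" using assms(4) by (simp add: eventually_nhds_conv_at)
  then have ev: "\<forall>\<^sub>F y in nhds x. Re (Ln (f (Complex y u) / f ?s)) + ln (norm (f ?s)) = ln (norm (f (Complex y u)))"
    by eventually_elim (use assms(4) in \<open>simp add: norm_divide ln_div\<close>)
  show ?thesis
    by (rule DERIV_cong_ev[OF refl ev refl, THEN iffD1, OF *])
qed

abbreviation zeta_log_deriv :: "complex \<Rightarrow> complex" where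
  "zeta_log_deriv s \<equiv> deriv zeta_reg s / zeta_reg s"

text \<open>Usually read off from the Dirichlet series of the logarithmic derivative. Here the
  combination D of the three logarithms is a limit of sums of \<open>log341\<close> and thus
  nonincreasing in the real part, so a positive derivative is impossible. The terms 1 / Complex
  \<delta> u are the logarithmic derivative of s - 1, which separates \<open>zeta_reg\<close> from
  \<zeta>.\<close>

lemma zeta_341:
  assumes "\<delta> > 0"
  shows "3 * Re (zeta_log_deriv (Complex (1 + \<delta>) 0) - 1 / Complex \<delta> 0)
     + 4 * Re (zeta_log_deriv (Complex (1 + \<delta>) t) - 1 / Complex \<delta> t)
     + Re (zeta_log_deriv (Complex (1 + \<delta>) (2 * t)) - 1 / Complex \<delta> (2 * t)) \<le> 0"
    (is "?d \<le> 0")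
proof (rule ccontr)
  assume pos: "\<not> ?d \<le> 0"
  let ?L = "\<lambda>u x. ln (norm (zeta_reg (Complex x u))) - ln (norm (Complex x u - 1))"
  define D where "D x = 3 * ?L 0 x + 4 * ?L t x + ?L (2 * t) x" for x
  have dL: "(?L u has_real_derivative Re (zeta_log_deriv (Complex (1 + \<delta>) u) - 1 / Complex \<delta> u)) (at (1 + \<delta>))" for u
  proof -
    have op: "open {s::complex. Re s > 0}" by (simp add: open_halfspace_Re_gt)
    have "((\<lambda>x. ln (norm (Complex x u - 1))) has_real_derivative
        Re (deriv (\<lambda>s. s - 1) (Complex (1 + \<delta>) u) / (Complex (1 + \<delta>) u - 1))) (at (1 + \<delta>))"
      using assms by (intro DERIV_ln_norm[where A = UNIV] holomorphic_intros) (auto simp: complex_eq_iff)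
    moreover have "deriv (\<lambda>s. s - 1) (Complex (1 + \<delta>) u) = 1"
      by (intro DERIV_imp_deriv) (auto intro!: derivative_eq_intros)
    moreover have "Complex (1 + \<delta>) u - 1 = Complex \<delta> u" by (simp add: complex_eq_iff)
    moreover have "((\<lambda>x. ln (norm (zeta_reg (Complex x u)))) has_real_derivative
        Re (zeta_log_deriv (Complex (1 + \<delta>) u))) (at (1 + \<delta>))"
      using assms zeta_reg_nonzero[of "Complex (1 + \<delta>) u"]
      by (intro DERIV_ln_norm[OF holomorphic_zeta_reg op]) auto
    ultimately show ?thesis unfolding minus_complex.sel by (intro DERIV_diff) simp_all
  qed
  have "(D has_real_derivative ?d) (at (1 + \<delta>))"
    unfolding D_def by (intro DERIV_add DERIV_cmult dL)
  then obtain e where e: "e > 0" "\<forall>h>0. h < e \<longrightarrow> D (1 + \<delta>) < D (1 + \<delta> + h)"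
    using has_real_derivative_pos_inc_right[of D ?d "1 + \<delta>" UNIV] pos by auto
  have lim: "(\<lambda>N. \<Sum>p | prime p \<and> p \<le> N. log341 t x p) \<longlonglongrightarrow> D x" if x: "x > 1" for x
  proof -
    have "(\<lambda>N. - ln (norm (euler_inv N (Complex x u)))) \<longlonglongrightarrow> ?L u x" for u
    proof -
      have nz: "zeta_reg (Complex x u) \<noteq> 0" "Complex x u - 1 \<noteq> 0"
        using zeta_reg_nonzero[of "Complex x u"] x by (auto simp: complex_eq_iff)
      have "(\<lambda>N. - ln (norm (euler_inv N (Complex x u)))) \<longlonglongrightarrow> - ln (norm ((Complex x u - 1) / zeta_reg (Complex x u)))"
        using nz x by (intro tendsto_intros euler_inv_tendsto) auto
      then show ?thesis using nz by (simp add: norm_divide ln_div)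
    qed
    then have "(\<lambda>N. 3 * (- ln (norm (euler_inv N (Complex x 0)))) + 4 * (- ln (norm (euler_inv N (Complex x t))))
        + (- ln (norm (euler_inv N (Complex x (2 * t)))))) \<longlonglongrightarrow> D x"
      unfolding D_def by (intro tendsto_add tendsto_mult_left)
    moreover have "3 * (- ln (norm (euler_inv N (Complex x 0)))) + 4 * (- ln (norm (euler_inv N (Complex x t))))
        + (- ln (norm (euler_inv N (Complex x (2 * t))))) = (\<Sum>p | prime p \<and> p \<le> N. log341 t x p)" for N
    proof -
      have "ln (norm (euler_inv N (Complex x u))) = (\<Sum>p | prime p \<and> p \<le> N. ln (norm (1 - of_nat p powr (- Complex x u) :: complex)))" for u
        unfolding euler_inv_def prod_norm[symmetric]
      proof (rule ln_prod)
        fix p :: nat assume "p \<in> {p. prime p \<and> p \<le> N}"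
        then have "norm (of_nat p powr (- Complex x u) :: complex) < 1"
          using x prime_powr_less_1[of p x] prime_ge_1_nat[of p] by (simp add: norm_of_nat_powr)
        then show "norm (1 - of_nat p powr (- Complex x u) :: complex) \<noteq> 0" by auto
      qed auto
      then show ?thesis
        by (simp add: log341_def sum_subtractf sum_negf sum_distrib_left[symmetric])
    qed
    ultimately show ?thesis by simp
  qed
  have "D (1 + \<delta> + e / 2) \<le> D (1 + \<delta>)"
  proof (rule LIMSEQ_le[OF lim lim])
    show "\<exists>N. \<forall>n\<ge>N. (\<Sum>p | prime p \<and> p \<le> n. log341 t (1 + \<delta> + e / 2) p) \<le> (\<Sum>p | prime p \<and> p \<le> n. log341 t (1 + \<delta>) p)"
      using assms e by (intro exI[of _ 0] allI impI sum_mono log341_antimono) (auto intro: prime_ge_2_nat)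
  qed (use assms e in auto)
  moreover have "D (1 + \<delta>) < D (1 + \<delta> + e / 2)" using e by auto
  ultimately show False by simp
qed

section \<open>Logarithmic derivatives and Blaschke factors\<close>

text \<open>The half-plane Re w < M consists of points closer to 0 than to 2 M, so w / (2 M - w)
  maps it into the unit disc and fixes 0. The Schwarz lemma applies to the composition with g,
  rescaled to the unit disc.\<close>

lemma borel_caratheodory:
  fixes g :: "complex \<Rightarrow> complex"
  assumes holg: "g holomorphic_on ball c r" and r: "r > 0" and M: "M > 0" and g0: "g c = 0"
    and Re_less: "\<And>z. z \<in> ball c r \<Longrightarrow> Re (g z) < M"
  shows "norm (deriv g c) \<le> 2 * M / r"
    and "z \<in> ball c r \<Longrightarrow> norm (g z) \<le> 2 * M * dist c z / (r - dist c z)"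
proof -
  define h where "h w = g (c + of_real r * w) / (of_real (2 * M) - g (c + of_real r * w))" for w
  have mem: "c + of_real r * w \<in> ball c r" if "norm w < 1" for w
    using that r by (simp add: dist_norm norm_mult)
  have nz: "of_real (2 * M) - g z \<noteq> 0" if "z \<in> ball c r" for z
    using Re_less[OF that] M by (auto simp: complex_eq_iff)
  have lt: "norm (g z) < norm (of_real (2 * M) - g z)" if "z \<in> ball c r" for z
  proof -
    have "(norm (g z))\<^sup>2 < (norm (of_real (2 * M) - g z))\<^sup>2"
      using mult_strict_left_mono[OF Re_less[OF that] M]
      unfolding cmod_power2 by (simp add: power2_eq_square algebra_simps)
    then show ?thesis by (rule power2_less_imp_less) simp
  qed
  have holh: "h holomorphic_on ball 0 1"
  proof -
    have "(g \<circ> (\<lambda>w. c + of_real r * w)) holomorphic_on ball 0 1"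
      by (rule holomorphic_on_compose_gen[OF _ holg]) (use mem in \<open>auto intro!: holomorphic_intros simp: image_subset_iff\<close>)
    then show ?thesis unfolding h_def o_def using nz mem
      by (intro holomorphic_intros) auto
  qed
  have h0: "h 0 = 0" using g0 by (simp add: h_def)
  have hlt: "norm (h w) < 1" if "norm w < 1" for w
    using lt[OF mem[OF that]] nz[OF mem[OF that]] by (simp add: h_def norm_divide divide_simps)
  have "(g has_field_derivative deriv g c) (at (c + of_real r * 0))"
    using holomorphic_derivI[OF holg, of c] r by simp
  then have "((\<lambda>w. g (c + of_real r * w)) has_field_derivative deriv g c * of_real r) (at 0)"
    by (rule DERIV_chain2) (auto intro!: derivative_eq_intros)
  then have "(h has_field_derivative (deriv g c * of_real r * of_real (2 * M)) / (of_real (2 * M) * of_real (2 * M))) (at 0)"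
    unfolding h_def using M g0 by (auto intro!: derivative_eq_intros)
  then have "deriv h 0 = deriv g c * of_real r / of_real (2 * M)"
    using M by (auto dest!: DERIV_imp_deriv)
  moreover have "norm (deriv h 0) \<le> 1"
    using Schwarz_Lemma(2)[OF holh h0 hlt, of 0] by simp
  ultimately have "norm (deriv g c) * r / (2 * M) \<le> 1" using r M by (simp add: norm_divide norm_mult)
  then show "norm (deriv g c) \<le> 2 * M / r" using r M by (simp add: field_simps)
  assume z: "z \<in> ball c r"
  define w where "w = (z - c) / of_real r"
  have w: "norm w = dist c z / r" "norm w < 1" "c + of_real r * w = z"
    using z r by (auto simp: w_def norm_divide dist_norm norm_minus_commute)
  have hw: "norm (h w) \<le> norm w" using Schwarz_Lemma(1)[OF holh h0 hlt w(2)] by simp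
  have "h w = g z / (of_real (2 * M) - g z)" by (simp add: h_def w(3))
  then have gz: "g z * (1 + h w) = of_real (2 * M) * h w"
    using nz[OF z] by (simp add: field_simps)
  have "norm (g z) * (1 - norm w) \<le> norm (g z) * norm (1 + h w)"
    using hw norm_triangle_ineq2[of 1 "- h w"] by (intro mult_left_mono) auto
  also have "\<dots> = 2 * M * norm (h w)" using arg_cong[OF gz, of norm] M by (simp add: norm_mult)
  also have "\<dots> \<le> 2 * M * norm w" using hw M by simp
  finally have "norm (g z) \<le> 2 * M * norm w / (1 - norm w)"
    using w(2) by (simp add: pos_le_divide_eq)
  also have "\<dots> = 2 * M * dist c z / (r - dist c z)"
    using r z unfolding w(1) by (simp add: divide_simps)
  finally show "norm (g z) \<le> 2 * M * dist c z / (r - dist c z)" .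
qed

text \<open>Without zeros, f / f c has a holomorphic logarithm vanishing at c, whose real part is
  below M by the growth bound. Borel and Caratheodory then bound its derivative at c, and a lower
  bound for its real part is a lower bound for the modulus of f.\<close>

lemma holomorphic_nonzero_bounds:
  fixes f :: "complex \<Rightarrow> complex"
  assumes holf: "f holomorphic_on ball c r" and r: "r > 0" and M: "M > 0"
    and nz: "\<And>z. z \<in> ball c r \<Longrightarrow> f z \<noteq> 0"
    and bd: "\<And>z. z \<in> ball c r \<Longrightarrow> norm (f z) < exp M * norm (f c)"
  shows "norm (deriv f c / f c) \<le> 2 * M / r"
    and "z \<in> ball c r \<Longrightarrow> norm (f c) * exp (- (2 * M * dist c z / (r - dist c z))) \<le> norm (f z)"
proof -
  obtain l where l: "l holomorphic_on ball c r" "\<And>z. z \<in> ball c r \<Longrightarrow> exp (l z) = f z"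
    using holomorphic_logarithm_exists[of "ball c r" f c] holf nz r by auto
  define g where "g z = l z - l c" for z
  have holg: "g holomorphic_on ball c r" unfolding g_def by (intro holomorphic_intros l)
  have g0: "g c = 0" by (simp add: g_def)
  have c: "c \<in> ball c r" using r by simp
  have fg: "f z = f c * exp (g z)" if "z \<in> ball c r" for z
    using l(2)[OF that] l(2)[OF c] by (simp add: g_def exp_diff nz[OF c])
  have Re_less: "Re (g z) < M" if "z \<in> ball c r" for z
  proof -
    have "norm (f c) * exp (Re (g z)) < exp M * norm (f c)"
      using bd[OF that] fg[OF that] by (simp add: norm_mult)
    then show ?thesis using nz[OF c] by (simp add: mult.commute)
  qed
  note bc = borel_caratheodory[OF holg r M g0 Re_less]
  have "(g has_field_derivative deriv g c) (at c)"
    using holomorphic_derivI[OF holg _ c] by simp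
  then have "((\<lambda>z. f c * exp (g z)) has_field_derivative f c * deriv g c) (at c)"
    by (auto intro!: derivative_eq_intros simp: g0)
  then have "(f has_field_derivative f c * deriv g c) (at c)"
    by (rule has_field_derivative_transform_within_open[where S = "ball c r"]) (use c in \<open>auto simp: fg[symmetric]\<close>)
  then have "deriv f c = f c * deriv g c" by (rule DERIV_imp_deriv)
  then show "norm (deriv f c / f c) \<le> 2 * M / r" using bc(1) nz[OF c] by simp
  assume z: "z \<in> ball c r"
  have "- norm (g z) \<le> Re (g z)" using abs_Re_le_cmod[of "g z"] by linarith
  then have "- (2 * M * dist c z / (r - dist c z)) \<le> Re (g z)" using bc(2)[OF _ z] by simp
  then show "norm (f c) * exp (- (2 * M * dist c z / (r - dist c z))) \<le> norm (f z)"
    unfolding fg[OF z] by (simp add: norm_mult mult_left_mono)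
qed

text \<open>f is multiplied by (r^2 - cnj \<rho> z) / (r (z - \<rho>)). This has modulus 1 on the
  circle of radius r, since there r^2 = z * cnj z, and its numerator vanishes only outside that
  circle. The logarithmic derivative at the centre changes by an explicit amount.\<close>

lemma blaschke_divide:
  fixes f :: "complex \<Rightarrow> complex"
  assumes holf: "f holomorphic_on ball 0 R" and r: "0 < r" "r < R" and \<rho>: "f \<rho> = 0" "norm \<rho> < r" "\<rho> \<noteq> 0"
    and f0: "f 0 \<noteq> 0"
  obtains g where "g holomorphic_on ball 0 R" "\<forall>z. norm z = r \<longrightarrow> norm (g z) = norm (f z)"
    "norm (g 0) = norm (f 0) * r / norm \<rho>"
    "\<forall>z. norm z \<le> r \<longrightarrow> g z = 0 \<longrightarrow> f z = 0"
    "- Re (deriv f 0 / f 0) = - Re (deriv g 0 / g 0) + (Re \<rho> / (norm \<rho>)\<^sup>2 - Re \<rho> / r\<^sup>2)"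
proof -
  define k where "k z = (if z = \<rho> then deriv f \<rho> else (f z - f \<rho>) / (z - \<rho>))" for z
  have holk: "k holomorphic_on ball 0 R"
    unfolding k_def by (rule pole_lemma_open[OF holf open_ball])
  have fk: "f z = (z - \<rho>) * k z" for z using \<rho> by (simp add: k_def)
  define g where "g z = k z * ((of_real (r\<^sup>2) - cnj \<rho> * z) / of_real r)" for z
  have k0: "k 0 \<noteq> 0" using f0 fk[of 0] by auto
  show ?thesis
  proof (rule that)
    show "g holomorphic_on ball 0 R" unfolding g_def using r by (intro holomorphic_intros holk) auto
    show "\<forall>z. norm z = r \<longrightarrow> norm (g z) = norm (f z)"
    proof (intro allI impI)
      fix z :: complex assume z: "norm z = r"
      have "of_real (r\<^sup>2) - cnj \<rho> * z = z * cnj (z - \<rho>)"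
        using complex_norm_square[of z] z by (simp add: algebra_simps)
      then have "norm (of_real (r\<^sup>2) - cnj \<rho> * z) = r * norm (z - \<rho>)"
        by (simp only: norm_mult complex_mod_cnj z)
      then show "norm (g z) = norm (f z)" using r by (simp add: g_def fk norm_mult norm_divide)
    qed
    show "norm (g 0) = norm (f 0) * r / norm \<rho>"
      using r \<rho> by (simp add: g_def fk[of 0] norm_mult norm_divide power2_eq_square)
    show "\<forall>z. norm z \<le> r \<longrightarrow> g z = 0 \<longrightarrow> f z = 0"
    proof (intro allI impI)
      fix z :: complex assume z: "norm z \<le> r" "g z = 0"
      have "of_real (r\<^sup>2) - cnj \<rho> * z \<noteq> 0"
      proof
        assume "of_real (r\<^sup>2) - cnj \<rho> * z = 0"
        then have "norm (cnj \<rho> * z) = norm (complex_of_real (r\<^sup>2))" by simp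
        then have "norm \<rho> * norm z = r\<^sup>2" 
          by (simp only: norm_mult complex_mod_cnj norm_of_real) simp
        moreover have "norm \<rho> * norm z \<le> norm \<rho> * r" using z by (intro mult_left_mono) auto
        moreover have "norm \<rho> * r < r * r" using \<rho> r by simp
        ultimately show False by (simp add: power2_eq_square)
      qed
      then show "f z = 0" using z r by (simp add: g_def fk)
    qed
    have dk: "(k has_field_derivative deriv k 0) (at 0)"
      using holomorphic_derivI[OF holk, of 0] r by simp
    have "((\<lambda>z. (z - \<rho>) * k z) has_field_derivative (k 0 - \<rho> * deriv k 0)) (at 0)"
      using dk by (auto intro!: derivative_eq_intros)
    then have df: "deriv f 0 = k 0 - \<rho> * deriv k 0" using fk[abs_def] by (auto dest: DERIV_imp_deriv)
    have "(g has_field_derivative (deriv k 0 * of_real r - k 0 * cnj \<rho> / of_real r)) (at 0)"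
      unfolding g_def using dk r by (auto intro!: derivative_eq_intros simp: power2_eq_square field_simps)
    then have dg: "deriv g 0 = deriv k 0 * of_real r - k 0 * cnj \<rho> / of_real r" by (rule DERIV_imp_deriv)
    have g0: "g 0 = k 0 * of_real r" using r by (simp add: g_def power2_eq_square)
    have "deriv f 0 / f 0 = deriv k 0 / k 0 - 1 / \<rho>"
      using k0 \<rho> by (simp add: df fk[of 0] field_simps)
    moreover have "deriv g 0 / g 0 = deriv k 0 / k 0 - cnj \<rho> / of_real (r\<^sup>2)"
      using k0 r by (simp add: dg g0 field_simps power2_eq_square)
    moreover have "Re (1 / \<rho>) = Re \<rho> / (norm \<rho>)\<^sup>2" by (simp add: Re_divide cmod_power2)
    moreover have "Re (cnj \<rho> / of_real (r\<^sup>2)) = Re \<rho> / r\<^sup>2" by (simp only: Re_divide_of_real complex_cnj cnj.sel)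
    ultimately show "- Re (deriv f 0 / f 0) = - Re (deriv g 0 / g 0) + (Re \<rho> / (norm \<rho>)\<^sup>2 - Re \<rho> / r\<^sup>2)"
      by simp
  qed
qed

text \<open>The sign that allows zeros to the left of the centre to be dropped from an upper bound
  for the negative real part of the logarithmic derivative.\<close>

lemma neg_Re_le_0:
  assumes "Re \<rho> < 0" "norm \<rho> \<le> r" "r > 0"
  shows "Re \<rho> / (norm \<rho>)\<^sup>2 - Re \<rho> / r\<^sup>2 \<le> 0"
proof -
  have "norm \<rho> > 0" using assms by auto
  then have "1 / r\<^sup>2 \<le> 1 / (norm \<rho>)\<^sup>2"
    using assms by (intro divide_left_mono power_mono) auto
  then have "- Re \<rho> * (1 / r\<^sup>2) \<le> - Re \<rho> * (1 / (norm \<rho>)\<^sup>2)" using assms by (intro mult_left_mono) auto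
  then show ?thesis by simp
qed

lemma max_modulus_cball:
  fixes f :: "complex \<Rightarrow> complex"
  assumes "f holomorphic_on ball 0 R" "0 < r" "r < R" "\<And>z. norm z = r \<Longrightarrow> norm (f z) \<le> B" "norm z \<le> r"
  shows "norm (f z) \<le> B"
proof (rule maximum_modulus_frontier[of f "cball 0 r"])
  show "f holomorphic_on interior (cball 0 r)"
    by (rule holomorphic_on_subset[OF assms(1)]) (use assms in auto)
  show "continuous_on (closure (cball 0 r)) f"
    using assms by (intro holomorphic_on_imp_continuous_on holomorphic_on_subset[OF assms(1)]) auto
qed (use assms in auto)

text \<open>Dividing out a zero \<open>\<rho>\<close> multiplies the value at the centre by \<open>r / \<bar>\<rho>\<bar> \<ge> r / r1\<close>. By the maximum modulus
  principle this value stays below \<open>B\<close>, so \<open>n\<close> bounds the number of divisions and no multiplicities have to be counted.\<close>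
lemma neg_log_deriv_le_induct:
  fixes f :: "complex \<Rightarrow> complex"
  assumes "f holomorphic_on ball 0 R" "0 < r" "r < R" "f 0 \<noteq> 0"
    and "\<And>z. norm z = r \<Longrightarrow> norm (f z) \<le> B" "B < B'" "0 < r1" "r1 < r"
    and "\<And>z. norm z \<le> r \<Longrightarrow> f z = 0 \<Longrightarrow> Re z < 0 \<and> norm z \<le> r1"
    and "norm (f 0) * (r / r1) ^ n > B"
  shows "- Re (deriv f 0 / f 0) \<le> 2 / r * ln (B' / norm (f 0))"
  using assms
proof (induction n arbitrary: f)
  case 0
  have "norm (0::complex) \<le> r" using \<open>0 < r\<close> by simp
  from max_modulus_cball[OF 0(1,2,3,5) this] have "norm (f 0) \<le> B" .
  with 0(10) show ?case by simp
next
  case (Suc n)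
  note p = Suc.prems
  have B: "norm (f z) \<le> B" if "norm z \<le> r" for z
    by (rule max_modulus_cball[OF p(1,2,3,5) that])
  have f0: "norm (f 0) > 0" "norm (f 0) < B'" using p(4,6) B[of 0] p(2) by auto
  show ?case
  proof (cases "\<exists>z. norm z \<le> r \<and> f z = 0")
    case False
    define M where "M = ln (B' / norm (f 0))"
    have M: "M > 0" unfolding M_def using f0 by (intro ln_gt_zero) (simp add: pos_less_divide_eq)
    have q: "B' / norm (f 0) > 0" using f0 by (intro divide_pos_pos) linarith+
    have eM: "exp M * norm (f 0) = B'" unfolding M_def exp_ln[OF q] using f0(1) by simp
    have "norm (deriv f 0 / f 0) \<le> 2 * M / r"
    proof (rule holomorphic_nonzero_bounds(1)[OF _ p(2) M])
      show "f holomorphic_on ball 0 r" by (rule holomorphic_on_subset[OF p(1)]) (use p in auto)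
      show "f z \<noteq> 0" if "z \<in> ball 0 r" for z using False that by auto
      show "norm (f z) < exp M * norm (f 0)" if "z \<in> ball 0 r" for z
        unfolding eM using B[of z] that p(6) by auto
    qed
    then show ?thesis using abs_Re_le_cmod[of "deriv f 0 / f 0"] by (simp add: M_def)
  next
    case True
    then obtain \<rho> where \<rho>: "norm \<rho> \<le> r" "f \<rho> = 0" by blast
    have \<rho>': "Re \<rho> < 0" "norm \<rho> \<le> r1" using p(9) \<rho> by auto
    then have n0: "\<rho> \<noteq> 0" "norm \<rho> > 0" by auto
    have "norm \<rho> < r" using \<rho>' p(8) by simp
    obtain g where g: "g holomorphic_on ball 0 R" "\<forall>z. norm z = r \<longrightarrow> norm (g z) = norm (f z)"
      "norm (g 0) = norm (f 0) * r / norm \<rho>" "\<forall>z. norm z \<le> r \<longrightarrow> g z = 0 \<longrightarrow> f z = 0"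
      "- Re (deriv f 0 / f 0) = - Re (deriv g 0 / g 0) + (Re \<rho> / (norm \<rho>)\<^sup>2 - Re \<rho> / r\<^sup>2)"
      by (rule blaschke_divide[OF p(1-3) \<rho>(2) \<open>norm \<rho> < r\<close> n0(1) p(4)])
    have ge: "norm (g 0) \<ge> norm (f 0) * (r / r1)"
      unfolding g(3) using \<rho>' n0 p f0 by (simp add: frac_le)
    moreover have "norm (f 0) * 1 \<le> norm (f 0) * (r / r1)" using p f0 by (intro mult_left_mono) auto
    ultimately have ge': "norm (g 0) \<ge> norm (f 0)" by simp
    have "norm (f 0) * (r / r1) * (r / r1) ^ n \<le> norm (g 0) * (r / r1) ^ n"
      using ge p(2,7) by (intro mult_right_mono) auto
    then have big: "norm (g 0) * (r / r1) ^ n > B" using p(10) by (simp add: mult_ac)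
    have gp: "norm (g 0) > 0" using ge' f0(1) by linarith
    have "- Re (deriv g 0 / g 0) \<le> 2 / r * ln (B' / norm (g 0))"
    proof (rule Suc.IH[OF g(1) p(2,3) _ _ p(6-8) _ big])
      show "g 0 \<noteq> 0" using gp by auto
      show "norm (g z) \<le> B" if "norm z = r" for z using g(2) p(5) that by simp
      show "Re z < 0 \<and> norm z \<le> r1" if "norm z \<le> r" "g z = 0" for z
        using g(4) p(9) that by blast
    qed
    also have "\<dots> \<le> 2 / r * ln (B' / norm (f 0))"
      using ge' gp f0 p(2) by (intro mult_left_mono ln_mono divide_left_mono mult_pos_pos divide_pos_pos divide_nonneg_pos) linarith+
    finally show ?thesis using g(5) neg_Re_le_0[OF \<rho>'(1) \<rho>(1) p(2)] by linarith
  qed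
qed

text \<open>Landau's local form of the Hadamard factorisation, one-sided: all zeros lie to the left
  of the centre and are dropped, except that a single one may be kept, with its term of order 1 /
  \<bar>z0 - c\<bar>.\<close>

lemma neg_log_deriv_le:
  fixes f :: "complex \<Rightarrow> complex"
  assumes holf: "f holomorphic_on ball c R" and r0: "0 < r0" "r0 < R" and fc: "f c \<noteq> 0"
    and bd: "\<And>z. z \<in> ball c R \<Longrightarrow> norm (f z) \<le> exp M * norm (f c)"
    and zeros: "\<And>z. z \<in> ball c R \<Longrightarrow> f z = 0 \<Longrightarrow> Re z < Re c" and M: "M \<ge> 0"
  shows "- Re (deriv f c / f c) \<le> 2 * (M + 1) / r0"
    and "z0 \<in> ball c r0 \<Longrightarrow> f z0 = 0 \<Longrightarrow>
      - Re (deriv f c / f c) \<le> 2 * (M + 1) / r0 + Re (z0 - c) / (norm (z0 - c))\<^sup>2 - Re (z0 - c) / r0\<^sup>2"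
proof -
  define h where "h z = f (c + z)" for z
  have mem: "c + z \<in> ball c R" if "norm z < R" for z using that by (simp add: dist_norm)
  have holh: "h holomorphic_on ball 0 R"
  proof -
    have "(f \<circ> (\<lambda>z. c + z)) holomorphic_on ball 0 R"
      by (rule holomorphic_on_compose_gen[OF _ holf]) (use mem in \<open>auto intro!: holomorphic_intros simp: image_subset_iff\<close>)
    then show ?thesis by (simp add: h_def[abs_def] o_def)
  qed
  have h0: "h 0 = f c" "h 0 \<noteq> 0" using fc by (auto simp: h_def)
  have dh: "deriv h 0 = deriv f c"
  proof -
    have "(f has_field_derivative deriv f c) (at (c + 0))"
      using holomorphic_derivI[OF holf, of c] r0 by simp
    then have "((\<lambda>z. f (c + z)) has_field_derivative deriv f c * 1) (at 0)"
      by (rule DERIV_chain2) (auto intro!: derivative_eq_intros)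
    then have "(h has_field_derivative deriv f c) (at 0)" by (simp add: h_def[abs_def])
    then show ?thesis by (rule DERIV_imp_deriv)
  qed
  have hbd: "norm (h z) \<le> exp M * norm (f c)" if "norm z < R" for z
    using bd[OF mem[OF that]] by (simp add: h_def)
  have hz: "Re z < 0" if "norm z < R" "h z = 0" for z
    using zeros[OF mem[OF that(1)]] that(2) by (simp add: h_def)
  \<comment> \<open>The closed disc of radius \<open>r2\<close> is a compact part of the open one,
    so it carries only finitely many zeros, and some circle between \<open>r0\<close> and
    \<open>r2\<close> avoids them all.\<close>
  define r2 where "r2 = (r0 + R) / 2"
  have r2: "r0 < r2" "r2 < R" using r0 by (auto simp: r2_def)
  define Zs where "Zs = {z \<in> cball 0 r2. h z = 0}"
  have fin: "finite Zs"
  proof (cases "h constant_on ball 0 R")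
    case True
    then have "h z = h 0" if "norm z < R" for z using that r0 unfolding constant_on_def by auto
    then have "Zs = {}" using r2 h0 by (auto simp: Zs_def)
    then show ?thesis by simp
  next
    case False
    then show ?thesis unfolding Zs_def using r2 holh
      by (intro holomorphic_compact_finite_zeros[where S = "ball 0 R"]) auto
  qed
  have "infinite ({r0<..<r2} - norm ` Zs)" using r2 fin by (simp add: infinite_Ioo)
  then obtain r where "r \<in> {r0<..<r2} - norm ` Zs" by (metis finite.emptyI ex_in_conv)
  then have r: "r0 < r" "r < r2" "r \<notin> norm ` Zs" by auto
  \<comment> \<open>The largest modulus of a zero inside the circle; \<open>r / 2\<close> is
    inserted so that the maximum exists and is positive when there is no zero. As the circle carries
    no zero, \<open>r / r1\<close> exceeds 1 and its powers are unbounded.\<close>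
  define r1 where "r1 = Max (insert (r / 2) (norm ` {z \<in> Zs. norm z \<le> r}))"
  have finI: "finite (insert (r / 2) (norm ` {z \<in> Zs. norm z \<le> r}))" using fin by simp
  have "r1 \<in> insert (r / 2) (norm ` {z \<in> Zs. norm z \<le> r})"
    unfolding r1_def by (rule Max_in[OF finI]) auto
  then have "r1 = r / 2 \<or> (\<exists>z\<in>Zs. r1 = norm z \<and> norm z \<le> r)" by auto
  then have r1r: "r1 < r" using r r0 by (auto simp: less_le)
  have "r / 2 \<le> r1" unfolding r1_def by (rule Max_ge[OF finI]) auto
  then have r1p: "r1 > 0" using r r0 by simp
  have z1: "Re z < 0 \<and> norm z \<le> r1" if "norm z \<le> r" "h z = 0" for z
  proof
    show "Re z < 0" using hz that r r2 by auto
    show "norm z \<le> r1" unfolding r1_def using that r by (intro Max_ge[OF finI]) (auto simp: Zs_def)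
  qed
  define B where "B = exp M * norm (f c)"
  \<comment> \<open>Borel and Caratheodory want a strict bound. Enlarging B by the factor e provides
    it and turns M into M + 1.\<close>
  define B' where "B' = exp (M + 1) * norm (f c)"
  have "B < B'" using fc by (simp add: B_def B'_def)
  have lnB: "ln (B' / norm (f c)) = M + 1" using fc by (simp add: B'_def)
  have main: "- Re (deriv k 0 / k 0) \<le> 2 / r * ln (B' / norm (k 0))"
    if k: "k holomorphic_on ball 0 R" "k 0 \<noteq> 0" "\<And>z. norm z = r \<Longrightarrow> norm (k z) \<le> B"
      "\<And>z. norm z \<le> r \<Longrightarrow> k z = 0 \<Longrightarrow> h z = 0" for k
  proof -
    obtain n where "B / norm (k 0) < (r / r1) ^ n" using real_arch_pow[of "r / r1"] r1r r1p by auto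
    moreover have "norm (k 0) > 0" using k(2) by simp
    ultimately have big: "B < norm (k 0) * (r / r1) ^ n" by (simp only: pos_divide_less_eq mult.commute)
    have rR: "0 < r" "r < R" using r r0 r2 by auto
    have zk: "Re z < 0 \<and> norm z \<le> r1" if "norm z \<le> r" "k z = 0" for z
      using z1[OF that(1)] k(4)[OF that] by blast
    show ?thesis
      by (rule neg_log_deriv_le_induct[OF k(1) rR k(2) k(3) \<open>B < B'\<close> r1p r1r zk big])
  qed
  have sph: "norm (h z) \<le> B" if "norm z = r" for z using hbd[of z] that r r2 by (simp add: B_def)
  have le: "2 / r * (M + 1) \<le> 2 * (M + 1) / r0"
    using r r0 M by (simp add: frac_le)
  show "- Re (deriv f c / f c) \<le> 2 * (M + 1) / r0"
    using main[OF holh h0(2) sph] le by (simp add: dh lnB h0(1))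
  assume z0: "z0 \<in> ball c r0" "f z0 = 0"
  define \<rho> where "\<rho> = z0 - c"
  have \<rho>: "h \<rho> = 0" "norm \<rho> < r" "norm \<rho> < r0" "Re \<rho> < 0"
    using z0 r hz[of \<rho>] r0 by (auto simp: \<rho>_def h_def dist_norm norm_minus_commute)
  then have "\<rho> \<noteq> 0" "norm \<rho> > 0" by auto
  have rR: "0 < r" "r < R" using r r0 r2 by auto
  \<comment> \<open>The distinguished zero is divided out separately so that its term survives;
    \<open>main\<close> then handles the quotient.\<close>
  obtain g where g: "g holomorphic_on ball 0 R" "\<forall>z. norm z = r \<longrightarrow> norm (g z) = norm (h z)"
      "norm (g 0) = norm (h 0) * r / norm \<rho>" "\<forall>z. norm z \<le> r \<longrightarrow> g z = 0 \<longrightarrow> h z = 0"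
      "- Re (deriv h 0 / h 0) = - Re (deriv g 0 / g 0) + (Re \<rho> / (norm \<rho>)\<^sup>2 - Re \<rho> / r\<^sup>2)"
    by (rule blaschke_divide[OF holh rR \<rho>(1,2) \<open>\<rho> \<noteq> 0\<close> h0(2)])
  have "norm (h 0) * 1 \<le> norm (h 0) * (r / norm \<rho>)" using \<rho> \<open>norm \<rho> > 0\<close> by (intro mult_left_mono) auto
  then have ge: "norm (g 0) \<ge> norm (f c)" using g(3) h0 by simp
  have fp: "norm (f c) > 0" using fc by simp
  have gp: "norm (g 0) > 0" using ge fp by linarith
  have bp: "B' > 0" using fp by (simp add: B'_def)
  have "- Re (deriv g 0 / g 0) \<le> 2 / r * ln (B' / norm (g 0))"
  proof (rule main[OF g(1)])
    show "g 0 \<noteq> 0" using ge fp by auto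
    show "norm (g z) \<le> B" if "norm z = r" for z using g(2)[rule_format, OF that] sph[OF that] by simp
  qed (use g(4) in blast)
  also have "\<dots> \<le> 2 / r * ln (B' / norm (f c))"
    using ge fp rR gp bp by (intro mult_left_mono ln_mono divide_left_mono mult_pos_pos divide_pos_pos divide_nonneg_pos) linarith+
  also have "\<dots> \<le> 2 * (M + 1) / r0" using le lnB by simp
  finally have "- Re (deriv f c / f c) \<le> 2 * (M + 1) / r0 + (Re \<rho> / (norm \<rho>)\<^sup>2 - Re \<rho> / r\<^sup>2)"
    using g(5) dh h0 by simp
  \<comment> \<open>The accidental radius r is replaced by \<open>r0\<close>, which only increases
    the term because Re \<rho> is negative.\<close>
  moreover have "- (Re \<rho> / r\<^sup>2) \<le> - (Re \<rho> / r0\<^sup>2)"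
    using \<rho> r r0 unfolding minus_divide_left by (intro divide_left_mono power_mono) auto
  ultimately show "- Re (deriv f c / f c) \<le> 2 * (M + 1) / r0 + Re (z0 - c) / (norm (z0 - c))\<^sup>2 - Re (z0 - c) / r0\<^sup>2"
    unfolding \<rho>_def[symmetric] by linarith
qed

section \<open>The zero-free region\<close>

lemma norm_zeta_reg_ge:
  assumes "Re s > 1" "zeta_re (Re s) \<le> C / (Re s - 1)" "C > 0"
  shows "norm (s - 1) * (Re s - 1) / C \<le> norm (zeta_reg s)"
proof -
  have z: "zeta_re (Re s) > 0" using zeta_re_pos[OF assms(1)] by simp
  have "(Re s - 1) / C \<le> 1 / zeta_re (Re s)"
    using assms z by (simp add: field_simps)
  also have "\<dots> \<le> norm (zeta_dir s)"
    using norm_zeta_dir_ge[OF assms(1)] z by (simp add: field_simps)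
  finally have "norm (s - 1) * ((Re s - 1) / C) \<le> norm (s - 1) * norm (zeta_dir s)"
    by (intro mult_left_mono) auto
  then show ?thesis by (simp add: zeta_reg_eq[OF assms(1)] norm_mult)
qed

lemma zeta_reg_nonzero_near_1:
  obtains \<eta> where "0 < \<eta>" "\<eta> \<le> 1/2" "\<And>s. dist s 1 < \<eta> \<Longrightarrow> zeta_reg s \<noteq> 0"
proof -
  have op: "open {s::complex. Re s > 0}" by (simp add: open_halfspace_Re_gt)
  have "continuous_on {s. Re s > 0} zeta_reg"
    by (intro holomorphic_on_imp_continuous_on holomorphic_zeta_reg)
  then have "isCont zeta_reg 1" by (rule continuous_on_interior) (simp add: interior_open op)
  then obtain e where "e > 0" "\<forall>y. dist 1 y < e \<longrightarrow> zeta_reg y \<noteq> 0"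
    using continuous_at_avoid[of 1 zeta_reg 0] by (auto simp: zeta_reg_1)
  then show ?thesis by (intro that[of "min e (1/2)"]) (auto simp: dist_commute)
qed

text \<open>With the pole term split off, the logarithmic derivative is continuous on the compact
  segment from 1 to 2, including the end point 1.\<close>

lemma zeta_reg_log_deriv_real:
  obtains K where "K \<ge> 0" "\<And>\<delta>. 0 < \<delta> \<Longrightarrow> \<delta> \<le> 1 \<Longrightarrow>
    \<bar>Re (zeta_log_deriv (Complex (1 + \<delta>) 0))\<bar> \<le> K"
proof -
  have op: "open {s::complex. Re s > 0}" by (simp add: open_halfspace_Re_gt)
  let ?S = "(\<lambda>x. Complex (1 + x) 0) ` {0..1}"
  have nz: "zeta_reg s \<noteq> 0" if s: "s \<in> ?S" for s
  proof -
    obtain x where x: "s = Complex (1 + x) 0" "0 \<le> x" using s by auto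
    have "s = 1" if "x = 0" using that x by (simp add: complex_eq_iff)
    then show ?thesis using x zeta_reg_nonzero[of s] by (cases "x = 0") (auto simp: zeta_reg_1)
  qed
  have "continuous_on {0..1} (\<lambda>x. Complex (1 + x) 0)"
    unfolding Complex_eq by (intro continuous_intros)
  then have comp: "compact ?S" by (intro compact_continuous_image) auto
  have "continuous_on ?S (\<lambda>s. deriv zeta_reg s / zeta_reg s)"
  proof (intro continuous_intros)
    show "continuous_on ?S (deriv zeta_reg)"
      by (rule continuous_on_subset[OF holomorphic_on_imp_continuous_on[OF holomorphic_deriv[OF holomorphic_zeta_reg op]]]) auto
    show "continuous_on ?S zeta_reg"
      by (rule continuous_on_subset[OF holomorphic_on_imp_continuous_on[OF holomorphic_zeta_reg]]) auto
  qed (use nz in auto)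
  then have "bounded ((\<lambda>s. deriv zeta_reg s / zeta_reg s) ` ?S)"
    using comp by (intro compact_imp_bounded compact_continuous_image[of ?S])
  then obtain K where K: "\<And>s. s \<in> ?S \<Longrightarrow> norm (deriv zeta_reg s / zeta_reg s) \<le> K"
    unfolding bounded_iff by (auto simp del: image_image)
  show ?thesis
  proof (rule that[of "max K 0"])
    fix \<delta> :: real assume "0 < \<delta>" "\<delta> \<le> 1"
    then have "norm (zeta_log_deriv (Complex (1 + \<delta>) 0)) \<le> K"
      by (intro K) auto
    then show "\<bar>Re (zeta_log_deriv (Complex (1 + \<delta>) 0))\<bar> \<le> max K 0"
      using abs_Re_le_cmod order_trans by fastforce
  qed simp
qed

lemma ln_plus3_ge_1: "ln (\<bar>u\<bar> + 3 :: real) \<ge> 1"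
proof -
  have "exp 1 \<le> \<bar>u\<bar> + 3" using exp_le by linarith
  then show ?thesis by (subst ln_ge_iff) auto
qed

text \<open>De la Vallee Poussin's argument with Landau's local lemma. A zero \<rho> at height
  \<gamma> very close to the line Re s = 1 contributes - 4 / d to the 3-4-1 inequality at 1 +
  \<delta>, where d = 1 + \<delta> - Re \<rho> and \<delta> = c1 / ln (\<bar>\<gamma>\<bar> + 3),
  while the pole contributes only 3 / \<delta> and everything else is of order ln
  (\<bar>\<gamma>\<bar> + 3).\<close>

theorem zeta_reg_zero_free:
  obtains c where "0 < c" "c \<le> 1/8" "\<And>s. Re s \<ge> 1 - c / ln (\<bar>Im s\<bar> + 3) \<Longrightarrow> zeta_reg s \<noteq> 0"
proof -
  obtain C1 where C1: "C1 \<ge> 1" "\<And>s. Re s \<ge> 1/2 \<Longrightarrow> norm (zeta_reg s) \<le> C1 * (norm s + 1)\<^sup>2"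
    using norm_zeta_reg by blast
  obtain C2 where C2: "C2 \<ge> 1" "\<And>\<sigma>. 1 < \<sigma> \<Longrightarrow> \<sigma> \<le> 2 \<Longrightarrow> zeta_re \<sigma> \<le> C2 / (\<sigma> - 1)"
    using zeta_re_le by blast
  obtain \<eta>' where \<eta>': "0 < \<eta>'" "\<eta>' \<le> 1/2" "\<And>s. dist s 1 < \<eta>' \<Longrightarrow> zeta_reg s \<noteq> 0"
    using zeta_reg_nonzero_near_1 by blast
  obtain C3 where C3: "C3 \<ge> 0" "\<And>\<delta>. 0 < \<delta> \<Longrightarrow> \<delta> \<le> 1 \<Longrightarrow>
    \<bar>Re (zeta_log_deriv (Complex (1 + \<delta>) 0))\<bar> \<le> C3"
    using zeta_reg_log_deriv_real by blast
  define \<eta> where "\<eta> = \<eta>' / 2"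
  have \<eta>: "0 < \<eta>" "\<eta> \<le> 1/4" using \<eta>' by (auto simp: \<eta>_def)
  define K0 where "K0 = ln (4 * C1 * C2 / \<eta>)"
  have "1 * 1 \<le> C1 * C2" using C1 C2 by (intro mult_mono) auto
  then have "4 * C1 * C2 / \<eta> \<ge> 1" using \<eta> by (simp add: field_simps)
  then have K0: "K0 \<ge> 0" unfolding K0_def by (rule ln_ge_zero)
  \<comment> \<open>The weights 4 and 1 of the points at heights \<gamma> and 2 \<gamma> give 40 =
    (4 + 1) * 8 and 5 / \<eta>; the 16 bounds 64 * d.\<close>
  define A where "A = 3 * C3 + 40 * (K0 + 4) + 16 + 5 / \<eta>"
  \<comment> \<open>The error constant depends on c1 itself: the lower bound for
    \<open>zeta_reg\<close> at the centre contains \<delta>, hence c1, whose logarithm reappears in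
    M. The choice is still possible because c * ln (1 / c) tends to 0.\<close>
  have "((\<lambda>c. c * (A + 40 * ln (1 / c))) \<longlongrightarrow> 0) (at_right 0)" by real_asymp
  then have "\<forall>\<^sub>F c in at_right 0. c * (A + 40 * ln (1 / c)) < 1 / 2" by (rule order_tendstoD) simp
  then have "\<forall>\<^sub>F c in at_right 0. c * (A + 40 * ln (1 / c)) < 1 / 2 \<and> 0 < c \<and> c < \<eta> / 2"
    using \<eta> by (intro eventually_conj eventually_at_right_less eventually_at_rightI[of 0 "\<eta>/2" "\<lambda>c. c < \<eta>/2"]) auto
  then obtain c1 where c1: "c1 * (A + 40 * ln (1 / c1)) < 1 / 2" "0 < c1" "c1 < \<eta> / 2"
    using eventually_happens[of _ "at_right (0::real)"] by fastforce
  define K where "K = K0 + 3 + ln (1 / c1)"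
  have c1': "c1 < 1/8" using c1 \<eta> by simp
  have lc1: "ln (1 / c1) \<ge> 0" using c1 c1' by (intro ln_ge_zero) simp
  show ?thesis
  proof (rule that[of "c1 / 8"])
    show "0 < c1 / 8" "c1 / 8 \<le> 1/8" using c1 c1' by auto
    fix \<rho> :: complex
    assume \<rho>: "Re \<rho> \<ge> 1 - c1 / 8 / ln (\<bar>Im \<rho>\<bar> + 3)"
    define \<gamma> where "\<gamma> = Im \<rho>"
    define L where "L = ln (\<bar>\<gamma>\<bar> + 3)"
    have L: "L \<ge> 1" "exp L = \<bar>\<gamma>\<bar> + 3" using ln_plus3_ge_1[of \<gamma>] by (auto simp: L_def)
    have \<beta>: "Re \<rho> \<ge> 1 - c1 / 8 / L" using \<rho> by (simp add: L_def \<gamma>_def)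
    have c1L: "0 < c1 / L" "c1 / L \<le> c1" using c1 L by (auto simp: field_simps)
    define \<delta> where "\<delta> = c1 / L"
    have \<delta>: "0 < \<delta>" "\<delta> \<le> c1" "\<delta> \<le> 1/8" "\<delta> \<le> 1" using c1L c1' unfolding \<delta>_def by linarith+
    have \<beta>': "Re \<rho> \<ge> 1 - \<delta> / 8" using \<beta> by (simp add: \<delta>_def)
    show "zeta_reg \<rho> \<noteq> 0"
    proof
      assume z: "zeta_reg \<rho> = 0"
      have \<beta>1: "Re \<rho> \<le> 1" using zeta_reg_nonzero[of \<rho>] z by force
      \<comment> \<open>Low heights are excluded by nonvanishing near s = 1. Otherwise the pole
        terms at heights \<gamma> and 2 \<gamma> would not be bounded.\<close>
      have \<gamma>: "\<bar>\<gamma>\<bar> \<ge> \<eta>"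
      proof (rule ccontr)
        assume "\<not> \<bar>\<gamma>\<bar> \<ge> \<eta>"
        moreover have "\<bar>Re \<rho> - 1\<bar> \<le> \<eta> / 2" using \<beta>1 \<beta>' \<delta> c1 by simp
        moreover have "norm (\<rho> - 1) \<le> \<bar>Re (\<rho> - 1)\<bar> + \<bar>Im (\<rho> - 1)\<bar>" by (rule cmod_le)
        ultimately have "dist \<rho> 1 < \<eta>'" using \<eta>'(1) by (simp add: dist_norm \<gamma>_def \<eta>_def)
        with \<eta>'(3) z show False by blast
      qed
      define M where "M = K * L"
      have K: "K \<ge> 0" using K0 lc1 by (simp add: K_def)
      have M: "M \<ge> 0" using K L by (simp add: M_def)
      have landau: "- Re (zeta_log_deriv (Complex (1 + \<delta>) u)) \<le> 8 * (M + 1)"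
        "zeta_reg z0 = 0 \<Longrightarrow> z0 \<in> ball (Complex (1 + \<delta>) u) (1/4) \<Longrightarrow>
          - Re (zeta_log_deriv (Complex (1 + \<delta>) u)) \<le> 8 * (M + 1)
           + Re (z0 - Complex (1 + \<delta>) u) / (norm (z0 - Complex (1 + \<delta>) u))\<^sup>2 - Re (z0 - Complex (1 + \<delta>) u) / (1/4)\<^sup>2"
        if u: "\<eta> \<le> \<bar>u\<bar>" "\<bar>u\<bar> \<le> 2 * \<bar>\<gamma>\<bar>" for u z0
      proof -
        let ?c = "Complex (1 + \<delta>) u"
        have Reb: "Re s > 1/2" if "s \<in> ball ?c (1/2)" for s
          using that abs_Re_le_cmod[of "?c - s"] \<delta> by (auto simp: dist_norm)
        have 1: "zeta_reg holomorphic_on ball ?c (1/2)"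
          by (rule holomorphic_on_subset[OF holomorphic_zeta_reg]) (use Reb in force)
        have 2: "zeta_reg ?c \<noteq> 0" using \<delta> by (intro zeta_reg_nonzero) simp
        have cge: "norm (zeta_reg ?c) \<ge> \<eta> * \<delta> / C2"
        proof -
          have "\<eta> * \<delta> / C2 \<le> norm (?c - 1) * (Re ?c - 1) / C2"
            using abs_Im_le_cmod[of "?c - 1"] u \<delta> C2(1) by (intro divide_right_mono mult_mono) auto
          also have "\<dots> \<le> norm (zeta_reg ?c)"
            using C2(1) C2(2)[of "1 + \<delta>"] \<delta> by (intro norm_zeta_reg_ge) auto
          finally show ?thesis .
        qed
        have 3: "norm (zeta_reg s) \<le> exp M * norm (zeta_reg ?c)" if s: "s \<in> ball ?c (1/2)" for s
        proof -
          have "norm s \<le> norm ?c + 1/2" using s norm_triangle_ineq2[of s ?c] by (simp add: dist_norm norm_minus_commute)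
          also have "norm ?c \<le> \<bar>1 + \<delta>\<bar> + \<bar>u\<bar>" using cmod_le[of ?c] by simp
          finally have "norm s + 1 \<le> 2 * exp L" using u \<delta> L(2) by simp
          then have "(norm s + 1)\<^sup>2 \<le> (2 * exp L)\<^sup>2" by (intro power_mono) auto
          then have "C1 * (norm s + 1)\<^sup>2 \<le> C1 * (2 * exp L)\<^sup>2" using C1 by (intro mult_left_mono) auto
          with C1(2)[of s] Reb[OF s] have "norm (zeta_reg s) \<le> C1 * (2 * exp L)\<^sup>2" by simp
          also have "\<dots> = (4 * C1 * C2 / \<eta>) * (exp L)\<^sup>2 * (1 / \<delta>) * (\<eta> * \<delta> / C2)"
            using \<eta> \<delta> C2 by (simp add: field_simps power2_eq_square)
          also have "\<dots> \<le> exp M * (\<eta> * \<delta> / C2)"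
          proof (intro mult_right_mono)
            \<comment> \<open>The centre costs 1 / \<delta> = L / c1, at most exp L / c1. With (exp
              L)^2 from quadratic growth this is where the 3 in K comes from.\<close>
            have "L \<le> exp L" using exp_ge_add_one_self[of L] by linarith
            then have "1 / \<delta> \<le> exp L * (1 / c1)" using c1 by (simp add: \<delta>_def divide_right_mono)
            also have "1 / c1 = exp (ln (1 / c1))" using c1 by simp
            finally have "1 / \<delta> \<le> exp L * exp (ln (1 / c1))" .
            moreover have "4 * C1 * C2 / \<eta> = exp K0" unfolding K0_def using C1 C2 \<eta> by simp
            ultimately have "(4 * C1 * C2 / \<eta>) * (exp L)\<^sup>2 * (1 / \<delta>) \<le> exp K0 * (exp L)\<^sup>2 * (exp L * exp (ln (1 / c1)))"
              by (simp only:) (intro mult_left_mono, auto)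
            also have "\<dots> = exp (K0 + 3 * L + ln (1 / c1))"
              by (simp add: power2_eq_square flip: exp_add)
            also have "\<dots> \<le> exp M"
            proof -
              have "K0 * 1 \<le> K0 * L" "ln (1 / c1) * 1 \<le> ln (1 / c1) * L"
                by (rule mult_left_mono[OF L(1) K0], rule mult_left_mono[OF L(1) lc1])
              then show ?thesis by (simp add: M_def K_def distrib_right)
            qed
            finally show "(4 * C1 * C2 / \<eta>) * (exp L)\<^sup>2 * (1 / \<delta>) \<le> exp M" .
          qed (use \<eta> \<delta> C2 in auto)
          also have "\<dots> \<le> exp M * norm (zeta_reg ?c)" using cge by (intro mult_left_mono) auto
          finally show ?thesis .
        qed
        have 4: "Re s < Re ?c" if "s \<in> ball ?c (1/2)" "zeta_reg s = 0" for s
          using zeta_reg_nonzero[of s] that(2) \<delta> by force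
        have e: "2 * (M + 1) / (1/4) = 8 * (M + 1)" by simp
        have q: "(0::real) < 1/4" "(1/4::real) < 1/2" by auto
        show "- Re (zeta_log_deriv ?c) \<le> 8 * (M + 1)"
          using neg_log_deriv_le(1)[OF 1 q 2 3 4 M] unfolding e .
        show "- Re (zeta_log_deriv ?c) \<le> 8 * (M + 1) + Re (z0 - ?c) / (norm (z0 - ?c))\<^sup>2 - Re (z0 - ?c) / (1/4)\<^sup>2"
          if "zeta_reg z0 = 0" "z0 \<in> ball ?c (1/4)"
          using neg_log_deriv_le(2)[OF 1 q 2 3 4 M that(2,1)] unfolding e .
      qed
      have inv_le: "Re (1 / Complex \<delta> u) \<le> 1 / \<eta>" if "\<eta> \<le> \<bar>u\<bar>" for u
      proof -
        have "Re (1 / Complex \<delta> u) \<le> norm (1 / Complex \<delta> u)" by (rule complex_Re_le_cmod)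
        also have "\<dots> = 1 / norm (Complex \<delta> u)" by (simp add: norm_divide)
        also have "\<dots> \<le> 1 / \<eta>"
          using that abs_Im_le_cmod[of "Complex \<delta> u"] \<eta> by (intro divide_left_mono mult_pos_pos) auto
        finally show ?thesis .
      qed
      define d where "d = 1 + \<delta> - Re \<rho>"
      have d: "0 < d" "d < 1/4" using \<beta>1 \<beta>' \<delta> by (auto simp: d_def)
      have \<rho>d: "\<rho> - Complex (1 + \<delta>) \<gamma> = of_real (- d)" by (simp add: complex_eq_iff d_def \<gamma>_def)
      have "\<rho> \<in> ball (Complex (1 + \<delta>) \<gamma>) (1/4)"
        using d arg_cong[OF \<rho>d, of norm] by (simp add: dist_norm norm_minus_commute)
      from landau(2)[OF \<gamma> _ z this]
      have l0: "- Re (zeta_log_deriv (Complex (1 + \<delta>) \<gamma>)) \<le> 8 * (M + 1) - 1 / d + 16 * d"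
        unfolding \<rho>d using d by (simp add: power2_eq_square)
      have \<gamma>2: "\<eta> \<le> \<bar>2 * \<gamma>\<bar>" using \<gamma> \<eta> by simp
      have l1: "- Re (zeta_log_deriv (Complex (1 + \<delta>) (2 * \<gamma>))) \<le> 8 * (M + 1)"
        by (rule landau(1)[OF \<gamma>2]) simp
      have r0: "Re (1 / Complex \<delta> 0) = 1 / \<delta>" using \<delta> by (simp add: Re_divide power2_eq_square)
      have "4 / d \<le> 3 / \<delta> + 3 * C3 + 40 * (M + 1) + 64 * d + 5 / \<eta>"
        using zeta_341[OF \<delta>(1), of \<gamma>] l0 l1 C3(2)[OF \<delta>(1,4)] inv_le[OF \<gamma>] inv_le[OF \<gamma>2]
        unfolding minus_complex.sel r0 by (simp add: abs_le_iff)
      also have "\<dots> \<le> (3 / c1 + (A + 40 * ln (1 / c1))) * L"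
      proof -
        have "3 * C3 + 56 + 5 / \<eta> \<le> (3 * C3 + 56 + 5 / \<eta>) * L"
          using L C3 \<eta> mult_left_mono[of 1 L "3 * C3 + 56 + 5 / \<eta>"] by simp
        moreover have "3 / \<delta> = 3 / c1 * L" by (simp add: \<delta>_def)
        moreover have "(3 / c1 + (A + 40 * ln (1 / c1))) * L = 3 / c1 * L + (3 * C3 + 56 + 5 / \<eta>) * L + 40 * M"
          by (simp add: A_def M_def K_def algebra_simps)
        ultimately show ?thesis using d by simp
      qed
      also have "\<dots> < (7 / 2 / c1) * L"
      proof (rule mult_strict_right_mono)
        have "A + 40 * ln (1 / c1) < 1 / 2 / c1" using c1 by (simp add: field_simps)
        then show "3 / c1 + (A + 40 * ln (1 / c1)) < 7 / 2 / c1" by (simp add: field_simps)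
      qed (use L in simp)
      also have "\<dots> = 7 / 2 / \<delta>" by (simp add: \<delta>_def)
      finally have "4 / d < 7 / 2 / \<delta>" .
      \<comment> \<open>On the other hand d is at most 9/8 of \<delta> by \<beta>', and 7 * 9/8 < 8;
        this is what the division of c1 by 8 in the final constant is for.\<close>
      then have "8 * \<delta> < 7 * d" using d \<delta> by (simp add: field_simps)
      then show False using \<beta>' \<delta> by (simp add: d_def)
    qed
  qed
qed

text \<open>To the right of 1 + \<delta> the Euler product bounds 1 / \<zeta> directly. Further left
  the lower bound at 1 + \<delta> is transported along the horizontal line by the estimate for
  zero-free functions on a disc; the loss exp (l / 4) is a fixed small power of the height exp
  l.\<close>

theorem zeta_reg_inverse_bound:
  obtains c C l0 where "0 < c" "c \<le> 1/4" "C > 0" "l0 \<ge> 2"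
    "\<And>l s. l \<ge> l0 \<Longrightarrow> \<bar>Im s\<bar> \<le> exp l \<Longrightarrow> 1 - c / l \<le> Re s \<Longrightarrow> Re s \<le> 2 \<Longrightarrow>
      zeta_reg s \<noteq> 0 \<and> norm ((s - 1) / zeta_reg s) \<le> C * l * exp (l / 4)"
proof -
  obtain C1 where C1: "C1 \<ge> 1" "\<And>s. Re s \<ge> 1/2 \<Longrightarrow> norm (zeta_reg s) \<le> C1 * (norm s + 1)\<^sup>2"
    using norm_zeta_reg by blast
  obtain C2 where C2: "C2 \<ge> 1" "\<And>\<sigma>. 1 < \<sigma> \<Longrightarrow> \<sigma> \<le> 2 \<Longrightarrow> zeta_re \<sigma> \<le> C2 / (\<sigma> - 1)"
    using zeta_re_le by blast
  obtain c where c: "0 < c" "c \<le> 1/8" "\<And>s. Re s \<ge> 1 - c / ln (\<bar>Im s\<bar> + 3) \<Longrightarrow> zeta_reg s \<noteq> 0"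
    using zeta_reg_zero_free by blast
  \<comment> \<open>With this value s lies within 2 * \<delta> = r / 64 of the centre, so the
    exponent lost in the transport is 10/63 of l, below l / 4.\<close>
  define \<theta> :: real where "\<theta> = 1 / 128"
  have "\<forall>\<^sub>F l in at_top. 2 * C1 * C2 / (\<theta> * (c / (2 * l)))\<^sup>2 < exp l"
    unfolding \<theta>_def using c C1 C2 by real_asymp
  then obtain l1 where l1: "\<And>l. l \<ge> l1 \<Longrightarrow> 2 * C1 * C2 / (\<theta> * (c / (2 * l)))\<^sup>2 < exp l"
    by (auto simp: eventually_at_top_linorder)
  show ?thesis
  proof (rule that[of "\<theta> * c / 2" "3 * C2 * (2 / (\<theta> * c))" "max 2 l1"])
    show "0 < \<theta> * c / 2" "\<theta> * c / 2 \<le> 1/4" "0 < 3 * C2 * (2 / (\<theta> * c))" "max 2 l1 \<ge> 2"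
      using c C2 by (auto simp: \<theta>_def)
    fix l s assume l: "max 2 l1 \<le> l" and s: "\<bar>Im s\<bar> \<le> exp l" "1 - \<theta> * c / 2 / l \<le> Re s" "Re s \<le> 2"
    have l2: "l \<ge> 2" using l by simp
    have T4: "exp l \<ge> 4"
    proof -
      have "(4::real) \<le> exp 1 * exp 1" using exp_ge_add_one_self[of 1] mult_mono[of 2 "exp 1 :: real" 2 "exp 1"] by simp
      also have "\<dots> = exp 2" by (simp flip: exp_add)
      also have "\<dots> \<le> exp l" using l2 by simp
      finally show ?thesis .
    qed
    have "4 * exp l \<le> exp l * exp l" using T4 by (intro mult_right_mono) auto
    then have Tsq: "exp l + 4 \<le> (exp l)\<^sup>2" using T4 unfolding power2_eq_square by linarith
    \<comment> \<open>The width of the zero-free region at heights up to exp l + 1, where ln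
      (\<bar>Im w\<bar> + 3) is at most 2 * l.\<close>
    define r where "r = c / (2 * l)"
    have r: "r > 0" "r \<le> 1/32" using c l2 by (auto simp: r_def field_simps)
    define \<delta> where "\<delta> = \<theta> * r"
    have \<delta>: "0 < \<delta>" "\<delta> \<le> 1/32" "\<delta> < r" using r by (auto simp: \<delta>_def \<theta>_def)
    have \<delta>_eq: "\<delta> = \<theta> * c / 2 / l" by (simp add: \<delta>_def r_def)
    have zf: "zeta_reg w \<noteq> 0" if "\<bar>Im w\<bar> \<le> exp l + 1" "Re w \<ge> 1 - r" for w
    proof (rule c(3))
      have "ln (\<bar>Im w\<bar> + 3) \<le> ln ((exp l)\<^sup>2)" using that Tsq by (intro ln_mono) auto
      also have "\<dots> = 2 * l" by (simp add: ln_realpow)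
      finally have "c / (2 * l) \<le> c / ln (\<bar>Im w\<bar> + 3)"
        using c ln_plus3_ge_1[of "Im w"] l2 by (intro divide_left_mono mult_pos_pos) auto
      then show "Re w \<ge> 1 - c / ln (\<bar>Im w\<bar> + 3)" using that by (simp add: r_def)
    qed
    have nz: "zeta_reg s \<noteq> 0" using s \<delta> by (intro zf) (auto simp: \<delta>_eq)
    have d2: "C2 / \<delta> = C2 * (2 / (\<theta> * c)) * l" using l2 by (simp add: \<delta>_eq field_simps)
    have "norm ((s - 1) / zeta_reg s) \<le> 3 * (C2 / \<delta>) * exp (l / 4)"
    proof (cases "Re s \<ge> 1 + \<delta>")
      case True
      have "norm (s - 1) * (Re s - 1) / C2 \<le> norm (zeta_reg s)"
        using True \<delta> C2(1) C2(2)[of "Re s"] s by (intro norm_zeta_reg_ge) auto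
      moreover have "norm (s - 1) * \<delta> / C2 \<le> norm (s - 1) * (Re s - 1) / C2"
        using True C2(1) by (intro divide_right_mono mult_left_mono) auto
      ultimately have "norm (s - 1) \<le> C2 / \<delta> * norm (zeta_reg s)" using \<delta> C2(1) by (simp add: field_simps)
      then have "norm ((s - 1) / zeta_reg s) \<le> C2 / \<delta> * 1" using nz by (simp add: norm_divide divide_le_eq)
      also have "C2 / \<delta> * 1 \<le> C2 / \<delta> * (3 * exp (l / 4))"
      proof (rule mult_left_mono)
        have "1 \<le> exp (l / 4)" using l2 by simp
        then show "1 \<le> 3 * exp (l / 4)" by linarith
      qed (use C2(1) \<delta> in simp)
      finally show ?thesis by (simp add: mult_ac)
    next
      case False
      let ?c = "Complex (1 + \<delta>) (Im s)"
      have mem: "1 - r \<le> Re w" "\<bar>Im w\<bar> \<le> exp l + 1" "norm w + 1 \<le> exp l + 4" if "w \<in> ball ?c r" for w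
      proof -
        have "norm (?c - w) < r" using that by (simp add: dist_norm)
        then have R: "\<bar>Re (?c - w)\<bar> < r" "\<bar>Im (?c - w)\<bar> < r"
          using abs_Re_le_cmod[of "?c - w"] abs_Im_le_cmod[of "?c - w"] by linarith+
        then show "1 - r \<le> Re w" "\<bar>Im w\<bar> \<le> exp l + 1" using s r \<delta> by auto
        then show "norm w + 1 \<le> exp l + 4" using cmod_le[of w] R r \<delta> s by auto
      qed
      have hol: "zeta_reg holomorphic_on ball ?c r"
        by (rule holomorphic_on_subset[OF holomorphic_zeta_reg]) (use mem(1) r in force)
      have dist: "dist ?c s = 1 + \<delta> - Re s"
      proof -
        have "?c - s = of_real (1 + \<delta> - Re s)" by (simp add: complex_eq_iff)
        then have "dist ?c s = \<bar>1 + \<delta> - Re s\<bar>" by (simp only: dist_norm norm_of_real)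
        then show ?thesis using False by linarith
      qed
      have ds: "dist ?c s \<le> 2 * \<delta>" using s(2) unfolding dist \<delta>_eq[symmetric] by linarith
      have c1: "norm (?c - 1) \<ge> \<delta>" using abs_Re_le_cmod[of "?c - 1"] by simp
      have cge: "norm (?c - 1) * \<delta> / C2 \<le> norm (zeta_reg ?c)"
        using norm_zeta_reg_ge[of ?c C2] C2(1) C2(2)[of "1 + \<delta>"] \<delta> by auto
      \<comment> \<open>Quadratic growth with exp l + 4 \<le> exp (2 * l) accounts for 4 * l; the
        fifth l absorbs the constants and the factor \<delta>^2, by the choice of
        \<open>l1\<close>.\<close>
      have bd: "norm (zeta_reg w) < exp (5 * l) * norm (zeta_reg ?c)" if w: "w \<in> ball ?c r" for w
      proof -
        have "norm (zeta_reg w) \<le> C1 * (norm w + 1)\<^sup>2" using mem(1)[OF w] r by (intro C1(2)) simp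
        also have "\<dots> \<le> C1 * ((exp l)\<^sup>2)\<^sup>2"
          using C1 mem(3)[OF w] Tsq by (intro mult_left_mono power_mono) auto
        also have "\<dots> = exp (4 * l) * C1" by (simp flip: exp_of_nat_mult exp_double add: mult_ac)
        also have "\<dots> < exp (4 * l) * (exp l * (\<delta> * \<delta> / C2))"
        proof (rule mult_strict_left_mono)
          have "2 * C1 * C2 / \<delta>\<^sup>2 < exp l" using l1[of l] l by (simp add: \<delta>_def r_def)
          then have "2 * C1 < exp l * (\<delta> * \<delta> / C2)"
            using \<delta> C2(1) by (simp add: field_simps power2_eq_square)
          then show "C1 < exp l * (\<delta> * \<delta> / C2)" using C1 by simp
        qed simp
        also have "\<dots> \<le> exp (4 * l) * (exp l * norm (zeta_reg ?c))"
        proof (intro mult_left_mono)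
          have "\<delta> * \<delta> / C2 \<le> norm (?c - 1) * \<delta> / C2"
            using c1 \<delta> C2(1) by (intro divide_right_mono mult_right_mono) auto
          then show "\<delta> * \<delta> / C2 \<le> norm (zeta_reg ?c)" using cge by linarith
        qed auto
        also have "exp (4 * l) * (exp l * norm (zeta_reg ?c)) = exp (5 * l) * norm (zeta_reg ?c)"
          by (simp flip: exp_add mult.assoc)
        finally show ?thesis .
      qed
      have smem: "s \<in> ball ?c r" using ds r by (simp add: \<delta>_def \<theta>_def)
      have "norm (zeta_reg ?c) * exp (- (2 * (5 * l) * dist ?c s / (r - dist ?c s))) \<le> norm (zeta_reg s)"
        by (rule holomorphic_nonzero_bounds(2)[OF hol r(1) _ _ bd smem]) (use l2 zf mem in auto)
      moreover have "2 * (5 * l) * dist ?c s / (r - dist ?c s) \<le> l / 4"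
      proof -
        have "dist ?c s \<le> r / 64" using ds by (simp add: \<delta>_def \<theta>_def)
        then have "2 * (5 * l) * dist ?c s / (r - dist ?c s) \<le> 2 * (5 * l) * (r / 64) / (r - r / 64)"
          using l2 r by (intro frac_le mult_left_mono) auto
        also have "\<dots> = l * (10 / 63)" using r by (simp add: field_simps)
        also have "\<dots> \<le> l / 4" using l2 by simp
        finally show ?thesis .
      qed
      ultimately have "norm (zeta_reg ?c) * exp (- (l / 4)) \<le> norm (zeta_reg s)"
        by (smt (verit) exp_le_cancel_iff mult_left_mono norm_ge_zero)
      moreover have "norm (?c - 1) * \<delta> / C2 * exp (- (l / 4)) \<le> norm (zeta_reg ?c) * exp (- (l / 4))"
        using cge by (intro mult_right_mono) auto
      ultimately have "norm (?c - 1) * \<delta> / C2 * exp (- (l / 4)) \<le> norm (zeta_reg s)" by linarith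
      then have "norm (?c - 1) \<le> C2 / \<delta> * exp (l / 4) * norm (zeta_reg s)"
        using \<delta> C2(1) by (simp add: field_simps exp_minus)
      moreover have "norm (s - 1) \<le> 3 * norm (?c - 1)"
        using norm_triangle_ineq[of "s - ?c" "?c - 1"] ds c1 by (simp add: dist_norm norm_minus_commute)
      ultimately have "norm (s - 1) \<le> 3 * (C2 / \<delta> * exp (l / 4) * norm (zeta_reg s))" by linarith
      then have "norm (s - 1) \<le> 3 * (C2 / \<delta>) * exp (l / 4) * norm (zeta_reg s)" by (simp only: mult.assoc)
      then show ?thesis using nz by (simp add: norm_divide divide_le_eq)
    qed
    then show "zeta_reg s \<noteq> 0 \<and> norm ((s - 1) / zeta_reg s) \<le> 3 * C2 * (2 / (\<theta> * c)) * l * exp (l / 4)"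
      using nz d2 by (simp add: mult_ac)
  qed
qed

section \<open>The Dirichlet series of the sieve coefficients\<close>

definition sieve_coeff :: "nat \<Rightarrow> real" where
  "sieve_coeff n = of_int (moebius_mu n) * 2 ^ num_prime_divisors n"

lemma sieve_coeff_1 [simp]: "sieve_coeff 1 = 1" "sieve_coeff (Suc 0) = 1"
  by (simp_all add: sieve_coeff_def moebius_mu_def num_prime_divisors_def)

lemma sieve_coeff_prime_mult:
  assumes "prime p" "\<not> p dvd n" "n > 0"
  shows "sieve_coeff (p * n) = - 2 * sieve_coeff n"
proof -
  have cop: "coprime p n" using assms by (simp add: prime_imp_coprime)
  have "squarefree p" using assms by (simp add: squarefree_prime)
  then have sq: "squarefree (p * n) \<longleftrightarrow> squarefree n"
    using cop squarefree_mult_coprime squarefree_multD(2) by blast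
  have "prime_factors (p * n) = insert p (prime_factors n)"
    using assms prime_gt_0_nat[of p] by (simp add: prime_factors_product prime_prime_factors)
  moreover have "p \<notin> prime_factors n" using assms by (simp add: prime_factors_dvd)
  ultimately have "card (prime_factors (p * n)) = Suc (card (prime_factors n))" by simp
  then show ?thesis by (simp add: sieve_coeff_def moebius_mu_def num_prime_divisors_def sq)
qed

text \<open>The value is at most the number of sets of prime factors of n, and taking products
  embeds these sets into the divisors; \<open>prime_factors\<close> recovers the set from its
  product.\<close>

lemma abs_sieve_coeff_le: "n > 0 \<Longrightarrow> \<bar>sieve_coeff n\<bar> \<le> real (card {d. d dvd n})"
proof -
  assume n: "n > 0"
  have "\<bar>sieve_coeff n\<bar> \<le> 2 ^ card (prime_factors n)"
    by (simp add: sieve_coeff_def moebius_mu_def num_prime_divisors_def abs_mult power_abs)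
  also have "\<dots> = real (card (Pow (prime_factors n)))" by (simp add: card_Pow)
  also have "card (Pow (prime_factors n)) \<le> card {d. d dvd n}"
  proof (rule card_inj_on_le[where f = "\<lambda>S. \<Prod>S"])
    have pf: "prime_factors (\<Prod>S) = S" if "S \<subseteq> prime_factors n" for S
    proof -
      have S: "finite S" "\<And>p. p \<in> S \<Longrightarrow> prime p"
        using that finite_subset by (auto simp: prime_factors_dvd)
      then have "0 \<notin> S" by (meson not_prime_0)
      then have "\<Prod>S \<noteq> 0" using S(1) by (simp add: prod_zero_iff)
      then have "x \<in> prime_factors (\<Prod>S) \<longleftrightarrow> prime x \<and> (\<exists>p\<in>S. x dvd p)" for x
        using S(1) prime_dvd_prod_iff[of S x "\<lambda>p. p"] by (auto simp: prime_factors_dvd)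
      moreover have "prime x \<and> (\<exists>p\<in>S. x dvd p) \<longleftrightarrow> x \<in> S" for x
      proof
        assume "prime x \<and> (\<exists>p\<in>S. x dvd p)"
        then obtain p where p: "prime x" "p \<in> S" "x dvd p" by auto
        show "x \<in> S" using primes_dvd_imp_eq[OF p(1) S(2)[OF p(2)] p(3)] p(2) by simp
      next
        assume x: "x \<in> S"
        show "prime x \<and> (\<exists>p\<in>S. x dvd p)" using S(2)[OF x] x dvd_refl[of x] by blast
      qed
      ultimately show ?thesis by (intro set_eqI) simp
    qed
    show "inj_on (\<lambda>S. \<Prod>S) (Pow (prime_factors n))"
      by (rule inj_on_inverseI[where g = prime_factors]) (use pf in auto)
    show "(\<lambda>S. \<Prod>S) ` Pow (prime_factors n) \<subseteq> {d. d dvd n}"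
    proof safe
      fix S assume S: "S \<subseteq> prime_factors n"
      have "\<Prod>S dvd \<Prod>(prime_factors n)" by (rule prod_dvd_prod_subset[OF _ S]) simp
      also have "\<Prod>(prime_factors n) dvd (\<Prod>p\<in>prime_factors n. p ^ multiplicity p n)"
        using n by (intro prod_dvd_prod dvd_power) (auto simp: prime_factors_multiplicity)
      also have "\<dots> = n" using n by (simp add: prime_factorization_nat[symmetric])
      finally show "\<Prod>S dvd n" .
    qed
  qed (use n in simp)
  finally show ?thesis by simp
qed

lemma dvd_mult_prime_iff:
  fixes p m n :: nat
  assumes "prime p" "\<not> p dvd m"
  shows "n dvd p * m \<longleftrightarrow> n dvd m \<or> (\<exists>d. n = p * d \<and> d dvd m)"
proof
  assume n: "n dvd p * m"
  show "n dvd m \<or> (\<exists>d. n = p * d \<and> d dvd m)"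
  proof (cases "p dvd n")
    case True
    then obtain d where "n = p * d" by blast
    with n show ?thesis using prime_gt_0_nat[OF assms(1)] by auto
  next
    case False
    then have "coprime n p" using prime_imp_coprime[OF assms(1)] by (simp add: coprime_commute)
    with n show ?thesis by (simp add: coprime_dvd_mult_right_iff)
  qed
qed auto

text \<open>The divisors of p * m, with p coprime to m, are the divisors of m and their multiples by
  p. Keeping F generic serves both the complex Dirichlet polynomial and the sum of absolute
  values.\<close>

lemma sum_divisors_prod_primes:
  fixes F :: "nat \<Rightarrow> 'a :: comm_ring_1"
  assumes "finite P" "\<And>p. p \<in> P \<Longrightarrow> prime p" "F 1 = 1"
    and "\<And>p d. p \<in> P \<Longrightarrow> d > 0 \<Longrightarrow> \<not> p dvd d \<Longrightarrow> F (p * d) = a p * F d"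
  shows "(\<Sum>n | n dvd \<Prod>P. F n) = (\<Prod>p\<in>P. 1 + a p)"
  using assms(1,2,4)
proof (induction P)
  case empty
  then show ?case using assms(3) by (simp add: Collect_conv_if)
next
  case (insert p P)
  define m where "m = \<Prod>P"
  have pr: "prime p" using insert by auto
  have m0: "m > 0" using insert.prems prime_gt_0_nat unfolding m_def by (intro prod_pos) auto
  have pm: "\<not> p dvd m"
  proof
    assume "p dvd m"
    then obtain q where "q \<in> P" "p dvd q" unfolding m_def using pr insert.hyps by (auto simp: prime_dvd_prod_iff)
    moreover have "prime q" using insert.prems(1) \<open>q \<in> P\<close> by simp
    ultimately have "p = q" using primes_dvd_imp_eq[OF pr] by blast
    then show False using insert.hyps(2) \<open>q \<in> P\<close> by simp
  qed
  have pd: "\<not> p dvd d" "d > 0" if "d dvd m" for d using that pm m0 by (auto intro: dvd_trans dvd_pos_nat)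
  have eq: "{n. n dvd p * m} = {n. n dvd m} \<union> (*) p ` {n. n dvd m}"
    using dvd_mult_prime_iff[OF pr pm] by auto
  have fin: "finite {n. n dvd m}" using m0 by simp
  have "(\<Sum>n | n dvd \<Prod>(insert p P). F n) = (\<Sum>n\<in>{n. n dvd m} \<union> (*) p ` {n. n dvd m}. F n)"
    using insert by (simp add: m_def[symmetric] eq)
  also have "\<dots> = (\<Sum>n | n dvd m. F n) + (\<Sum>n\<in>(*) p ` {n. n dvd m}. F n)"
    using pd(1) fin by (intro sum.union_disjoint) auto
  also have "(\<Sum>n\<in>(*) p ` {n. n dvd m}. F n) = (\<Sum>n | n dvd m. F (p * n))"
    using prime_gt_0_nat[OF pr] by (subst sum.reindex) (auto simp: inj_on_def)
  also have "\<dots> = (\<Sum>n | n dvd m. a p * F n)"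
    using pd by (intro sum.cong insert.prems) auto
  also have "\<dots> = a p * (\<Sum>n | n dvd m. F n)" by (simp add: sum_distrib_left)
  also have "(\<Sum>n | n dvd m. F n) = (\<Prod>p\<in>P. 1 + a p)"
    unfolding m_def using insert.prems by (intro insert.IH) auto
  finally show ?case using insert.hyps by (simp add: algebra_simps)
qed

definition prime_block :: "nat \<Rightarrow> nat \<Rightarrow> nat set" where
  "prime_block z N = {p. prime p \<and> z < p \<and> p \<le> N}"

lemma finite_prime_block [simp]: "finite (prime_block z N)"
  by (simp add: prime_block_def)

lemma prime_blockD: "p \<in> prime_block z N \<Longrightarrow> prime p"
  by (simp add: prime_block_def)

lemma sum_sieve_coeff_powr:
  "(\<Sum>n | n dvd \<Prod>(prime_block z N). of_real (sieve_coeff n) * of_nat n powr (- s) :: complex)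
     = (\<Prod>p\<in>prime_block z N. 1 - 2 * of_nat p powr (- s))"
proof -
  have "(\<Sum>n | n dvd \<Prod>(prime_block z N). of_real (sieve_coeff n) * of_nat n powr (- s) :: complex)
     = (\<Prod>p\<in>prime_block z N. 1 + (- 2 * of_nat p powr (- s)))"
    by (intro sum_divisors_prod_primes)
      (auto dest: prime_blockD simp: sieve_coeff_prime_mult of_nat_powr_mult simp del: of_nat_mult)
  then show ?thesis by simp
qed

text \<open>Each local factor satisfies 1 + 2 x \<le> (1 + x)^2 \<le> 1 / (1 - x)^2, which is the
  local factor of \<zeta>^2.\<close>

lemma sum_abs_sieve_coeff_powr:
  assumes "\<sigma> > 1"
  shows "(\<Sum>n | n dvd \<Prod>(prime_block z N). \<bar>sieve_coeff n\<bar> * real n powr (- \<sigma>)) \<le> (zeta_re \<sigma>)\<^sup>2"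
proof -
  have "(\<Sum>n | n dvd \<Prod>(prime_block z N). \<bar>sieve_coeff n\<bar> * real n powr (- \<sigma>))
     = (\<Prod>p\<in>prime_block z N. 1 + 2 * real p powr (- \<sigma>))"
    by (intro sum_divisors_prod_primes)
      (auto dest: prime_blockD simp: sieve_coeff_prime_mult abs_mult powr_mult)
  also have "\<dots> \<le> (\<Prod>p\<in>prime_block z N. (1 / (1 - real p powr (- \<sigma>)))\<^sup>2)"
  proof (intro prod_mono conjI)
    fix p assume "p \<in> prime_block z N"
    define x where "x = real p powr (- \<sigma>)"
    have x: "0 \<le> x" "x < 1" using prime_powr_less_1[of p \<sigma>] prime_blockD[OF \<open>p \<in> _\<close>] assms by (auto simp: x_def)
    have "(1 + x)\<^sup>2 \<le> (1 / (1 - x))\<^sup>2" using x by (intro power_mono) (auto simp: field_simps)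
    moreover have "1 + 2 * x \<le> (1 + x)\<^sup>2" by (simp add: power2_eq_square algebra_simps)
    ultimately show "1 + 2 * real p powr (- \<sigma>) \<le> (1 / (1 - real p powr (- \<sigma>)))\<^sup>2" by (simp add: x_def)
  qed auto
  also have "\<dots> = (\<Prod>p\<in>prime_block z N. 1 / (1 - real p powr (- \<sigma>)))\<^sup>2" by (simp add: prod_power_distrib)
  also have "\<dots> \<le> (zeta_re \<sigma>)\<^sup>2"
    using assms prime_powr_less_1[of _ \<sigma>]
    by (intro power_mono prod_inverse_primes_le prod_nonneg) (auto intro: less_imp_le dest: prime_blockD)
  finally show ?thesis .
qed

text \<open>The quotient of the product of 1 - 2 * p powr (- s) over z < p \<le> N by
  \<open>(euler_inv N s)\<^sup>2\<close>: primes up to z appear only in the denominator, and for the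
  others the first-order terms in p powr (- s) cancel.\<close>

definition sieve_factor :: "nat \<Rightarrow> nat \<Rightarrow> complex \<Rightarrow> complex" where
  "sieve_factor z N s = (\<Prod>p\<in>prime_block 0 z. 1 / (1 - of_nat p powr (- s))\<^sup>2)
     * (\<Prod>p\<in>prime_block z N. (1 - 2 * of_nat p powr (- s)) / (1 - of_nat p powr (- s))\<^sup>2)"

lemma norm_prime_powr_less_1:
  assumes "prime p" "Re s > 0" shows "norm (of_nat p powr (- s) :: complex) < 1"
  using prime_powr_less_1[OF assms] prime_ge_1_nat[OF assms(1)] by (simp add: norm_of_nat_powr)

lemma one_minus_prime_powr_nonzero:
  assumes "prime p" "Re s > 0" shows "1 - of_nat p powr (- s) \<noteq> (0 :: complex)"
  using norm_prime_powr_less_1[OF assms] by auto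

lemma sieve_prod_eq:
  assumes "Re s > 0" "z \<le> N"
  shows "(\<Prod>p\<in>prime_block z N. 1 - 2 * of_nat p powr (- s)) = (euler_inv N s)\<^sup>2 * sieve_factor z N s"
proof -
  have un: "{p. prime p \<and> p \<le> N} = prime_block 0 z \<union> prime_block z N" "prime_block 0 z \<inter> prime_block z N = {}"
    using assms(2) by (auto simp: prime_block_def intro: prime_gt_0_nat)
  let ?w = "\<lambda>p::nat. 1 - of_nat p powr (- s) :: complex"
  have nz: "?w p \<noteq> 0" if "prime p" for p using one_minus_prime_powr_nonzero[OF that assms(1)] .
  have "(euler_inv N s)\<^sup>2 = (\<Prod>p\<in>prime_block 0 z. (?w p)\<^sup>2) * (\<Prod>p\<in>prime_block z N. (?w p)\<^sup>2)"
    unfolding euler_inv_def un(1) using un(2) by (simp add: prod.union_disjoint power_mult_distrib prod_power_distrib)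
  then have "(euler_inv N s)\<^sup>2 * sieve_factor z N s =
     (\<Prod>p\<in>prime_block 0 z. (?w p)\<^sup>2 * (1 / (?w p)\<^sup>2)) * (\<Prod>p\<in>prime_block z N. (?w p)\<^sup>2 * ((1 - 2 * of_nat p powr (- s)) / (?w p)\<^sup>2))"
    by (simp only: sieve_factor_def prod.distrib mult_ac)
  also have "\<dots> = (\<Prod>p\<in>prime_block 0 z. 1) * (\<Prod>p\<in>prime_block z N. 1 - 2 * of_nat p powr (- s))"
    by (intro arg_cong2[of _ _ _ _ "(*)"] prod.cong) (use nz in \<open>auto dest: prime_blockD\<close>)
  finally show ?thesis by simp
qed

lemma holomorphic_sieve_factor: "sieve_factor z N holomorphic_on {s. Re s > 0}"
  unfolding sieve_factor_def
  by (intro holomorphic_intros) (use one_minus_prime_powr_nonzero in \<open>auto dest!: prime_blockD\<close>)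

lemma harm_le_ln:
  assumes "n \<ge> 1" shows "harm n \<le> 1 + ln (real n)"
proof -
  obtain m where m: "n = Suc m" using assms by (cases n) auto
  have "harm (Suc m) - ln (real (Suc m)) \<le> harm (Suc 0) - ln (real (Suc 0))"
    using decseq_harm_diff_ln[THEN decseqD, of 0 m] by simp
  then show ?thesis by (simp add: m harm_expand)
qed

text \<open>To the left of 1, as long as (1 - \<sigma>) * ln z \<le> 1, the powers n powr (-
  \<sigma>) with n \<le> z exceed 1 / n by at most the factor e, so the sum is still of harmonic
  size.\<close>

lemma sum_powr_le:
  assumes "z \<ge> 1" "(1 - \<sigma>) * ln (real z) \<le> 1"
  shows "(\<Sum>n=1..z. real n powr (- \<sigma>)) \<le> 3 * (1 + ln (real z))"
proof -
  have "(\<Sum>n=1..z. real n powr (- \<sigma>)) \<le> (\<Sum>n=1..z. 3 * inverse (real n))"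
  proof (rule sum_mono)
    fix n assume n: "n \<in> {1..z}"
    have l: "0 \<le> ln (real n)" "ln (real n) \<le> ln (real z)" using n by auto
    have "(1 - \<sigma>) * ln (real n) \<le> 1"
    proof (cases "\<sigma> \<le> 1")
      case True
      then show ?thesis using mult_left_mono[OF l(2), of "1 - \<sigma>"] assms(2) by simp
    next
      case False
      then have "(1 - \<sigma>) * ln (real n) \<le> 0" using l by (intro mult_nonpos_nonneg) auto
      then show ?thesis by simp
    qed
    then have "exp ((1 - \<sigma>) * ln (real n)) \<le> exp 1" by simp
    also have "exp 1 \<le> (3::real)" by (rule exp_le)
    finally have "real n powr (1 - \<sigma>) \<le> 3" using n by (simp add: powr_def)
    moreover have "real n powr (- \<sigma>) = real n powr (1 - \<sigma>) * inverse (real n)"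
      using n by (simp add: powr_diff powr_minus field_simps)
    ultimately show "real n powr (- \<sigma>) \<le> 3 * inverse (real n)" using n by (simp add: mult_right_mono)
  qed
  also have "\<dots> = 3 * harm z" by (simp add: harm_def sum_distrib_left)
  also have "\<dots> \<le> 3 * (1 + ln (real z))" using harm_le_ln[of z] assms by simp
  finally show ?thesis .
qed

text \<open>Small primes: each w = p powr (- s) has modulus at most 3/4, so 1 / \<bar>1 - w\<bar>^2
  \<le> exp (8 * \<bar>w\<bar>), and the sum of the \<bar>w\<bar> is at most 3 * (1 + ln z), whence
  the exponent 24 = 8 * 3. Large primes: a convergent product, bounded independently of N.\<close>

lemma norm_sieve_factor:
  obtains C where "C > 0" "\<And>z N s. Re s \<ge> 3/4 \<Longrightarrow> z \<ge> 1 \<Longrightarrow> (1 - Re s) * ln (real z) \<le> 1 \<Longrightarrow>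
    norm (sieve_factor z N s) \<le> C * real z ^ 24"
proof -
  show ?thesis
  proof (rule that[of "exp 24 * exp (16 * zeta_re (3/2))"])
    fix z N :: nat and s :: complex assume s: "Re s \<ge> 3/4" and z: "z \<ge> 1" "(1 - Re s) * ln (real z) \<le> 1"
    let ?w = "\<lambda>p::nat. of_nat p powr (- s) :: complex"
    have w: "norm (?w p) \<le> 3/4" "norm (?w p) = real p powr (- Re s)" "norm (1 - ?w p) \<ge> 1 / 4"
      "norm (1 - ?w p) \<ge> 1 - norm (?w p)" if p: "prime p" for p
    proof -
      have p2: "p \<ge> 2" using prime_ge_2_nat[OF p] .
      show n: "norm (?w p) = real p powr (- Re s)" using p2 by (simp add: norm_of_nat_powr)
      have "real p powr (- Re s) \<le> 2 powr (- Re s)" using p2 s by (intro powr_mono2') auto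
      also have "\<dots> \<le> 2 powr (- (3/4))" using s by (intro powr_mono) auto
      also have "\<dots> \<le> 3/4"
      proof -
        define q where "q = (2::real) powr (3/4)"
        have "q ^ 4 = 2 powr (3/4 * real 4)" unfolding q_def by (subst powr_power) auto
        also have "\<dots> = 8" by simp
        finally have "q ^ 4 = 8" .
        moreover have "(4/3::real) ^ 4 \<le> 8" by (simp add: power_divide)
        ultimately have "(4/3) ^ Suc 3 \<le> q ^ Suc 3" by simp
        then have "4/3 \<le> q" by (rule power_le_imp_le_base) (simp add: q_def)
        then have "1 / q \<le> 3/4" by (simp add: field_simps)
        then show ?thesis by (simp add: q_def powr_minus inverse_eq_divide)
      qed
      finally show l: "norm (?w p) \<le> 3/4" by (simp add: n)
      show "norm (1 - ?w p) \<ge> 1 - norm (?w p)" using norm_triangle_ineq2[of 1 "?w p"] by simp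
      then show "norm (1 - ?w p) \<ge> 1 / 4" using l by linarith
    qed
    have "norm (\<Prod>p\<in>prime_block 0 z. 1 / (1 - ?w p)\<^sup>2) \<le> (\<Prod>p\<in>prime_block 0 z. exp (8 * real p powr (- Re s)))"
      unfolding prod_norm[symmetric]
    proof (intro prod_mono conjI norm_ge_zero)
      fix p assume "p \<in> prime_block 0 z"
      then have p: "prime p" by (rule prime_blockD)
      define x where "x = norm (?w p)"
      have x: "0 \<le> x" "x \<le> 3/4" using w(1)[OF p] by (auto simp: x_def)
      have n1: "norm (1 - ?w p) \<ge> 1 - x" using w(4)[OF p] by (simp add: x_def)
      have "norm (1 / (1 - ?w p)) \<le> 1 / (1 - x)"
        unfolding norm_divide norm_one using x n1 by (intro divide_left_mono mult_pos_pos) linarith+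
      also have "\<dots> \<le> 1 + 4 * x"
      proof -
        have "0 \<le> x * (3 - 4 * x)" using x by (intro mult_nonneg_nonneg) auto
        then have "1 \<le> (1 + 4 * x) * (1 - x)" by (simp add: algebra_simps)
        then show ?thesis using x by (simp add: divide_le_eq)
      qed
      also have "\<dots> \<le> exp (4 * x)" using exp_ge_add_one_self[of "4 * x"] by simp
      finally have "(norm (1 / (1 - ?w p)))\<^sup>2 \<le> (exp (4 * x))\<^sup>2" by (intro power_mono) auto
      also have "\<dots> = exp (8 * x)" by (simp flip: exp_of_nat_mult exp_double)
      finally show "norm (1 / (1 - ?w p)\<^sup>2) \<le> exp (8 * real p powr (- Re s))"
        using w(2)[OF p] by (simp add: x_def norm_divide norm_power power_divide)
    qed
    also have "\<dots> = exp (8 * (\<Sum>p\<in>prime_block 0 z. real p powr (- Re s)))"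
      by (simp add: exp_sum sum_distrib_left)
    also have "\<dots> \<le> exp (8 * (3 * (1 + ln (real z))))"
    proof -
      have "(\<Sum>p\<in>prime_block 0 z. real p powr (- Re s)) \<le> (\<Sum>n=1..z. real n powr (- Re s))"
        by (intro sum_mono2) (auto simp: prime_block_def)
      also have "\<dots> \<le> 3 * (1 + ln (real z))" by (rule sum_powr_le[OF z])
      finally show ?thesis by simp
    qed
    also have "\<dots> = exp 24 * exp (24 * ln (real z))" by (simp flip: exp_add add: algebra_simps)
    also have "exp (24 * ln (real z)) = real z ^ 24"
      using z(1) exp_of_nat_mult[of 24 "ln (real z)"] by simp
    finally have 1: "norm (\<Prod>p\<in>prime_block 0 z. 1 / (1 - ?w p)\<^sup>2) \<le> exp 24 * real z ^ 24" .
    have "norm (\<Prod>p\<in>prime_block z N. (1 - 2 * ?w p) / (1 - ?w p)\<^sup>2)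
        \<le> (\<Prod>p\<in>prime_block z N. exp (16 * real p powr (- (3/2))))"
      unfolding prod_norm[symmetric]
    proof (intro prod_mono conjI norm_ge_zero)
      fix p assume "p \<in> prime_block z N"
      then have p: "prime p" by (rule prime_blockD)
      have nz: "1 - ?w p \<noteq> 0" using w(3)[OF p] by auto
      \<comment> \<open>Writing the numerator as a difference of squares shows that the factor
        differs from 1 only by a term of second order.\<close>
      have "1 - 2 * ?w p = (1 - ?w p)\<^sup>2 - (?w p)\<^sup>2" by (simp add: power2_eq_square algebra_simps)
      then have "(1 - 2 * ?w p) / (1 - ?w p)\<^sup>2 = 1 - (?w p)\<^sup>2 / (1 - ?w p)\<^sup>2"
        using nz by (simp only: diff_divide_distrib) simp
      then have "norm ((1 - 2 * ?w p) / (1 - ?w p)\<^sup>2) \<le> 1 + (norm (?w p))\<^sup>2 / (norm (1 - ?w p))\<^sup>2"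
        using norm_triangle_ineq4[of 1 "(?w p)\<^sup>2 / (1 - ?w p)\<^sup>2"] by (simp add: norm_divide norm_power)
      also have "\<dots> \<le> 1 + (norm (?w p))\<^sup>2 / (1/4)\<^sup>2"
        using w(3)[OF p] by (intro add_left_mono divide_left_mono power_mono mult_pos_pos) auto
      also have "\<dots> = 1 + 16 * real p powr (- (2 * Re s))"
        unfolding w(2)[OF p] using powr_power[of "real p" "- Re s" 2]
        by (simp add: power2_eq_square mult.commute flip: powr_add)
      also have "\<dots> \<le> 1 + 16 * real p powr (- (3/2))"
        using s prime_ge_1_nat[OF p] by (intro add_left_mono mult_left_mono powr_mono) auto
      also have "\<dots> \<le> exp (16 * real p powr (- (3/2)))" by (rule exp_ge_add_one_self)
      finally show "norm ((1 - 2 * ?w p) / (1 - ?w p)\<^sup>2) \<le> exp (16 * real p powr (- (3/2)))" .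
    qed
    also have "\<dots> = exp (16 * (\<Sum>p\<in>prime_block z N. real p powr (- (3/2))))"
      by (simp add: exp_sum sum_distrib_left)
    also have "\<dots> \<le> exp (16 * zeta_re (3/2))"
    proof -
      have "(\<Sum>p\<in>prime_block z N. real p powr (- (3/2))) = (\<Sum>\<^sub>\<infinity>p\<in>prime_block z N. real p powr (- (3/2)))"
        by simp
      also have "\<dots> \<le> zeta_re (3/2)" unfolding zeta_re_def
        by (intro infsum_mono2 summable_on_powr_real) (auto simp: prime_block_def)
      finally show ?thesis by simp
    qed
    finally have 2: "norm (\<Prod>p\<in>prime_block z N. (1 - 2 * ?w p) / (1 - ?w p)\<^sup>2) \<le> exp (16 * zeta_re (3/2))" .
    have "norm (sieve_factor z N s) \<le> (exp 24 * real z ^ 24) * exp (16 * zeta_re (3/2))"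
      unfolding sieve_factor_def norm_mult using 1 2 by (intro mult_mono) auto
    then show "norm (sieve_factor z N s) \<le> exp 24 * exp (16 * zeta_re (3/2)) * real z ^ 24" by (simp add: mult_ac)
  qed simp
qed

section \<open>The Perron kernel\<close>

abbreviation vertical_integral :: "real \<Rightarrow> real \<Rightarrow> (complex \<Rightarrow> complex) \<Rightarrow> complex" where
  "vertical_integral c T \<equiv> contour_integral (linepath (Complex c (- T)) (Complex c T))"

abbreviation horizontal_integral :: "real \<Rightarrow> real \<Rightarrow> real \<Rightarrow> (complex \<Rightarrow> complex) \<Rightarrow> complex" where
  "horizontal_integral t a b \<equiv> contour_integral (linepath (Complex a t) (Complex b t))"

lemma contour_integral_rectpath:
  assumes "a \<le> b" "T \<ge> 0" "continuous_on (cbox (Complex a (- T)) (Complex b T) - box (Complex a (- T)) (Complex b T)) f"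
  shows "contour_integral (rectpath (Complex a (- T)) (Complex b T)) f
    = horizontal_integral (- T) a b f
      + vertical_integral b T f
      - horizontal_integral T a b f
      - vertical_integral a T f"
proof -
  let ?p = "Complex a (- T)" and ?q = "Complex b (- T)" and ?r = "Complex b T" and ?u = "Complex a T"
  have im: "path_image (rectpath ?p ?r) = cbox ?p ?r - box ?p ?r"
    using assms by (intro path_image_rectpath_cbox_minus_box) auto
  have im': "path_image (rectpath ?p ?r) = closed_segment ?p ?q \<union> closed_segment ?q ?r \<union> closed_segment ?r ?u \<union> closed_segment ?u ?p"
    by (simp add: rectpath_def Let_def path_image_join Un_assoc)
  have sub: "closed_segment ?p ?q \<subseteq> cbox ?p ?r - box ?p ?r" "closed_segment ?q ?r \<subseteq> cbox ?p ?r - box ?p ?r"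
    "closed_segment ?r ?u \<subseteq> cbox ?p ?r - box ?p ?r" "closed_segment ?u ?p \<subseteq> cbox ?p ?r - box ?p ?r"
    using im im' by auto
  have ci: "f contour_integrable_on linepath ?p ?q" "f contour_integrable_on linepath ?q ?r"
    "f contour_integrable_on linepath ?r ?u" "f contour_integrable_on linepath ?u ?p"
    by (intro contour_integrable_continuous_linepath continuous_on_subset[OF assms(3)] sub)+
  have "contour_integral (rectpath ?p ?r) f = contour_integral (linepath ?p ?q) f + (contour_integral (linepath ?q ?r) f
     + (contour_integral (linepath ?r ?u) f + contour_integral (linepath ?u ?p) f))"
    using ci by (simp add: rectpath_def Let_def valid_path_join contour_integrable_join)
  also have "contour_integral (linepath ?r ?u) f = - contour_integral (linepath ?u ?r) f"
    using sub(3) by (intro contour_integral_reverse_linepath continuous_on_subset[OF assms(3)])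
  also have "contour_integral (linepath ?u ?p) f = - contour_integral (linepath ?p ?u) f"
    using sub(4) by (intro contour_integral_reverse_linepath continuous_on_subset[OF assms(3)])
  finally show ?thesis by simp
qed

lemma linepath_horizontal:
  assumes "z \<in> closed_segment (Complex a t) (Complex b t)" "a \<le> b"
  shows "Im z = t" "a \<le> Re z" "Re z \<le> b"
proof -
  obtain u where u: "0 \<le> u" "u \<le> 1" "z = (1 - u) *\<^sub>R Complex a t + u *\<^sub>R Complex b t"
    using assms(1) by (auto simp: in_segment)
  have "Im z = t" "Re z = a + u * (b - a)" unfolding u(3) by (simp_all add: algebra_simps)
  moreover have "0 \<le> u * (b - a)" using u(1) assms(2) by simp
  moreover have "u * (b - a) \<le> 1 * (b - a)" using u(2) assms(2) by (intro mult_right_mono) auto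
  ultimately show "Im z = t" "a \<le> Re z" "Re z \<le> b" by auto
qed

lemma linepath_vertical:
  assumes "z \<in> closed_segment (Complex c (- T)) (Complex c T)" "T \<ge> 0"
  shows "Re z = c" "\<bar>Im z\<bar> \<le> T"
proof -
  obtain u where u: "0 \<le> u" "u \<le> 1" "z = (1 - u) *\<^sub>R Complex c (- T) + u *\<^sub>R Complex c T"
    using assms(1) by (auto simp: in_segment)
  have "Re z = c" "Im z = - T + u * (2 * T)" unfolding u(3) by (simp_all add: algebra_simps)
  moreover have "0 \<le> u * (2 * T)" using u(1) assms(2) by simp
  moreover have "u * (2 * T) \<le> 1 * (2 * T)" using u(2) assms(2) by (intro mult_right_mono) auto
  ultimately show "Re z = c" "\<bar>Im z\<bar> \<le> T" by linarith+
qed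

lemma horizontal_avoid:
  assumes "t \<noteq> 0" "a \<le> b"
  shows "0 \<notin> closed_segment (Complex a t) (Complex b t)" "-1 \<notin> closed_segment (Complex a t) (Complex b t)"
  using linepath_horizontal(1)[of _ a t b] assms by force+

lemma vertical_avoid:
  assumes "c \<noteq> 0" "c \<noteq> -1" "T \<ge> 0"
  shows "0 \<notin> closed_segment (Complex c (- T)) (Complex c T)" "-1 \<notin> closed_segment (Complex c (- T)) (Complex c T)"
  using linepath_vertical(1)[of _ c T] assms by force+

lemma norm_horizontal_integral:
  assumes "a \<le> b" "B \<ge> 0" "continuous_on (closed_segment (Complex a t) (Complex b t)) f"
    and "\<And>z. Im z = t \<Longrightarrow> a \<le> Re z \<Longrightarrow> Re z \<le> b \<Longrightarrow> norm (f z) \<le> B"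
  shows "norm (horizontal_integral t a b f) \<le> B * (b - a)"
proof -
  have "norm (horizontal_integral t a b f) \<le> B * norm (Complex b t - Complex a t)"
    using assms linepath_horizontal
    by (intro contour_integral_bound_linepath contour_integrable_continuous_linepath) auto
  also have "Complex b t - Complex a t = of_real (b - a)" by (simp add: complex_eq_iff)
  finally show ?thesis using assms(1) by (simp only: norm_of_real abs_of_nonneg diff_ge_0_iff_ge)
qed

lemma norm_vertical_integral:
  assumes "T \<ge> 0" "B \<ge> 0" "continuous_on (closed_segment (Complex c (- T)) (Complex c T)) f"
    and "\<And>z. Re z = c \<Longrightarrow> \<bar>Im z\<bar> \<le> T \<Longrightarrow> norm (f z) \<le> B"
  shows "norm (vertical_integral c T f) \<le> B * (2 * T)"
proof -
  have "norm (vertical_integral c T f) \<le> B * norm (Complex c T - Complex c (- T))"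
    using assms linepath_vertical
    by (intro contour_integral_bound_linepath contour_integrable_continuous_linepath) auto
  also have "Complex c T - Complex c (- T) = \<i> * of_real (2 * T)" by (simp add: complex_eq_iff)
  also have "norm (\<i> * of_real (2 * T)) = 2 * T" using assms(1) by (simp add: norm_mult)
  finally show ?thesis .
qed

lemma norm_add_diff_le:
  fixes a b c :: "'a :: real_normed_vector"
  shows "norm (a + b - c) \<le> norm a + norm b + norm c"
  using norm_triangle_ineq4[of "a + b" c] norm_triangle_ineq[of a b] by linarith

lemma perron_kernel_bound:
  assumes "norm s \<ge> A" "norm (s + 1) \<ge> B" "A > 0" "B > 0" "y > 0" "y powr Re s \<le> Y" "Y \<ge> 0"
  shows "norm (of_real y powr s / (s * (s + 1))) \<le> Y / (A * B)"
proof -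
  have "norm (of_real y powr s / (s * (s + 1))) = y powr Re s / (norm s * norm (s + 1))"
    using assms by (simp add: norm_divide norm_mult norm_powr_real_powr)
  also have "\<dots> \<le> Y / (A * B)" using assms by (intro frac_le mult_mono mult_pos_pos) auto
  finally show ?thesis .
qed

text \<open>For y \<ge> 1 the line is pushed left to Re s = - T, past the poles at 0 and -1 with
  residues 1 and - 1 / y; for y < 1 it is pushed right to Re s = T, past no pole. The quadratic
  decay of the kernel makes the error uniform, also for y close to 1.\<close>

lemma perron_kernel:
  assumes y: "y > 0" and c: "1 < c" "c \<le> 2" and T: "T \<ge> 3"
  shows "norm (vertical_integral c T (\<lambda>s. of_real y powr s / (s * (s + 1)))
     - 2 * of_real pi * \<i> * of_real (max 0 (1 - 1 / y))) \<le> 8 * y powr c / T"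
proof -
  define f where "f = (\<lambda>s. of_real y powr s / (s * (s + 1)) :: complex)"
  have cont: "continuous_on A f" if "0 \<notin> A" "-1 \<notin> A" for A
    unfolding f_def using that y
    by (intro continuous_intros) (auto simp: add_eq_0_iff2)
  have Yp: "y powr c > 0" using y by simp
  have inT: "norm z \<ge> T" "norm (z + 1) \<ge> T" if "\<bar>Im z\<bar> = T" for z
    using abs_Im_le_cmod[of z] abs_Im_le_cmod[of "z + 1"] that by auto
  show ?thesis
  proof (cases "y \<ge> 1")
    case True
    have hor: "norm (horizontal_integral t (- T) c f) \<le> y powr c / (T * T) * (c - - T)"
      if "\<bar>t\<bar> = T" for t
    proof (rule norm_horizontal_integral)
      show "continuous_on (closed_segment (Complex (- T) t) (Complex c t)) f"
        using that c T by (intro cont horizontal_avoid) auto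
      fix z assume "Im z = t" "Re z \<le> c"
      then show "norm (f z) \<le> y powr c / (T * T)"
        unfolding f_def using that T y inT[of z] True by (intro perron_kernel_bound powr_mono) auto
    qed (use c T Yp in auto)
    have "y powr c / (T * T) * (c - - T) \<le> y powr c / (T * T) * (2 * T)"
      using c T Yp by (intro mult_left_mono) auto
    also have "\<dots> = 2 * y powr c / T" using T by simp
    finally have hle: "y powr c / (T * T) * (c - - T) \<le> 2 * y powr c / T" .
    note hor2 = order_trans[OF hor hle]
    have ver: "norm (vertical_integral (- T) T f) \<le> y powr c / (T * (T / 2)) * (2 * T)"
    proof (rule norm_vertical_integral)
      show "continuous_on (closed_segment (Complex (- T) (- T)) (Complex (- T) T)) f"
        using c T by (intro cont vertical_avoid) auto
      fix z assume z: "Re z = - T"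
      have "norm z \<ge> T" "norm (z + 1) \<ge> T / 2"
        using z abs_Re_le_cmod[of z] abs_Re_le_cmod[of "z + 1"] T by auto
      then show "norm (f z) \<le> y powr c / (T * (T / 2))"
        unfolding f_def using z T y True c by (intro perron_kernel_bound powr_mono) auto
    qed (use c T Yp in auto)
    have vle: "y powr c / (T * (T / 2)) * (2 * T) = 4 * y powr c / T" using T by simp
    let ?S = "UNIV :: complex set" and ?\<gamma> = "rectpath (Complex (- T) (- T)) (Complex c T)"
    have im: "path_image ?\<gamma> = cbox (Complex (- T) (- T)) (Complex c T) - box (Complex (- T) (- T)) (Complex c T)"
      using c T by (intro path_image_rectpath_cbox_minus_box) auto
    have box: "0 \<in> box (Complex (- T) (- T)) (Complex c T)" "-1 \<in> box (Complex (- T) (- T)) (Complex c T)"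
      using c T by (auto simp: in_box_complex_iff)
    have ny: "of_real y \<noteq> (0::complex)" using y by simp
    \<comment> \<open>Partial fractions 1 / s - 1 / (s + 1) reduce the residue computation to two
      instances of Cauchy's integral formula.\<close>
    have cauchy: "((\<lambda>w. of_real y powr w / (w - z)) has_contour_integral (2 * of_real pi * \<i> * of_real y powr z)) ?\<gamma>"
      if z: "z \<in> box (Complex (- T) (- T)) (Complex c T)" for z
    proof -
      have "((\<lambda>w. of_real y powr w / (w - z)) has_contour_integral (of_real (2 * pi) * \<i> * winding_number ?\<gamma> z * of_real y powr z)) ?\<gamma>"
        using z by (intro Cauchy_integral_formula_convex_simple[of UNIV] holomorphic_intros) (auto simp: im)
      then show ?thesis using winding_number_rectpath[OF z] by simp
    qed
    have "((\<lambda>w. of_real y powr w / (w - 0) - of_real y powr w / (w - (-1))) has_contour_integral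
        (2 * of_real pi * \<i> * of_real y powr 0 - 2 * of_real pi * \<i> * of_real y powr (-1))) ?\<gamma>"
      by (intro has_contour_integral_diff cauchy box)
    then have "(f has_contour_integral (2 * of_real pi * \<i> * of_real y powr 0 - 2 * of_real pi * \<i> * of_real y powr (-1))) ?\<gamma>"
    proof (rule has_contour_integral_eq)
      fix w assume "w \<in> path_image ?\<gamma>"
      then have "w \<noteq> 0" "w + 1 \<noteq> 0" using box im by (auto simp: add_eq_0_iff2)
      then show "of_real y powr w / (w - 0) - of_real y powr w / (w - (-1)) = f w"
        by (simp add: f_def field_simps)
    qed
    moreover have "2 * of_real pi * \<i> * of_real y powr 0 - 2 * of_real pi * \<i> * of_real y powr (-1)
        = 2 * of_real pi * \<i> * of_real (max 0 (1 - 1 / y))"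
      using y True by (simp add: powr_minus inverse_eq_divide right_diff_distrib)
    ultimately have W: "contour_integral ?\<gamma> f = 2 * of_real pi * \<i> * of_real (max 0 (1 - 1 / y))"
      by (metis contour_integral_unique)
    have "contour_integral ?\<gamma> f
      = horizontal_integral (- T) (- T) c f
      + vertical_integral c T f
      - horizontal_integral T (- T) c f
      - vertical_integral (- T) T f"
      using c T box by (intro contour_integral_rectpath cont) auto
    then have eq: "vertical_integral c T f - 2 * of_real pi * \<i> * of_real (max 0 (1 - 1 / y))
      = horizontal_integral T (- T) c f
      + vertical_integral (- T) T f
      - horizontal_integral (- T) (- T) c f"
      unfolding W by (simp add: algebra_simps)
    have "norm (vertical_integral c T f - 2 * of_real pi * \<i> * of_real (max 0 (1 - 1 / y)))
      \<le> norm (horizontal_integral T (- T) c f)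
      + norm (vertical_integral (- T) T f)
      + norm (horizontal_integral (- T) (- T) c f)"
      unfolding eq by (rule norm_add_diff_le)
    also have "\<dots> \<le> 2 * y powr c / T + 4 * y powr c / T + 2 * y powr c / T"
      by (intro add_mono hor2 ver[unfolded vle]) (use T in simp_all)
    also have "\<dots> = 8 * y powr c / T" by (simp add: field_simps)
    finally show ?thesis unfolding f_def .
  next
    case False
    then have y1: "y < 1" by simp
    have mono: "y powr u \<le> y powr c" if "c \<le> u" for u
      using that y y1 by (intro powr_mono') auto
    have hor: "norm (horizontal_integral t c T f) \<le> y powr c / (T * T) * (T - c)"
      if "\<bar>t\<bar> = T" for t
    proof (rule norm_horizontal_integral)
      show "continuous_on (closed_segment (Complex c t) (Complex T t)) f"
        using that c T by (intro cont horizontal_avoid) auto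
      fix z assume "Im z = t" "c \<le> Re z"
      then show "norm (f z) \<le> y powr c / (T * T)"
        unfolding f_def using that T y inT[of z] mono[of "Re z"] by (intro perron_kernel_bound) auto
    qed (use c T Yp in auto)
    have "y powr c / (T * T) * (T - c) \<le> y powr c / (T * T) * (2 * T)"
      using c T Yp by (intro mult_left_mono) auto
    also have "\<dots> = 2 * y powr c / T" using T by simp
    finally have hle: "y powr c / (T * T) * (T - c) \<le> 2 * y powr c / T" .
    note hor2 = order_trans[OF hor hle]
    have ver: "norm (vertical_integral T T f) \<le> y powr c / (T * T) * (2 * T)"
    proof (rule norm_vertical_integral)
      show "continuous_on (closed_segment (Complex T (- T)) (Complex T T)) f"
        using c T by (intro cont vertical_avoid) auto
      fix z assume z: "Re z = T"
      have "norm z \<ge> T" "norm (z + 1) \<ge> T"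
        using z abs_Re_le_cmod[of z] abs_Re_le_cmod[of "z + 1"] T by auto
      then show "norm (f z) \<le> y powr c / (T * T)"
        unfolding f_def using z T y mono[of "Re z"] c by (intro perron_kernel_bound) auto
    qed (use c T Yp in auto)
    have vle: "y powr c / (T * T) * (2 * T) = 2 * y powr c / T" using T by simp
    let ?\<gamma> = "rectpath (Complex c (- T)) (Complex T T)"
    have inR: "Re z \<ge> c" if "z \<in> cbox (Complex c (- T)) (Complex T T)" for z
      using that by (auto simp: in_cbox_complex_iff)
    have "(f has_contour_integral 0) ?\<gamma>"
    proof (rule Cauchy_theorem_convex_simple[of _ "{z. Re z > 0}"])
      show "f holomorphic_on {z. Re z > 0}"
        unfolding f_def using y by (intro holomorphic_intros) (auto simp: add_eq_0_iff2)
      show "convex {z. Re z > 0}" by (rule convex_halfspace_Re_gt)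
      have "path_image ?\<gamma> \<subseteq> cbox (Complex c (- T)) (Complex T T)"
        using c T by (intro path_image_rectpath_subset_cbox) auto
      then show "path_image ?\<gamma> \<subseteq> {z. Re z > 0}" using inR c by fastforce
    qed auto
    then have W: "contour_integral ?\<gamma> f = 0" by (rule contour_integral_unique)
    have "contour_integral ?\<gamma> f
      = horizontal_integral (- T) c T f
      + vertical_integral T T f
      - horizontal_integral T c T f
      - vertical_integral c T f"
      using c T inR[of 0] inR[of "-1"] by (intro contour_integral_rectpath cont) auto
    then have eq: "vertical_integral c T f - 2 * of_real pi * \<i> * of_real (max 0 (1 - 1 / y))
      = horizontal_integral (- T) c T f
      + vertical_integral T T f
      - horizontal_integral T c T f"
      unfolding W using y1 y by (simp add: algebra_simps max_def)
    have "norm (vertical_integral c T f - 2 * of_real pi * \<i> * of_real (max 0 (1 - 1 / y)))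
      \<le> norm (horizontal_integral (- T) c T f)
      + norm (vertical_integral T T f)
      + norm (horizontal_integral T c T f)"
      unfolding eq by (rule norm_add_diff_le)
    also have "\<dots> \<le> 2 * y powr c / T + 2 * y powr c / T + 2 * y powr c / T"
      by (intro add_mono hor2 ver[unfolded vle]) (use T in simp_all)
    also have "\<dots> \<le> 8 * y powr c / T" using Yp T by (simp add: field_simps)
    finally show ?thesis unfolding f_def .
  qed
qed

section \<open>Riesz means over rough numbers\<close>

text \<open>Squarefreeness is built in: up to any bound these are exactly the divisors of a product
  of distinct primes exceeding z.\<close>

definition rough :: "nat \<Rightarrow> nat set" where
  "rough z = {n. n > 0 \<and> squarefree n \<and> (\<forall>p. prime p \<longrightarrow> p dvd n \<longrightarrow> z < p)}"

lemma squarefree_prod_primes: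
  assumes "finite P" "\<And>p. p \<in> P \<Longrightarrow> prime (p::nat)"
  shows "squarefree (\<Prod>P)"
  using assms
proof (induction P)
  case (insert p P)
  have "coprime p (\<Prod>P)"
    using insert primes_coprime[of p] by (intro prod_coprime_right) auto
  then show ?case using insert by (auto intro!: squarefree_mult_coprime simp: squarefree_prime)
qed simp

lemma dvd_prod_prime_block:
  "n dvd \<Prod>(prime_block z N) \<longleftrightarrow> n \<in> rough z \<and> (\<forall>p. prime p \<longrightarrow> p dvd n \<longrightarrow> p \<le> N)"
proof
  let ?P = "prime_block z N"
  assume n: "n dvd \<Prod>?P"
  have "\<Prod>?P \<noteq> 0" using prime_blockD[of 0 z N] by (auto simp: prod_zero_iff)
  then have "n > 0" using n by (cases n) auto
  moreover have "squarefree n"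
    using squarefree_mono[OF n] squarefree_prod_primes[of ?P] prime_blockD by auto
  moreover have "z < p \<and> p \<le> N" if p: "prime p" "p dvd n" for p
  proof -
    obtain q where q: "q \<in> ?P" "p dvd q" using p n prime_dvd_prod_iff[of ?P p "\<lambda>p. p"] dvd_trans by auto
    then have "p = q" using primes_dvd_imp_eq[OF p(1) prime_blockD] by blast
    then show ?thesis using q by (simp add: prime_block_def)
  qed
  ultimately show "n \<in> rough z \<and> (\<forall>p. prime p \<longrightarrow> p dvd n \<longrightarrow> p \<le> N)" by (auto simp: rough_def)
next
  assume n: "n \<in> rough z \<and> (\<forall>p. prime p \<longrightarrow> p dvd n \<longrightarrow> p \<le> N)"
  then have n0: "n > 0" "squarefree n" by (auto simp: rough_def)
  have "n = (\<Prod>p\<in>prime_factors n. p ^ multiplicity p n)" using n0 by (simp add: prime_factorization_nat[symmetric])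
  also have "\<dots> = \<Prod>(prime_factors n)"
    using n0 squarefree_factorial_semiring'[of n] by (intro prod.cong) auto
  also have "\<dots> dvd \<Prod>(prime_block z N)"
    using n by (intro prod_dvd_prod_subset) (auto simp: prime_block_def rough_def prime_factors_dvd)
  finally show "n dvd \<Prod>(prime_block z N)" .
qed

lemma dvd_prod_prime_block_le:
  assumes "n \<le> N" shows "n dvd \<Prod>(prime_block z N) \<longleftrightarrow> n \<in> rough z"
proof -
  have "p \<le> N" if "n \<in> rough z" "p dvd n" for p
    using that assms dvd_imp_le[of p n] by (auto simp: rough_def)
  then show ?thesis by (auto simp: dvd_prod_prime_block)
qed

text \<open>The weight 1 - n / x is the inverse Mellin transform of 1 / (s * (s + 1)) at x / n, for
  n \<le> x.\<close>

definition riesz_mean :: "nat \<Rightarrow> real \<Rightarrow> real" where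
  "riesz_mean z x = (\<Sum>n | n \<in> rough z \<and> real n \<le> x. sieve_coeff n * (1 - real n / x))"

lemma finite_nat_le_real [simp]: "finite {n. P n \<and> real n \<le> x}" "finite {n. real n \<le> x \<and> P n}"
proof -
  have "{n. real n \<le> x} \<subseteq> {..nat \<lfloor>x\<rfloor>}" by (auto simp: le_nat_floor)
  then have "finite {n. real n \<le> x}" by (rule finite_subset) simp
  then show "finite {n. P n \<and> real n \<le> x}" "finite {n. real n \<le> x \<and> P n}"
    by (auto intro: rev_finite_subset)
qed

text \<open>Truncating the weight at 0 replaces the condition n \<le> x, so that the sum runs over
  all divisors of one fixed product, as an Euler product requires.\<close>

lemma riesz_mean_eq:
  assumes "x > 0" "x \<le> real N"
  shows "riesz_mean z x = (\<Sum>n | n dvd \<Prod>(prime_block z N). sieve_coeff n * max 0 (1 - 1 / (x / real n)))"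
proof -
  have fin: "finite {n. n dvd \<Prod>(prime_block z N)}"
    using prime_blockD[of 0 z N] by (intro finite_divisors_nat) (auto simp: gr0_conv_Suc[symmetric] intro!: prod_pos dest: prime_blockD prime_gt_0_nat)
  have "riesz_mean z x = (\<Sum>n | n \<in> rough z \<and> real n \<le> x. sieve_coeff n * max 0 (1 - 1 / (x / real n)))"
    unfolding riesz_mean_def using assms by (intro sum.cong) (auto simp: max_def field_simps)
  also have "\<dots> = (\<Sum>n | n dvd \<Prod>(prime_block z N). sieve_coeff n * max 0 (1 - 1 / (x / real n)))"
  proof (rule sum.mono_neutral_left[OF fin])
    show "{n \<in> rough z. real n \<le> x} \<subseteq> {n. n dvd \<Prod>(prime_block z N)}"
      using assms by (auto simp: dvd_prod_prime_block_le)
    show "\<forall>n\<in>{n. n dvd \<Prod>(prime_block z N)} - {n \<in> rough z. real n \<le> x}. sieve_coeff n * max 0 (1 - 1 / (x / real n)) = 0"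
    proof
      fix n assume "n \<in> {n. n dvd \<Prod>(prime_block z N)} - {n \<in> rough z. real n \<le> x}"
      then have "real n > x" by (auto simp: dvd_prod_prime_block)
      then show "sieve_coeff n * max 0 (1 - 1 / (x / real n)) = 0" using assms by (simp add: max_def field_simps)
    qed
  qed
  finally show ?thesis .
qed

text \<open>For Re s > 1 the first factor is 1 / \<zeta>^2. In this form it is regular at s =
  1.\<close>

definition perron_integrand :: "nat \<Rightarrow> nat \<Rightarrow> real \<Rightarrow> complex \<Rightarrow> complex" where
  "perron_integrand z N x s = ((s - 1) / zeta_reg s)\<^sup>2 * sieve_factor z N s * (of_real x powr s / (s * (s + 1)))"

text \<open>The integrand has no singularity in the rectangle, the zeros of \<zeta> being excluded
  and the poles of the kernel lying to the left, so the integral over the right edge equals those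
  over the other three. On the horizontal edges the kernel is of size 1 / T^2; on the left edge the
  gain is the smaller power of x.\<close>

lemma perron_integral_bound:
  assumes x: "x \<ge> 1" and c': "3/4 \<le> c'" "c' \<le> c" "1 \<le> c" "c \<le> 2" and T: "T \<ge> 1" and B: "Bz \<ge> 0" "Bs \<ge> 0"
    and zeta: "\<And>s. c' \<le> Re s \<Longrightarrow> Re s \<le> c \<Longrightarrow> \<bar>Im s\<bar> \<le> T \<Longrightarrow> zeta_reg s \<noteq> 0 \<and> norm ((s - 1) / zeta_reg s) \<le> Bz"
    and sieve: "\<And>s. c' \<le> Re s \<Longrightarrow> Re s \<le> c \<Longrightarrow> \<bar>Im s\<bar> \<le> T \<Longrightarrow> norm (sieve_factor z N s) \<le> Bs"
  shows "norm (vertical_integral c T (perron_integrand z N x))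
     \<le> Bz\<^sup>2 * Bs * (4 * T * x powr c' + 4 * x powr c / T\<^sup>2)"
proof -
  define f where "f = perron_integrand z N x"
  let ?R = "cbox (Complex c' (- T)) (Complex c T)"
  have inR: "c' \<le> Re s" "Re s \<le> c" "\<bar>Im s\<bar> \<le> T" if "s \<in> ?R" for s
    using that by (auto simp: in_cbox_complex_iff)
  have Rpos: "Re s > 0" "s \<noteq> 0" "s + 1 \<noteq> 0" if "s \<in> ?R" for s
    using inR[OF that] c' by (auto simp: complex_eq_iff)
  have hol: "f holomorphic_on ?R"
    unfolding f_def perron_integrand_def
  proof (intro holomorphic_intros)
    show "zeta_reg holomorphic_on ?R" by (rule holomorphic_on_subset[OF holomorphic_zeta_reg]) (use Rpos in auto)
    show "sieve_factor z N holomorphic_on ?R" by (rule holomorphic_on_subset[OF holomorphic_sieve_factor]) (use Rpos in auto)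
  qed (use x zeta[OF inR] Rpos in auto)
  have cont: "continuous_on ?R f" by (rule holomorphic_on_imp_continuous_on[OF hol])
  have "path_image (rectpath (Complex c' (- T)) (Complex c T)) \<subseteq> ?R"
    using c' T by (intro path_image_rectpath_subset_cbox) auto
  then have "(f has_contour_integral 0) (rectpath (Complex c' (- T)) (Complex c T))"
    by (intro Cauchy_theorem_convex_simple[OF hol]) auto
  then have "contour_integral (rectpath (Complex c' (- T)) (Complex c T)) f = 0" by (rule contour_integral_unique)
  moreover have "contour_integral (rectpath (Complex c' (- T)) (Complex c T)) f
      = horizontal_integral (- T) c' c f
      + vertical_integral c T f
      - horizontal_integral T c' c f
      - vertical_integral c' T f"
    using c' T by (intro contour_integral_rectpath continuous_on_subset[OF cont]) auto
  ultimately have eq: "vertical_integral c T f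
      = horizontal_integral T c' c f
      + vertical_integral c' T f
      - horizontal_integral (- T) c' c f"
    by (simp add: algebra_simps)
  have fle: "norm (f s) \<le> Bz\<^sup>2 * Bs * K"
    if "c' \<le> Re s" "Re s \<le> c" "\<bar>Im s\<bar> \<le> T" "norm (of_real x powr s / (s * (s + 1))) \<le> K" for s K
    unfolding f_def perron_integrand_def norm_mult norm_power
    using zeta[OF that(1-3)] sieve[OF that(1-3)] that(4) B
    by (intro mult_mono power_mono) auto
  have hor: "norm (horizontal_integral t c' c f) \<le> Bz\<^sup>2 * Bs * (x powr c / (T * T)) * (c - c')"
    if t: "\<bar>t\<bar> = T" for t
  proof (rule norm_horizontal_integral)
    show "continuous_on (closed_segment (Complex c' t) (Complex c t)) f"
    proof (rule continuous_on_subset[OF cont], rule subsetI)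
      fix w assume "w \<in> closed_segment (Complex c' t) (Complex c t)"
      then show "w \<in> ?R" using linepath_horizontal[of w c' t c] c' t by (auto simp: in_cbox_complex_iff)
    qed
    fix s assume s: "Im s = t" "c' \<le> Re s" "Re s \<le> c"
    have "norm s \<ge> T" "norm (s + 1) \<ge> T" using abs_Im_le_cmod[of s] abs_Im_le_cmod[of "s + 1"] s t by auto
    then show "norm (f s) \<le> Bz\<^sup>2 * Bs * (x powr c / (T * T))"
      using s t x T by (intro fle perron_kernel_bound powr_mono) auto
  qed (use c' B in auto)
  have hor2: "norm (horizontal_integral t c' c f) \<le> Bz\<^sup>2 * Bs * (2 * x powr c / T\<^sup>2)"
    if t: "\<bar>t\<bar> = T" for t
  proof -
    have "Bz\<^sup>2 * Bs * (x powr c / (T * T)) * (c - c') \<le> Bz\<^sup>2 * Bs * (x powr c / (T * T)) * 2"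
      using c' B by (intro mult_left_mono) auto
    then show ?thesis using hor[OF t] by (simp add: power2_eq_square mult_ac)
  qed
  have ver: "norm (vertical_integral c' T f) \<le> Bz\<^sup>2 * Bs * (x powr c' / (1/2 * 1)) * (2 * T)"
  proof (rule norm_vertical_integral)
    show "continuous_on (closed_segment (Complex c' (- T)) (Complex c' T)) f"
    proof (rule continuous_on_subset[OF cont], rule subsetI)
      fix w assume "w \<in> closed_segment (Complex c' (- T)) (Complex c' T)"
      then show "w \<in> ?R" using linepath_vertical[of w c' T] c' T by (auto simp: in_cbox_complex_iff)
    qed
    fix s assume s: "Re s = c'" "\<bar>Im s\<bar> \<le> T"
    have "norm s \<ge> 1/2" "norm (s + 1) \<ge> 1" using abs_Re_le_cmod[of s] abs_Re_le_cmod[of "s + 1"] s c' by auto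
    then show "norm (f s) \<le> Bz\<^sup>2 * Bs * (x powr c' / (1/2 * 1))"
      using s x c' by (intro fle perron_kernel_bound) auto
  qed (use T B in auto)
  have "norm (vertical_integral c T f)
      \<le> norm (horizontal_integral T c' c f)
      + norm (vertical_integral c' T f)
      + norm (horizontal_integral (- T) c' c f)"
    unfolding eq by (rule norm_add_diff_le)
  also have "\<dots> \<le> Bz\<^sup>2 * Bs * (2 * x powr c / T\<^sup>2) + Bz\<^sup>2 * Bs * (x powr c' / (1/2 * 1)) * (2 * T) + Bz\<^sup>2 * Bs * (2 * x powr c / T\<^sup>2)"
    by (intro add_mono hor2 ver) (use T in simp_all)
  also have "\<dots> = Bz\<^sup>2 * Bs * (4 * T * x powr c' + 4 * x powr c / T\<^sup>2)"
    by (simp add: algebra_simps)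
  finally show ?thesis unfolding f_def .
qed

text \<open>The finite Euler product \<open>euler_inv N\<close> is replaced by \<open>1 / \<zeta>\<close> only on the line of absolute
  convergence; the remaining factor \<open>sieve_factor z N\<close> is bounded uniformly in \<open>N\<close>.\<close>
lemma riesz_mean_perron:
  assumes x: "x \<ge> 1" and c: "1 < c" "c \<le> 2" and T: "T \<ge> 3" and N: "z \<le> N" "x \<le> real N" and Bs: "Bs \<ge> 0"
    and sieve: "\<And>s. Re s = c \<Longrightarrow> norm (sieve_factor z N s) \<le> Bs"
    and I: "norm (vertical_integral c T (perron_integrand z N x)) \<le> I"
  shows "\<bar>riesz_mean z x\<bar> \<le> 8 * x powr c / T * (zeta_re c)\<^sup>2 + 4 * T * (zeta_re c)\<^sup>2 * Bs * x powr c * zeta_tail c N + I"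
proof -
  let ?D = "{n. n dvd \<Prod>(prime_block z N)}"
  let ?L = "linepath (Complex c (- T)) (Complex c T)"
  have Pnz: "\<Prod>(prime_block z N) > 0" by (intro prod_pos) (auto dest!: prime_blockD prime_gt_0_nat)
  have D: "finite ?D" "\<And>n. n \<in> ?D \<Longrightarrow> n > 0" using Pnz dvd_pos_nat[OF Pnz] by (auto simp del: prod_pos)
  have inL: "Re s = c" "\<bar>Im s\<bar> \<le> T" "s \<noteq> 0" "s + 1 \<noteq> 0" if "s \<in> closed_segment (Complex c (- T)) (Complex c T)" for s
    using linepath_vertical[OF that] T c by (auto simp: complex_eq_iff)
  define k where "k n s = (of_real (x / real n) powr s / (s * (s + 1)) :: complex)" for n s
  define P where "P s = (\<Prod>p\<in>prime_block z N. 1 - 2 * of_nat p powr (- s)) * (of_real x powr s / (s * (s + 1)) :: complex)" for s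
  have contk: "continuous_on (closed_segment (Complex c (- T)) (Complex c T)) (k n)" if "n > 0" for n
    unfolding k_def using that x inL by (intro continuous_intros) auto
  have ki: "k n contour_integrable_on ?L" if "n > 0" for n
    by (intro contour_integrable_continuous_linepath contk that)
  have split: "(\<Sum>n\<in>?D. of_real (sieve_coeff n) * k n s) = P s" for s
  proof -
    have "(\<Sum>n\<in>?D. of_real (sieve_coeff n) * k n s)
        = (\<Sum>n\<in>?D. of_real (sieve_coeff n) * of_nat n powr (- s)) * (of_real x powr s / (s * (s + 1)))"
      unfolding sum_distrib_right
    proof (rule sum.cong[OF refl])
      fix n assume "n \<in> ?D"
      then have n: "n > 0" using D by simp
      have "of_real (x / real n) powr s = (of_real x powr s * of_nat n powr (- s) :: complex)"
        using powr_times_real[of "of_real (x / real n)" "of_nat n" s] n x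
        by (simp add: powr_minus field_simps)
      then show "of_real (sieve_coeff n) * k n s = of_real (sieve_coeff n) * of_nat n powr (- s) * (of_real x powr s / (s * (s + 1)))"
        by (simp add: k_def)
    qed
    then show ?thesis by (simp add: P_def sum_sieve_coeff_powr)
  qed
  have main: "(\<Sum>n\<in>?D. of_real (sieve_coeff n) * contour_integral ?L (k n)) = contour_integral ?L P"
  proof -
    have "(\<Sum>n\<in>?D. of_real (sieve_coeff n) * contour_integral ?L (k n)) = (\<Sum>n\<in>?D. contour_integral ?L (\<lambda>s. of_real (sieve_coeff n) * k n s))"
      using D by (intro sum.cong refl contour_integral_lmul[symmetric] ki) auto
    also have "\<dots> = contour_integral ?L (\<lambda>s. \<Sum>n\<in>?D. of_real (sieve_coeff n) * k n s)"
      using D by (intro contour_integral_sum[symmetric] contour_integrable_lmul ki) auto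
    finally show ?thesis by (simp add: split)
  qed
  define w where "w = 2 * of_real pi * \<i>"
  have err1: "norm ((\<Sum>n\<in>?D. of_real (sieve_coeff n) * contour_integral ?L (k n)) - w * of_real (riesz_mean z x))
      \<le> 8 * x powr c / T * (zeta_re c)\<^sup>2"
  proof -
    have "w * of_real (riesz_mean z x) = (\<Sum>n\<in>?D. of_real (sieve_coeff n) * (w * of_real (max 0 (1 - 1 / (x / real n)))))"
      using riesz_mean_eq[of x N z] x N by (simp add: sum_distrib_left mult_ac)
    then have "norm ((\<Sum>n\<in>?D. of_real (sieve_coeff n) * contour_integral ?L (k n)) - w * of_real (riesz_mean z x))
      = norm (\<Sum>n\<in>?D. of_real (sieve_coeff n) * (contour_integral ?L (k n) - w * of_real (max 0 (1 - 1 / (x / real n)))))"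
      by (simp add: sum_subtractf right_diff_distrib)
    also have "\<dots> \<le> (\<Sum>n\<in>?D. \<bar>sieve_coeff n\<bar> * (8 * (x / real n) powr c / T))"
    proof (rule sum_norm_le)
      fix n assume "n \<in> ?D"
      then have n: "n > 0" using D by simp
      have "norm (contour_integral ?L (k n) - w * of_real (max 0 (1 - 1 / (x / real n)))) \<le> 8 * (x / real n) powr c / T"
        unfolding k_def w_def using n x c T by (intro perron_kernel) auto
      then show "norm (of_real (sieve_coeff n) * (contour_integral ?L (k n) - w * of_real (max 0 (1 - 1 / (x / real n)))))
          \<le> \<bar>sieve_coeff n\<bar> * (8 * (x / real n) powr c / T)"
        by (simp only: norm_mult norm_of_real) (rule mult_left_mono, simp_all)
    qed
    also have "\<dots> = 8 * x powr c / T * (\<Sum>n\<in>?D. \<bar>sieve_coeff n\<bar> * real n powr (- c))"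
      unfolding sum_distrib_left
      using x by (intro sum.cong refl) (simp add: powr_divide powr_minus field_simps)
    also have "\<dots> \<le> 8 * x powr c / T * (zeta_re c)\<^sup>2"
      using x c T by (intro mult_left_mono sum_abs_sieve_coeff_powr) auto
    finally show ?thesis .
  qed
  have zr: "zeta_re c \<ge> 1" using zeta_re_pos c by simp
  have tail: "zeta_tail c N \<ge> 0" unfolding zeta_tail_def by (intro infsum_nonneg) auto
  have Pcont: "continuous_on (closed_segment (Complex c (- T)) (Complex c T)) P"
    unfolding P_def using x inL by (intro continuous_intros) (auto dest!: prime_blockD)
  have Gcont: "continuous_on (closed_segment (Complex c (- T)) (Complex c T)) (perron_integrand z N x)"
    unfolding perron_integrand_def
  proof (intro continuous_intros)
    show "continuous_on (closed_segment (Complex c (- T)) (Complex c T)) zeta_reg"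
      by (rule continuous_on_subset[OF holomorphic_on_imp_continuous_on[OF holomorphic_zeta_reg]]) (use inL c in auto)
    show "continuous_on (closed_segment (Complex c (- T)) (Complex c T)) (sieve_factor z N)"
      by (rule continuous_on_subset[OF holomorphic_on_imp_continuous_on[OF holomorphic_sieve_factor]]) (use inL c in auto)
  qed (use x inL zeta_reg_nonzero c in auto)
  \<comment> \<open>Exchanging the partial product for 1 / \<zeta> costs E^2 - v^2 = (E - v) * (E +
    v), where E - v carries the tail of the zeta series and therefore vanishes as N grows.\<close>
  have err2: "norm (contour_integral ?L (\<lambda>s. P s - perron_integrand z N x s))
      \<le> 2 * (zeta_re c)\<^sup>2 * zeta_tail c N * Bs * x powr c * (2 * T)"
  proof (rule norm_vertical_integral)
    show "continuous_on (closed_segment (Complex c (- T)) (Complex c T)) (\<lambda>s. P s - perron_integrand z N x s)"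
      by (intro continuous_intros Pcont Gcont)
    fix s assume s: "Re s = c" "\<bar>Im s\<bar> \<le> T"
    have s1: "Re s > 1" "s \<noteq> 1" using s c by auto
    define E where "E = euler_inv N s"
    define v where "v = (s - 1) / zeta_reg s"
    have v: "v = 1 / zeta_dir s" using s1 by (simp add: v_def zeta_reg_eq)
    have vle: "norm v \<le> zeta_re c"
      using norm_zeta_dir_ge[OF s1(1)] zeta_dir_nonzero[OF s1(1)] s by (simp add: v norm_divide divide_le_eq mult.commute)
    have Ele: "norm E \<le> zeta_re c" using norm_euler_inv_le[OF s1(1), of N] s by (simp add: E_def)
    have "E - v = (E * zeta_dir s - 1) * v" using zeta_dir_nonzero[OF s1(1)] by (simp add: v field_simps)
    then have "norm (E - v) \<le> zeta_tail c N * zeta_re c"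
      using euler_inv_zeta[OF s1(1), of N] vle s tail by (simp add: norm_mult E_def) (intro mult_mono; simp)
    moreover have "norm (E + v) \<le> 2 * zeta_re c" using norm_triangle_ineq[of E v] Ele vle by simp
    moreover have "E\<^sup>2 - v\<^sup>2 = (E - v) * (E + v)" by (simp add: power2_eq_square algebra_simps)
    ultimately have "norm (E\<^sup>2 - v\<^sup>2) \<le> (zeta_tail c N * zeta_re c) * (2 * zeta_re c)"
      using zr tail by (simp only: norm_mult) (intro mult_mono; simp)
    then have 1: "norm (E\<^sup>2 - v\<^sup>2) \<le> 2 * (zeta_re c)\<^sup>2 * zeta_tail c N" by (simp add: power2_eq_square mult_ac)
    have "norm s \<ge> 1" "norm (s + 1) \<ge> 1" using abs_Re_le_cmod[of s] abs_Re_le_cmod[of "s + 1"] s c by auto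
    then have 2: "norm (of_real x powr s / (s * (s + 1))) \<le> x powr c"
      using perron_kernel_bound[of 1 s 1 x "x powr c"] s x by simp
    have "P s - perron_integrand z N x s = (E\<^sup>2 - v\<^sup>2) * sieve_factor z N s * (of_real x powr s / (s * (s + 1)))"
      unfolding P_def perron_integrand_def E_def v_def using sieve_prod_eq[of s z N] N s1
      by (simp only:) (simp add: algebra_simps)
    then show "norm (P s - perron_integrand z N x s) \<le> 2 * (zeta_re c)\<^sup>2 * zeta_tail c N * Bs * x powr c"
      using 1 2 sieve[OF s(1)] tail Bs zr
      by (simp only: norm_mult) (intro mult_mono mult_nonneg_nonneg; simp)
  qed (use T tail Bs in auto)
  have "contour_integral ?L (\<lambda>s. P s - perron_integrand z N x s) = contour_integral ?L P - contour_integral ?L (perron_integrand z N x)"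
    by (intro contour_integral_diff contour_integrable_continuous_linepath Pcont Gcont)
  then have dec: "w * of_real (riesz_mean z x) =
      contour_integral ?L (\<lambda>s. P s - perron_integrand z N x s) + contour_integral ?L (perron_integrand z N x)
      - ((\<Sum>n\<in>?D. of_real (sieve_coeff n) * contour_integral ?L (k n)) - w * of_real (riesz_mean z x))"
    by (simp add: main)
  have "norm (w * of_real (riesz_mean z x)) \<le>
      norm (contour_integral ?L (\<lambda>s. P s - perron_integrand z N x s)) + norm (contour_integral ?L (perron_integrand z N x))
      + norm ((\<Sum>n\<in>?D. of_real (sieve_coeff n) * contour_integral ?L (k n)) - w * of_real (riesz_mean z x))"
    by (subst dec) (rule norm_add_diff_le)
  moreover have "1 * \<bar>riesz_mean z x\<bar> \<le> norm w * \<bar>riesz_mean z x\<bar>"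
    using pi_ge_two by (intro mult_right_mono) (auto simp: w_def norm_mult)
  ultimately show ?thesis using err1 err2 I by (simp add: norm_mult algebra_simps)
qed

text \<open>With l = \<kappa> * sqrt (ln x), the height T = exp l balances the truncation error x /
  T against the gain from moving the contour to Re s = 1 - c0 / l. The condition on z keeps the
  sieve factor of size z^24 on that line.\<close>

theorem riesz_mean_bound:
  obtains \<kappa> C X where "\<kappa> > 0" "C > 0" "X \<ge> 1"
    "\<And>x z. x \<ge> X \<Longrightarrow> z \<ge> 1 \<Longrightarrow> ln (real z) \<le> \<kappa> * sqrt (ln x) \<Longrightarrow>
       \<bar>riesz_mean z x\<bar> \<le> C * real z ^ 24 * x * (ln x)\<^sup>2 * exp (- (\<kappa> * sqrt (ln x)))"
proof -
  obtain c0 Cz l0 where Z: "0 < c0" "c0 \<le> 1/4" "Cz > 0" "l0 \<ge> 2"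
    "\<And>l s. l \<ge> l0 \<Longrightarrow> \<bar>Im s\<bar> \<le> exp l \<Longrightarrow> 1 - c0 / l \<le> Re s \<Longrightarrow> Re s \<le> 2 \<Longrightarrow>
      zeta_reg s \<noteq> 0 \<and> norm ((s - 1) / zeta_reg s) \<le> Cz * l * exp (l / 4)"
    using zeta_reg_inverse_bound by blast
  obtain Cs where S: "Cs > 0" "\<And>z N s. Re s \<ge> 3/4 \<Longrightarrow> z \<ge> 1 \<Longrightarrow> (1 - Re s) * ln (real z) \<le> 1 \<Longrightarrow>
    norm (sieve_factor z N s) \<le> Cs * real z ^ 24"
    using norm_sieve_factor by blast
  obtain C2 where C2: "C2 \<ge> 1" "\<And>\<sigma>. 1 < \<sigma> \<Longrightarrow> \<sigma> \<le> 2 \<Longrightarrow> zeta_re \<sigma> \<le> C2 / (\<sigma> - 1)"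
    using zeta_re_le by blast
  \<comment> \<open>This makes c0 * ln x / l equal to 3 * l, so x powr c' is x / T^3. After
    multiplication by the length T of the edge and the loss T^(1/2) from 1 / \<zeta>^2, a saving
    T^(3/2) remains.\<close>
  define \<kappa> where "\<kappa> = sqrt (c0 / 3)"
  have \<kappa>: "\<kappa> > 0" "\<kappa> \<le> 1" "\<kappa>\<^sup>2 = c0 / 3" using Z by (auto simp: \<kappa>_def real_sqrt_le_iff)
  show ?thesis
  proof (rule that)
    show "\<kappa> > 0" by (rule \<kappa>)
    show "24 * C2\<^sup>2 + 1 + 16 * (Cz\<^sup>2 * Cs) > 0" using S by (intro add_nonneg_pos add_pos_nonneg) auto
    show "exp (max 1 ((l0 / \<kappa>)\<^sup>2)) \<ge> 1" by simp
    fix x :: real and z :: nat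
    assume xX: "x \<ge> exp (max 1 ((l0 / \<kappa>)\<^sup>2))" and z: "z \<ge> 1" "ln (real z) \<le> \<kappa> * sqrt (ln x)"
    have xpos: "x > 0" using xX less_le_trans[OF exp_gt_zero] by blast
    then have lx: "ln x \<ge> max 1 ((l0 / \<kappa>)\<^sup>2)" using xX by (subst ln_ge_iff) auto
    then have lx1: "ln x \<ge> 1" by simp
    have x1: "x \<ge> 1" using xX by (rule order_trans[rotated]) simp
    define l where "l = \<kappa> * sqrt (ln x)"
    have "l0 / \<kappa> \<le> sqrt (ln x)" using lx by (intro real_le_rsqrt) simp
    then have ll0: "l \<ge> l0" using \<kappa> by (simp add: l_def field_simps)
    then have l2: "l \<ge> 2" using Z by simp
    have lsq: "l\<^sup>2 = \<kappa>\<^sup>2 * ln x" using lx1 by (simp add: l_def power_mult_distrib)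
    have "l\<^sup>2 \<le> 1 * ln x" unfolding lsq using \<kappa> lx1 by (intro mult_right_mono power_le_one) auto
    moreover have "ln x * 1 \<le> ln x * ln x" using lx1 by (intro mult_left_mono) auto
    ultimately have lsq_le: "l\<^sup>2 \<le> (ln x)\<^sup>2" by (simp add: power2_eq_square)
    then have l_le: "l \<le> ln x" by (rule power2_le_imp_le) (use lx1 in simp)
    define T where "T = exp l"
    have T: "T \<ge> 3" using exp_ge_add_one_self[of l] l2 unfolding T_def by linarith
    \<comment> \<open>On this line x powr c is within the factor e of x, and the zeta function is of
      order ln x.\<close>
    define c where "c = 1 + 1 / ln x"
    have c: "1 < c" "c \<le> 2" using lx1 by (auto simp: c_def)
    define c' where "c' = 1 - c0 / l"
    have c0l: "0 < c0 / l" "c0 / l \<le> 1/8" using Z l2 by (auto simp: field_simps)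
    have c': "3/4 \<le> c'" "c' \<le> c" using c0l c unfolding c'_def by linarith+
    define Bz where "Bz = Cz * l * exp (l / 4)"
    define Bs where "Bs = Cs * real z ^ 24"
    have B: "Bz \<ge> 0" "Bs \<ge> 0" using Z S l2 by (auto simp: Bz_def Bs_def)
    have sieve: "norm (sieve_factor z N s) \<le> Bs" if "c' \<le> Re s" for N s
    proof -
      have lz: "ln (real z) \<ge> 0" using z by simp
      have "(1 - Re s) * ln (real z) \<le> c0 / l * ln (real z)"
        using that lz by (intro mult_right_mono) (auto simp: c'_def)
      also have "\<dots> \<le> c0 / l * l" using z c0l by (intro mult_left_mono) (auto simp: l_def)
      also have "\<dots> \<le> 1" using l2 Z by simp
      finally show ?thesis unfolding Bs_def using that c' z by (intro S) auto
    qed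
    define I where "I = Bz\<^sup>2 * Bs * (4 * T * x powr c' + 4 * x powr c / T\<^sup>2)"
    have Ib: "norm (vertical_integral c T (perron_integrand z N x)) \<le> I" for N
      unfolding I_def
    proof (rule perron_integral_bound[OF x1 c' _ c(2) _ B])
      show "zeta_reg s \<noteq> 0 \<and> norm ((s - 1) / zeta_reg s) \<le> Bz"
        if "c' \<le> Re s" "Re s \<le> c" "\<bar>Im s\<bar> \<le> T" for s
        unfolding Bz_def using that c ll0 by (intro Z(5)) (auto simp: c'_def T_def)
    qed (use c T sieve in auto)
    \<comment> \<open>N is chosen last, after x, z and T: the coefficient D of the tail does not
      depend on it, so the tail contribution can be pushed below 1.\<close>
    define D where "D = 4 * T * (zeta_re c)\<^sup>2 * Bs * x powr c"
    have "(\<lambda>N. D * zeta_tail c N) \<longlonglongrightarrow> D * 0" by (intro tendsto_intros zeta_tail_tendsto c)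
    then have "\<forall>\<^sub>F N in sequentially. D * zeta_tail c N < 1" by (intro order_tendstoD) auto
    moreover have "\<forall>\<^sub>F N in sequentially. N \<ge> z" by (rule eventually_ge_at_top)
    moreover have "\<forall>\<^sub>F N in sequentially. N \<ge> nat \<lceil>x\<rceil>" by (rule eventually_ge_at_top)
    ultimately have "\<forall>\<^sub>F N in sequentially. D * zeta_tail c N < 1 \<and> z \<le> N \<and> x \<le> real N"
      by eventually_elim linarith
    then obtain N where N: "D * zeta_tail c N < 1" "z \<le> N" "x \<le> real N"
      using eventually_happens trivial_limit_sequentially by blast
    have "\<bar>riesz_mean z x\<bar> \<le> 8 * x powr c / T * (zeta_re c)\<^sup>2 + D * zeta_tail c N + I"
      unfolding D_def by (rule riesz_mean_perron[OF x1 c T N(2,3) B(2) _ Ib]) (use sieve c' in auto)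
    then have Q: "\<bar>riesz_mean z x\<bar> \<le> 8 * x powr c / T * (zeta_re c)\<^sup>2 + 1 + I" using N(1) by linarith
    define Y where "Y = x * exp (- l)"
    have Y: "Y \<ge> 1"
    proof -
      have "1 \<le> exp (ln x - l)" using l_le by simp
      also have "\<dots> = Y" using xpos by (simp add: Y_def exp_diff exp_minus field_simps)
      finally show ?thesis .
    qed
    have zz: "real z ^ 24 \<ge> 1" using z by simp
    have lx2: "(ln x)\<^sup>2 \<ge> 1" using lx1 by simp
    have xc: "x powr c \<le> 3 * x"
    proof -
      have "x \<noteq> 1" using lx1 by auto
      then have "x powr c = x * exp 1" using xpos lx1 by (simp add: c_def powr_add) (simp add: powr_def)
      also have "\<dots> \<le> x * 3" using xpos exp_le by (intro mult_left_mono) auto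
      finally show ?thesis by simp
    qed
    have xc': "x powr c' = x * exp (- (3 * l))"
    proof -
      have "c0 / l * ln x = 3 * l"
      proof -
        have "c0 * ln x = 3 * l\<^sup>2" using lsq \<kappa> by simp
        then show ?thesis using l2 by (simp add: field_simps power2_eq_square)
      qed
      then have "c' * ln x = ln x - 3 * l" by (simp add: c'_def left_diff_distrib)
      then have "x powr c' = exp (ln x + - (3 * l))" using xpos by (simp add: powr_def)
      then show ?thesis using xpos by (simp only: exp_add exp_ln)
    qed
    have t1: "8 * x powr c / T * (zeta_re c)\<^sup>2 \<le> 24 * C2\<^sup>2 * (Y * (ln x)\<^sup>2)"
    proof -
      have "zeta_re c \<le> C2 * ln x" using C2(2)[OF c] by (simp add: c_def)
      then have "(zeta_re c)\<^sup>2 \<le> (C2 * ln x)\<^sup>2" using zeta_re_pos[OF c(1)] by (intro power_mono) auto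
      then have "8 * x powr c / T * (zeta_re c)\<^sup>2 \<le> 8 * (3 * x) / T * (C2 * ln x)\<^sup>2"
        using xc T xpos by (intro mult_mono divide_right_mono) auto
      also have "\<dots> = 24 * C2\<^sup>2 * (Y * (ln x)\<^sup>2)" by (simp add: Y_def T_def exp_minus power_mult_distrib field_simps)
      finally show ?thesis .
    qed
    have t2: "I \<le> 16 * (Cz\<^sup>2 * Cs) * real z ^ 24 * (Y * (ln x)\<^sup>2)"
    proof -
      have e1: "4 * T * x powr c' = 4 * x * exp (- (2 * l))" unfolding xc' T_def by (simp flip: exp_add)
      have e2: "4 * x powr c / T\<^sup>2 \<le> 12 * x * exp (- (2 * l))"
      proof -
        have "4 * x powr c / T\<^sup>2 \<le> 4 * (3 * x) / T\<^sup>2" using xc by (intro divide_right_mono) auto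
        also have "\<dots> = 12 * x * exp (- (2 * l))"
          by (simp add: T_def exp_minus exp_double[symmetric] field_simps)
        finally show ?thesis .
      qed
      have "I \<le> Bz\<^sup>2 * Bs * (16 * x * exp (- (2 * l)))"
        unfolding I_def using B e1 e2 by (intro mult_left_mono) auto
      also have "\<dots> = 16 * (Cz\<^sup>2 * Cs) * real z ^ 24 * (l\<^sup>2 * (x * (exp (l / 2) * exp (- (2 * l)))))"
      proof -
        have "(exp (l / 4))\<^sup>2 = exp (l / 2)" using exp_double[of "l / 4"] by simp
        then show ?thesis by (simp add: Bz_def Bs_def power_mult_distrib)
      qed
      also have "\<dots> \<le> 16 * (Cz\<^sup>2 * Cs) * real z ^ 24 * ((ln x)\<^sup>2 * (x * exp (- l)))"
        using l2 S lsq_le xpos by (intro mult_left_mono mult_mono) (auto simp flip: exp_add)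
      finally show ?thesis by (simp add: Y_def mult_ac)
    qed
    have YL: "Y * (ln x)\<^sup>2 \<ge> 1" using mult_mono[of 1 Y 1 "(ln x)\<^sup>2"] Y lx2 by simp
    have m: "a \<le> a * real z ^ 24" if "a \<ge> 0" for a using mult_left_mono[OF zz that] by simp
    have "\<bar>riesz_mean z x\<bar> \<le> 24 * C2\<^sup>2 * (Y * (ln x)\<^sup>2) + Y * (ln x)\<^sup>2 + 16 * (Cz\<^sup>2 * Cs) * real z ^ 24 * (Y * (ln x)\<^sup>2)"
      using Q t1 t2 YL by linarith
    also have "\<dots> \<le> 24 * C2\<^sup>2 * (Y * (ln x)\<^sup>2) * real z ^ 24 + Y * (ln x)\<^sup>2 * real z ^ 24 + 16 * (Cz\<^sup>2 * Cs) * real z ^ 24 * (Y * (ln x)\<^sup>2)"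
      using YL by (intro add_mono m order_refl) auto
    also have "\<dots> = (24 * C2\<^sup>2 + 1 + 16 * (Cz\<^sup>2 * Cs)) * real z ^ 24 * x * (ln x)\<^sup>2 * exp (- (\<kappa> * sqrt (ln x)))"
      by (simp add: Y_def l_def algebra_simps)
    finally show "\<bar>riesz_mean z x\<bar> \<le> (24 * C2\<^sup>2 + 1 + 16 * (Cz\<^sup>2 * Cs)) * real z ^ 24 * x * (ln x)\<^sup>2 * exp (- (\<kappa> * sqrt (ln x)))" .
  qed
qed

section \<open>Divisor sums over short intervals\<close>

lemma card_nat_interval_le:
  assumes "0 \<le> u" "u \<le> v"
  shows "finite {m::nat. u < real m \<and> real m \<le> v}" "real (card {m::nat. u < real m \<and> real m \<le> v}) \<le> v - u + 1"
proof -
  have sub: "{m::nat. u < real m \<and> real m \<le> v} \<subseteq> {nat \<lfloor>u\<rfloor><..nat \<lfloor>v\<rfloor>}"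
    using assms by (auto simp: le_nat_floor nat_less_iff floor_less_iff)
  then show "finite {m::nat. u < real m \<and> real m \<le> v}" by (rule finite_subset) simp
  have "card {m::nat. u < real m \<and> real m \<le> v} \<le> nat \<lfloor>v\<rfloor> - nat \<lfloor>u\<rfloor>"
    using card_mono[OF _ sub] by simp
  also have "real (nat \<lfloor>v\<rfloor> - nat \<lfloor>u\<rfloor>) \<le> v - u + 1"
  proof -
    have "nat \<lfloor>u\<rfloor> \<le> nat \<lfloor>v\<rfloor>" using assms by (intro nat_mono floor_mono)
    then have "real (nat \<lfloor>v\<rfloor> - nat \<lfloor>u\<rfloor>) = of_int \<lfloor>v\<rfloor> - of_int \<lfloor>u\<rfloor>" using assms by (simp add: of_nat_diff)
    then show ?thesis by linarith
  qed
  finally show "real (card {m::nat. u < real m \<and> real m \<le> v}) \<le> v - u + 1" by simp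
qed

text \<open>Every divisor or its cofactor is at most the square root of n.\<close>

lemma card_divisors_le:
  assumes "(n::nat) > 0"
  shows "card {d. d dvd n} \<le> 2 * card {d. d dvd n \<and> d * d \<le> n}"
proof -
  let ?A = "{d. d dvd n \<and> d * d \<le> n}"
  have fin: "finite ?A" by (rule finite_subset[OF _ finite_divisors_nat[OF assms]]) auto
  have "{d. d dvd n} \<subseteq> ?A \<union> (\<lambda>d. n div d) ` ?A"
  proof
    fix d assume "d \<in> {d. d dvd n}"
    then obtain e where e: "n = d * e" by auto
    show "d \<in> ?A \<union> (\<lambda>d. n div d) ` ?A"
    proof (cases "d * d \<le> n")
      case False
      then have "e < d" using e by (metis linorder_not_le mult_le_mono2)
      then have "e * e \<le> n" using e by simp
      moreover have "e > 0" using e assms by (cases e) auto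
      ultimately have "e \<in> ?A" "d = n div e" using e by auto
      then show ?thesis by blast
    qed (use e in auto)
  qed
  then have "card {d. d dvd n} \<le> card (?A \<union> (\<lambda>d. n div d) ` ?A)" using fin by (intro card_mono) auto
  also have "\<dots> \<le> card ?A + card ((\<lambda>d. n div d) ` ?A)" by (rule card_Un_le)
  also have "\<dots> \<le> card ?A + card ?A" using fin by (intro add_left_mono card_image_le)
  finally show ?thesis by simp
qed

text \<open>Counting only divisors up to sqrt b keeps the rounding errors at sqrt b instead of b;
  otherwise the bound would be worthless for intervals short compared with b.\<close>

lemma sum_divisors_interval:
  assumes "0 \<le> a" "a \<le> b" "b \<ge> 1"
  shows "(\<Sum>n | a < real n \<and> real n \<le> b. real (card {d. d dvd n})) \<le> 2 * (b - a) * (1 + ln b) + 2 * sqrt b"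
proof -
  define D where "D = nat \<lfloor>sqrt b\<rfloor>"
  let ?N = "{n::nat. a < real n \<and> real n \<le> b}"
  have fin: "finite ?N" by (rule card_nat_interval_le(1)[OF assms(1,2)])
  have sb: "sqrt b \<ge> 1" "sqrt b \<le> b" using assms by (auto simp: real_le_lsqrt power2_eq_square)
  have D: "D \<ge> 1" "real D \<le> sqrt b" using sb by (auto simp: D_def le_nat_floor)
  have "real (card {d. d dvd n}) \<le> 2 * (\<Sum>d=1..D. if d dvd n then 1 else 0)" if n: "n \<in> ?N" for n
  proof -
    have n0: "n > 0" using n assms by (cases n) auto
    have "{d. d dvd n \<and> d * d \<le> n} \<subseteq> {d\<in>{1..D}. d dvd n}"
    proof safe
      fix d assume d: "d dvd n" "d * d \<le> n"
      show "d \<in> {1..D}"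
      proof -
        have "real d * real d \<le> b" using d n by (metis (mono_tags, lifting) mem_Collect_eq of_nat_le_iff of_nat_mult order_trans)
        then have "real d \<le> sqrt b" by (intro real_le_rsqrt) (simp add: power2_eq_square)
        then have "d \<le> D" by (simp add: D_def le_nat_floor)
        moreover have "d \<ge> 1" using d n0 by (cases d) auto
        ultimately show ?thesis by simp
      qed
    qed
    then have "card {d. d dvd n \<and> d * d \<le> n} \<le> card {d\<in>{1..D}. d dvd n}" by (intro card_mono) auto
    also have "real (card {d\<in>{1..D}. d dvd n}) = (\<Sum>d=1..D. if d dvd n then 1 else 0)"
      by (simp add: sum.If_cases Int_def)
    finally show ?thesis using card_divisors_le[OF n0] by linarith
  qed
  then have "(\<Sum>n\<in>?N. real (card {d. d dvd n})) \<le> (\<Sum>n\<in>?N. 2 * (\<Sum>d=1..D. if d dvd n then 1 else 0))"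
    by (rule sum_mono)
  also have "\<dots> = 2 * (\<Sum>d=1..D. \<Sum>n\<in>?N. if d dvd n then 1 else 0)"
    by (simp only: sum_distrib_left[symmetric] sum.swap[of _ "{1..D}"])
  also have "\<dots> \<le> 2 * (\<Sum>d=1..D. (b - a) * inverse (real d) + 1)"
  proof (intro mult_left_mono sum_mono)
    fix d assume d: "d \<in> {1..D}"
    have "{n\<in>?N. d dvd n} \<subseteq> (*) d ` {m::nat. a / real d < real m \<and> real m \<le> b / real d}"
      using d by (auto simp: field_simps image_iff elim!: dvdE)
    then have "card {n\<in>?N. d dvd n} \<le> card {m::nat. a / real d < real m \<and> real m \<le> b / real d}"
      using assms d card_nat_interval_le(1)[of "a / real d" "b / real d"]
      by (intro surj_card_le) (auto simp: divide_right_mono)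
    also have "real \<dots> \<le> b / real d - a / real d + 1"
      using assms d by (intro card_nat_interval_le) (auto simp: divide_right_mono)
    finally have "real (card {n\<in>?N. d dvd n}) \<le> (b - a) * inverse (real d) + 1"
      by (simp add: inverse_eq_divide diff_divide_distrib)
    moreover have "(\<Sum>n\<in>?N. if d dvd n then 1 else 0) = real (card {n\<in>?N. d dvd n})"
      using fin by (simp add: sum.If_cases Int_def)
    ultimately show "(\<Sum>n\<in>?N. if d dvd n then 1 else 0) \<le> (b - a) * inverse (real d) + 1" by simp
  qed simp
  also have "\<dots> = 2 * ((b - a) * harm D + real D)" by (simp add: sum.distrib harm_def sum_distrib_left)
  also have "\<dots> \<le> 2 * ((b - a) * (1 + ln b) + sqrt b)"
  proof (intro mult_left_mono add_mono)
    have "harm D \<le> 1 + ln (real D)" by (rule harm_le_ln[OF D(1)])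
    also have "ln (real D) \<le> ln b" using D sb by (intro ln_mono) auto
    finally show "harm D \<le> 1 + ln b" by simp
  qed (use assms D in auto)
  finally show ?thesis by (simp add: algebra_simps)
qed

section \<open>Sums over rough numbers\<close>

definition sieve_sum :: "nat \<Rightarrow> real \<Rightarrow> real" where
  "sieve_sum z x = (\<Sum>n | n \<in> rough z \<and> real n \<le> x. sieve_coeff n)"

lemma rough_pos: "n \<in> rough z \<Longrightarrow> n > 0"
  by (simp add: rough_def)

lemma sum_abs_sieve_coeff_interval:
  assumes "0 \<le> a" "a \<le> b" "b \<ge> 1"
  shows "(\<Sum>n | n \<in> rough z \<and> a < real n \<and> real n \<le> b. \<bar>sieve_coeff n\<bar>) \<le> 2 * (b - a) * (1 + ln b) + 2 * sqrt b"
proof -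
  have fin: "finite {n. a < real n \<and> real n \<le> b}" by (rule card_nat_interval_le(1)[OF assms(1,2)])
  have "(\<Sum>n | n \<in> rough z \<and> a < real n \<and> real n \<le> b. \<bar>sieve_coeff n\<bar>)
      \<le> (\<Sum>n | n \<in> rough z \<and> a < real n \<and> real n \<le> b. real (card {d. d dvd n}))"
    by (intro sum_mono abs_sieve_coeff_le) (auto dest: rough_pos)
  also have "\<dots> \<le> (\<Sum>n | a < real n \<and> real n \<le> b. real (card {d. d dvd n}))"
    by (rule sum_mono2[OF fin]) auto
  also have "\<dots> \<le> 2 * (b - a) * (1 + ln b) + 2 * sqrt b" by (rule sum_divisors_interval[OF assms])
  finally show ?thesis .
qed

lemma riesz_mean_mult: "x > 0 \<Longrightarrow> x * riesz_mean z x = (\<Sum>n | n \<in> rough z \<and> real n \<le> x. sieve_coeff n * (x - real n))"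
  unfolding riesz_mean_def sum_distrib_left by (intro sum.cong) (auto simp: field_simps)

text \<open>x times the Riesz mean is the integral of the summatory function from 0 to x. Its
  increment from x to x + h is h times the summatory function at x, up to the coefficients in (x, x
  + h].\<close>

lemma sieve_sum_le_riesz_mean:
  assumes "x > 0" "h > 0"
  shows "\<bar>sieve_sum z x\<bar> \<le> ((x + h) * \<bar>riesz_mean z (x + h)\<bar> + x * \<bar>riesz_mean z x\<bar>) / h
     + (\<Sum>n | n \<in> rough z \<and> x < real n \<and> real n \<le> x + h. \<bar>sieve_coeff n\<bar>)"
proof -
  let ?A = "{n. n \<in> rough z \<and> real n \<le> x}" and ?B = "{n. n \<in> rough z \<and> x < real n \<and> real n \<le> x + h}"
  have fin: "finite ?A" "finite ?B"
    by (simp, rule finite_subset[OF _ finite_nat_le_real(1)[of "\<lambda>n. n \<in> rough z" "x + h"]]) auto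
  have un: "{n. n \<in> rough z \<and> real n \<le> x + h} = ?A \<union> ?B" using assms by auto
  have "(x + h) * riesz_mean z (x + h) = (\<Sum>n\<in>?A. sieve_coeff n * (x + h - real n)) + (\<Sum>n\<in>?B. sieve_coeff n * (x + h - real n))"
    using assms fin by (simp add: riesz_mean_mult un) (intro sum.union_disjoint; auto)
  moreover have "(\<Sum>n\<in>?A. sieve_coeff n * (x + h - real n)) = x * riesz_mean z x + h * sieve_sum z x"
    using assms by (simp add: riesz_mean_mult sieve_sum_def sum_distrib_left algebra_simps flip: sum.distrib)
  moreover have "\<bar>\<Sum>n\<in>?B. sieve_coeff n * (x + h - real n)\<bar> \<le> h * (\<Sum>n\<in>?B. \<bar>sieve_coeff n\<bar>)"
  proof -
    have "\<bar>\<Sum>n\<in>?B. sieve_coeff n * (x + h - real n)\<bar> \<le> (\<Sum>n\<in>?B. \<bar>sieve_coeff n * (x + h - real n)\<bar>)" by (rule sum_abs)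
    also have "\<dots> \<le> (\<Sum>n\<in>?B. h * \<bar>sieve_coeff n\<bar>)"
    proof (rule sum_mono)
      fix n assume "n \<in> ?B"
      then have "\<bar>x + h - real n\<bar> \<le> h" by simp
      then have "\<bar>x + h - real n\<bar> * \<bar>sieve_coeff n\<bar> \<le> h * \<bar>sieve_coeff n\<bar>" by (rule mult_right_mono) simp
      then show "\<bar>sieve_coeff n * (x + h - real n)\<bar> \<le> h * \<bar>sieve_coeff n\<bar>" by (simp add: abs_mult mult.commute)
    qed
    finally show ?thesis by (simp add: sum_distrib_left)
  qed
  moreover have "\<bar>h * sieve_sum z x\<bar> = h * \<bar>sieve_sum z x\<bar>" "\<bar>x * riesz_mean z x\<bar> = x * \<bar>riesz_mean z x\<bar>"
    "\<bar>(x + h) * riesz_mean z (x + h)\<bar> = (x + h) * \<bar>riesz_mean z (x + h)\<bar>"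
    using assms by (simp_all add: abs_mult)
  ultimately have "h * \<bar>sieve_sum z x\<bar> \<le> (x + h) * \<bar>riesz_mean z (x + h)\<bar> + x * \<bar>riesz_mean z x\<bar> + h * (\<Sum>n\<in>?B. \<bar>sieve_coeff n\<bar>)"
    by linarith
  then have "\<bar>sieve_sum z x\<bar> \<le> ((x + h) * \<bar>riesz_mean z (x + h)\<bar> + x * \<bar>riesz_mean z x\<bar> + h * (\<Sum>n\<in>?B. \<bar>sieve_coeff n\<bar>)) / h"
    using assms by (simp add: pos_le_divide_eq mult.commute)
  then show ?thesis using assms by (simp add: add_divide_distrib)
qed

text \<open>Powers of ln x, including those coming from z^24, are absorbed by halving \<kappa>;
  since ln z is at most 3 * ln (ln x), the condition on z holds for large x.\<close>

lemma riesz_mean_bound':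
  obtains k X where "k > 0" "X \<ge> 1"
    "\<And>x z. x \<ge> X \<Longrightarrow> z \<ge> 1 \<Longrightarrow> real z \<le> ln x ^ 3 \<Longrightarrow> \<bar>riesz_mean z x\<bar> \<le> x * exp (- (k * sqrt (ln x)))"
proof -
  obtain \<kappa> C X where K: "\<kappa> > 0" "C > 0" "X \<ge> 1"
    "\<And>x z. x \<ge> X \<Longrightarrow> z \<ge> 1 \<Longrightarrow> ln (real z) \<le> \<kappa> * sqrt (ln x) \<Longrightarrow>
       \<bar>riesz_mean z x\<bar> \<le> C * real z ^ 24 * x * (ln x)\<^sup>2 * exp (- (\<kappa> * sqrt (ln x)))"
    using riesz_mean_bound by blast
  have 1: "\<forall>\<^sub>F x::real in at_top. ln (ln x ^ 3) \<le> \<kappa> * sqrt (ln x)"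
    using K(1) by real_asymp
  have 2: "\<forall>\<^sub>F x::real in at_top. C * (ln x ^ 3) ^ 24 * (ln x)\<^sup>2 * exp (- (\<kappa> * sqrt (ln x))) \<le> exp (- (\<kappa> / 2 * sqrt (ln x)))"
    using K(1,2) by real_asymp
  from eventually_conj[OF 1 2] obtain X' where X': "\<And>x. x \<ge> X' \<Longrightarrow> ln (ln x ^ 3) \<le> \<kappa> * sqrt (ln x) \<and>
      C * (ln x ^ 3) ^ 24 * (ln x)\<^sup>2 * exp (- (\<kappa> * sqrt (ln x))) \<le> exp (- (\<kappa> / 2 * sqrt (ln x)))"
    unfolding eventually_at_top_linorder by blast
  show ?thesis
  proof (rule that)
    show "\<kappa> / 2 > 0" "max X X' \<ge> 1" using K by auto
    fix x :: real and z :: nat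
    assume x: "x \<ge> max X X'" and z: "z \<ge> 1" "real z \<le> ln x ^ 3"
    have x0: "x > 0" using x K(3) by simp
    have "ln (real z) \<le> ln (ln x ^ 3)" using z by (intro ln_mono) auto
    also have "\<dots> \<le> \<kappa> * sqrt (ln x)" using X' x by simp
    finally have "\<bar>riesz_mean z x\<bar> \<le> C * real z ^ 24 * x * (ln x)\<^sup>2 * exp (- (\<kappa> * sqrt (ln x)))"
      using x z by (intro K(4)) auto
    also have "\<dots> \<le> C * (ln x ^ 3) ^ 24 * x * (ln x)\<^sup>2 * exp (- (\<kappa> * sqrt (ln x)))"
      using K z x0 by (intro mult_right_mono mult_left_mono power_mono) auto
    also have "\<dots> = x * (C * (ln x ^ 3) ^ 24 * (ln x)\<^sup>2 * exp (- (\<kappa> * sqrt (ln x))))" by (simp add: mult_ac)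
    also have "\<dots> \<le> x * exp (- (\<kappa> / 2 * sqrt (ln x)))" using X' x x0 by (intro mult_left_mono) auto
    finally show "\<bar>riesz_mean z x\<bar> \<le> x * exp (- (\<kappa> / 2 * sqrt (ln x)))" .
  qed
qed

theorem sieve_sum_bound:
  obtains k X where "k > 0" "X \<ge> 1"
    "\<And>x z. x \<ge> X \<Longrightarrow> z \<ge> 1 \<Longrightarrow> real z \<le> ln x ^ 3 \<Longrightarrow> \<bar>sieve_sum z x\<bar> \<le> x * exp (- (k * sqrt (ln x)))"
proof -
  obtain k X where K: "k > 0" "X \<ge> 1"
    "\<And>x z. x \<ge> X \<Longrightarrow> z \<ge> 1 \<Longrightarrow> real z \<le> ln x ^ 3 \<Longrightarrow> \<bar>riesz_mean z x\<bar> \<le> x * exp (- (k * sqrt (ln x)))"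
    using riesz_mean_bound' by blast
  have "\<forall>\<^sub>F x::real in at_top. 5 * x * exp (- (k / 2 * sqrt (ln x))) + (2 * (x * exp (- (k / 2 * sqrt (ln x)))) * (1 + ln (2 * x)) + 2 * sqrt (2 * x))
     \<le> x * exp (- (k / 4 * sqrt (ln x)))" (is "eventually ?E _")
    using K(1) by real_asymp
  then obtain X' where X': "\<And>x. x \<ge> X' \<Longrightarrow> ?E x"
    unfolding eventually_at_top_linorder by blast
  show ?thesis
  proof (rule that)
    show "k / 4 > 0" "max X X' \<ge> 1" using K by auto
    fix x :: real and z :: nat
    assume x: "x \<ge> max X X'" and z: "z \<ge> 1" "real z \<le> ln x ^ 3"
    have x1: "x \<ge> 1" using x K by simp
    \<comment> \<open>Half of the exponent: dividing by h spends half of the saving of the Riesz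
      means, and the coefficients in (x, x + h], of total size about h * ln x, cost no more than the
      other half allows.\<close>
    define h where "h = x * exp (- (k / 2 * sqrt (ln x)))"
    have "exp (- (k / 2 * sqrt (ln x))) \<le> 1" using K x1 by simp
    then have h: "0 < h" "h \<le> x" using x1 mult_left_mono[of "exp (- (k / 2 * sqrt (ln x)))" 1 x] by (auto simp: h_def)
    have lm: "ln x \<le> ln (x + h)" using x1 h by (intro ln_mono) auto
    have z': "real z \<le> ln (x + h) ^ 3" using z(2) power_mono[OF lm, of 3] x1 by simp
    have "\<bar>riesz_mean z (x + h)\<bar> \<le> (x + h) * exp (- (k * sqrt (ln (x + h))))"
      using x h z' z by (intro K(3)) auto
    also have "\<dots> \<le> (2 * x) * exp (- (k * sqrt (ln x)))"
      using h x1 lm K(1) by (intro mult_mono) auto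
    finally have q1: "\<bar>riesz_mean z (x + h)\<bar> \<le> (2 * x) * exp (- (k * sqrt (ln x)))" .
    have q2: "\<bar>riesz_mean z x\<bar> \<le> x * exp (- (k * sqrt (ln x)))" using x z by (intro K(3)) auto
    have "(x + h) * \<bar>riesz_mean z (x + h)\<bar> + x * \<bar>riesz_mean z x\<bar>
        \<le> (2 * x) * ((2 * x) * exp (- (k * sqrt (ln x)))) + x * (x * exp (- (k * sqrt (ln x))))"
      using q1 q2 h x1 by (intro add_mono mult_mono) auto
    also have "\<dots> = 5 * x * exp (- (k / 2 * sqrt (ln x))) * h"
      by (simp add: h_def algebra_simps flip: exp_add)
    finally have "((x + h) * \<bar>riesz_mean z (x + h)\<bar> + x * \<bar>riesz_mean z x\<bar>) / h \<le> 5 * x * exp (- (k / 2 * sqrt (ln x)))"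
      using h by (simp add: pos_divide_le_eq)
    moreover have "(\<Sum>n | n \<in> rough z \<and> x < real n \<and> real n \<le> x + h. \<bar>sieve_coeff n\<bar>) \<le> 2 * h * (1 + ln (2 * x)) + 2 * sqrt (2 * x)"
    proof -
      have "(\<Sum>n | n \<in> rough z \<and> x < real n \<and> real n \<le> x + h. \<bar>sieve_coeff n\<bar>) \<le> 2 * (x + h - x) * (1 + ln (x + h)) + 2 * sqrt (x + h)"
        using x1 h by (intro sum_abs_sieve_coeff_interval) auto
      also have "\<dots> \<le> 2 * h * (1 + ln (2 * x)) + 2 * sqrt (2 * x)"
        using x1 h by (intro add_mono mult_mono ln_mono) auto
      finally show ?thesis .
    qed
    ultimately have "\<bar>sieve_sum z x\<bar> \<le> 5 * x * exp (- (k / 2 * sqrt (ln x))) + (2 * h * (1 + ln (2 * x)) + 2 * sqrt (2 * x))"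
      using sieve_sum_le_riesz_mean[of x h z] x1 h by simp
    also have "\<dots> \<le> x * exp (- (k / 4 * sqrt (ln x)))" unfolding h_def using X' x by simp
    finally show "\<bar>sieve_sum z x\<bar> \<le> x * exp (- (k / 4 * sqrt (ln x)))" .
  qed
qed

section \<open>Abel summation and the sum with fractional parts\<close>

lemma abel_inequality:
  fixes c w :: "nat \<Rightarrow> real"
  assumes part: "\<And>j. m \<le> j \<Longrightarrow> j \<le> M \<Longrightarrow> \<bar>\<Sum>n\<in>{m<..j}. c n\<bar> \<le> B"
    and w: "\<And>i j. m < i \<Longrightarrow> i \<le> j \<Longrightarrow> j \<le> M \<Longrightarrow> w j \<le> w i" "\<And>i. m < i \<Longrightarrow> i \<le> M \<Longrightarrow> 0 \<le> w i \<and> w i \<le> W"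
    and mM: "m \<le> M" and W: "W \<ge> 0"
  shows "\<bar>\<Sum>n\<in>{m<..M}. c n * w n\<bar> \<le> B * W"
proof -
  have B: "B \<ge> 0" using part[of m] mM by simp
  \<comment> \<open>Generalised for the induction: subtracting v times the plain sum, for any v
    below all the weights, leaves B times the drop W - v. The claim is the case v = 0.\<close>
  have "\<bar>(\<Sum>n\<in>{m<..j}. c n * w n) - (\<Sum>n\<in>{m<..j}. c n) * v\<bar> \<le> B * (W - v)"
    if "m \<le> j" "j \<le> M" "0 \<le> v" "v \<le> W" "\<And>i. m < i \<Longrightarrow> i \<le> j \<Longrightarrow> v \<le> w i" for j v
    using that
  proof (induction j arbitrary: v rule: dec_induct)
    case base
    then show ?case using B by simp
  next
    case (step j)
    have ins: "{m<..Suc j} = insert (Suc j) {m<..j}" using step.hyps by auto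
    have wS: "0 \<le> w (Suc j)" "w (Suc j) \<le> W" using w(2)[of "Suc j"] step by auto
    have IH: "\<bar>(\<Sum>n\<in>{m<..j}. c n * w n) - (\<Sum>n\<in>{m<..j}. c n) * w (Suc j)\<bar> \<le> B * (W - w (Suc j))"
      using step.prems step.hyps wS by (intro step.IH w(1)) auto
    have v: "v \<le> w (Suc j)" using step.prems step.hyps by auto
    have "\<bar>(\<Sum>n\<in>{m<..Suc j}. c n) * (w (Suc j) - v)\<bar> \<le> B * (w (Suc j) - v)"
      unfolding abs_mult using part[of "Suc j"] step.prems step.hyps v by (intro mult_mono) auto
    moreover have "(\<Sum>n\<in>{m<..Suc j}. c n * w n) - (\<Sum>n\<in>{m<..Suc j}. c n) * v
       = ((\<Sum>n\<in>{m<..j}. c n * w n) - (\<Sum>n\<in>{m<..j}. c n) * w (Suc j)) + (\<Sum>n\<in>{m<..Suc j}. c n) * (w (Suc j) - v)"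
      by (simp add: ins algebra_simps)
    ultimately have "\<bar>(\<Sum>n\<in>{m<..Suc j}. c n * w n) - (\<Sum>n\<in>{m<..Suc j}. c n) * v\<bar> \<le> B * (W - w (Suc j)) + B * (w (Suc j) - v)"
      using IH by linarith
    then show ?case by (simp add: algebra_simps)
  qed
  from this[of M 0] show ?thesis using mM W w(2) by auto
qed

definition frac_sum :: "nat \<Rightarrow> real \<Rightarrow> real" where
  "frac_sum z x = (\<Sum>n | n \<in> rough z \<and> real n \<le> x. sieve_coeff n * frac (x / real n))"

text \<open>On \<open>y < n \<le> x\<close> the fractional part is split as \<open>x / n - \<lfloor>x / n\<rfloor>\<close>, a difference of two monotone
  weights, so that Abel's inequality applies to each of them.\<close>
lemma frac_sum_le:
  assumes y: "1 \<le> y" "y \<le> x" and S: "\<And>u. y \<le> u \<Longrightarrow> u \<le> x \<Longrightarrow> \<bar>sieve_sum z u\<bar> \<le> B"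
  shows "\<bar>frac_sum z x\<bar> \<le> (2 * y * (1 + ln y) + 2 * sqrt y) + 4 * B * (x / y)"
proof -
  define m where "m = nat \<lfloor>y\<rfloor>"
  define M where "M = nat \<lfloor>x\<rfloor>"
  define c where "c n = (if n \<in> rough z then sieve_coeff n else 0)" for n
  have mM: "m \<le> M" unfolding m_def M_def using y by (intro nat_mono floor_mono)
  have le_m: "real n \<le> y \<longleftrightarrow> n \<le> m" and le_M: "real n \<le> x \<longleftrightarrow> n \<le> M" for n
    using y by (auto simp: m_def M_def le_nat_iff le_floor_iff)
  have part: "\<bar>\<Sum>n\<in>{m<..j}. c n\<bar> \<le> 2 * B" if j: "m \<le> j" "j \<le> M" for j
  proof -
    have Sj: "sieve_sum z u = (\<Sum>n\<in>{0<..i}. c n)" if "\<And>n. real n \<le> u \<longleftrightarrow> n \<le> i" for u i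
    proof -
      have "sieve_sum z u = (\<Sum>n | n \<in> rough z \<and> real n \<le> u. c n)" unfolding sieve_sum_def by (intro sum.cong) (auto simp: c_def)
      also have "\<dots> = (\<Sum>n\<in>{0<..i}. c n)"
        by (intro sum.mono_neutral_left) (auto simp: c_def that dest: rough_pos)
      finally show ?thesis .
    qed
    have "{0<..j} = {0<..m} \<union> {m<..j}" using j by auto
    then have "(\<Sum>n\<in>{0<..j}. c n) = (\<Sum>n\<in>{0<..m}. c n) + (\<Sum>n\<in>{m<..j}. c n)"
      by (simp only:) (rule sum.union_disjoint, auto)
    moreover have "(\<Sum>n\<in>{0<..m}. c n) = sieve_sum z y" using Sj[of y m] le_m by simp
    \<comment> \<open>The argument is max y j because j may be the integer part of y and lie below
      y, where the hypothesis on the summatory function says nothing.\<close>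
    moreover have "(\<Sum>n\<in>{0<..j}. c n) = sieve_sum z (max y (real j))"
      using j le_m by (intro Sj[symmetric]) (auto simp: le_max_iff_disj)
    moreover have "\<bar>sieve_sum z y\<bar> \<le> B" using y by (intro S) auto
    moreover have "\<bar>sieve_sum z (max y (real j))\<bar> \<le> B" using y j le_M[of j] by (intro S) auto
    ultimately show ?thesis by linarith
  qed
  have xn: "0 \<le> x / real n \<and> x / real n \<le> x / y" if "m < n" for n
    using that le_m[of n] y by (auto intro!: divide_left_mono)
  have xm: "x / real j \<le> x / real i" if "m < i" "i \<le> j" for i j
    using that y by (intro divide_left_mono) auto
  have a1: "\<bar>\<Sum>n\<in>{m<..M}. c n * (x / real n)\<bar> \<le> 2 * B * (x / y)"
    by (rule abel_inequality[OF part]) (use xn xm mM y in auto)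
  have a2: "\<bar>\<Sum>n\<in>{m<..M}. c n * of_int \<lfloor>x / real n\<rfloor>\<bar> \<le> 2 * B * (x / y)"
  proof (rule abel_inequality[OF part])
    show "real_of_int \<lfloor>x / real j\<rfloor> \<le> real_of_int \<lfloor>x / real i\<rfloor>" if "m < i" "i \<le> j" for i j
      using xm[OF that] by (simp add: floor_mono)
    show "0 \<le> real_of_int \<lfloor>x / real i\<rfloor> \<and> real_of_int \<lfloor>x / real i\<rfloor> \<le> x / y" if "m < i" for i
    proof
      show "0 \<le> real_of_int \<lfloor>x / real i\<rfloor>" using xn[OF that] by simp
      show "real_of_int \<lfloor>x / real i\<rfloor> \<le> x / y" using xn[OF that] of_int_floor_le[of "x / real i"] by linarith
    qed
  qed (use mM y in auto)
  have fin: "finite {n. n \<in> rough z \<and> real n \<le> y}" by simp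
  have "frac_sum z x = (\<Sum>n | n \<in> rough z \<and> real n \<le> y. sieve_coeff n * frac (x / real n)) + (\<Sum>n\<in>{m<..M}. c n * frac (x / real n))"
  proof -
    have "{n. n \<in> rough z \<and> real n \<le> x} = {n. n \<in> rough z \<and> real n \<le> y} \<union> {n \<in> rough z. m < n \<and> n \<le> M}"
      using mM by (auto simp: le_m le_M)
    then have "frac_sum z x = (\<Sum>n | n \<in> rough z \<and> real n \<le> y. sieve_coeff n * frac (x / real n))
        + (\<Sum>n | n \<in> rough z \<and> m < n \<and> n \<le> M. sieve_coeff n * frac (x / real n))"
      unfolding frac_sum_def by (simp only:) (rule sum.union_disjoint, auto simp: le_m)
    also have "(\<Sum>n | n \<in> rough z \<and> m < n \<and> n \<le> M. sieve_coeff n * frac (x / real n)) = (\<Sum>n\<in>{m<..M}. c n * frac (x / real n))"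
      by (rule sum.mono_neutral_cong_left) (auto simp: c_def)
    finally show ?thesis .
  qed
  moreover have "(\<Sum>n\<in>{m<..M}. c n * frac (x / real n)) = (\<Sum>n\<in>{m<..M}. c n * (x / real n)) - (\<Sum>n\<in>{m<..M}. c n * of_int \<lfloor>x / real n\<rfloor>)"
    by (simp add: frac_def right_diff_distrib sum_subtractf)
  moreover have "\<bar>\<Sum>n | n \<in> rough z \<and> real n \<le> y. sieve_coeff n * frac (x / real n)\<bar> \<le> 2 * y * (1 + ln y) + 2 * sqrt y"
  proof -
    have "\<bar>\<Sum>n | n \<in> rough z \<and> real n \<le> y. sieve_coeff n * frac (x / real n)\<bar>
        \<le> (\<Sum>n | n \<in> rough z \<and> real n \<le> y. \<bar>sieve_coeff n * frac (x / real n)\<bar>)" by (rule sum_abs)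
    also have "\<dots> \<le> (\<Sum>n | n \<in> rough z \<and> real n \<le> y. \<bar>sieve_coeff n\<bar>)"
    proof (rule sum_mono)
      fix n
      have "\<bar>sieve_coeff n\<bar> * \<bar>frac (x / real n)\<bar> \<le> \<bar>sieve_coeff n\<bar> * 1"
        using frac_lt_1[of "x / real n"] by (intro mult_left_mono) (auto simp: less_imp_le)
      then show "\<bar>sieve_coeff n * frac (x / real n)\<bar> \<le> \<bar>sieve_coeff n\<bar>" by (simp add: abs_mult)
    qed
    also have "(\<Sum>n | n \<in> rough z \<and> real n \<le> y. \<bar>sieve_coeff n\<bar>) = (\<Sum>n | n \<in> rough z \<and> 0 < real n \<and> real n \<le> y. \<bar>sieve_coeff n\<bar>)"
      by (rule sum.cong) (auto dest: rough_pos)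
    also have "\<dots> \<le> 2 * (y - 0) * (1 + ln y) + 2 * sqrt y"
      using y by (intro sum_abs_sieve_coeff_interval) auto
    finally show ?thesis by simp
  qed
  ultimately have "\<bar>frac_sum z x\<bar> \<le> (2 * y * (1 + ln y) + 2 * sqrt y) + (2 * B * (x / y) + 2 * B * (x / y))"
    using a1 a2 by linarith
  then show ?thesis by simp
qed

text \<open>The hypothesis on z has the exponent 2 where the summatory function allows 3: that bound
  is applied at all u in [y, x], where ln u is only known to be at least ln x / 4, and the spare
  power of the logarithm pays for the factor 1/4.\<close>

theorem frac_sum_bound:
  obtains k X where "k > 0" "X \<ge> 1"
    "\<And>x z. x \<ge> X \<Longrightarrow> z \<ge> 1 \<Longrightarrow> real z \<le> (ln x)\<^sup>2 \<Longrightarrow> \<bar>frac_sum z x\<bar> \<le> x * exp (- (k * sqrt (ln x)))"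
proof -
  obtain k X where K: "k > 0" "X \<ge> 1"
    "\<And>x z. x \<ge> X \<Longrightarrow> z \<ge> 1 \<Longrightarrow> real z \<le> ln x ^ 3 \<Longrightarrow> \<bar>sieve_sum z x\<bar> \<le> x * exp (- (k * sqrt (ln x)))"
    using sieve_sum_bound by blast
  \<comment> \<open>On [y, x] the summatory function saves exp (k / 2 * sqrt (ln x)), of which x / y
    spends half; the terms n \<le> y are of size y * ln y. Both leave k / 4, and lowering it to k /
    8 absorbs the logarithm.\<close>
  define y where "y x = x * exp (- (k / 4 * sqrt (ln x)))" for x
  have 1: "\<forall>\<^sub>F x::real in at_top. y x \<ge> X" unfolding y_def using K(1) by real_asymp
  have 2: "\<forall>\<^sub>F x::real in at_top. ln x / 4 \<le> ln x - k / 4 * sqrt (ln x)" using K(1) by real_asymp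
  have 3: "\<forall>\<^sub>F x::real in at_top. (ln x)\<^sup>2 \<le> (ln x / 4) ^ 3" by real_asymp
  have 4: "\<forall>\<^sub>F x::real in at_top. (2 * y x * (1 + ln (y x)) + 2 * sqrt (y x)) + 4 * (x * exp (- (k / 2 * sqrt (ln x)))) * exp (k / 4 * sqrt (ln x))
      \<le> x * exp (- (k / 8 * sqrt (ln x)))"
    unfolding y_def using K(1) by real_asymp
  have "\<forall>\<^sub>F x::real in at_top. y x \<ge> X \<and> ln x / 4 \<le> ln x - k / 4 * sqrt (ln x) \<and> (ln x)\<^sup>2 \<le> (ln x / 4) ^ 3 \<and>
     (2 * y x * (1 + ln (y x)) + 2 * sqrt (y x)) + 4 * (x * exp (- (k / 2 * sqrt (ln x)))) * exp (k / 4 * sqrt (ln x))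
      \<le> x * exp (- (k / 8 * sqrt (ln x)))" (is "eventually ?E _")
    using 1 2 3 4 by eventually_elim blast
  then obtain X' where X': "\<And>x. x \<ge> X' \<Longrightarrow> ?E x" unfolding eventually_at_top_linorder by blast
  show ?thesis
  proof (rule that)
    show "k / 8 > 0" "max X X' \<ge> 1" using K by auto
    fix x :: real and z :: nat
    assume x: "x \<ge> max X X'" and z: "z \<ge> 1" "real z \<le> (ln x)\<^sup>2"
    note X'x = X'[of x]
    have x1: "x \<ge> 1" using x K by simp
    have lx: "ln x \<ge> 0" using x1 by simp
    have yX: "y x \<ge> X" using X'x x by simp
    have "exp (- (k / 4 * sqrt (ln x))) \<le> 1" using K lx by simp
    then have yx: "y x \<le> x" using mult_left_mono[of "exp (- (k / 4 * sqrt (ln x)))" 1 x] x1 by (simp add: y_def)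
    have y1: "y x \<ge> 1" using yX K by simp
    have "ln (y x) = ln x - k / 4 * sqrt (ln x)" using x1 by (simp add: y_def ln_mult)
    then have ly: "ln x / 4 \<le> ln (y x)" using X'x x by simp
    have S: "\<bar>sieve_sum z u\<bar> \<le> x * exp (- (k / 2 * sqrt (ln x)))" if u: "y x \<le> u" "u \<le> x" for u
    proof -
      have "ln (y x) \<le> ln u" using u y1 by (intro ln_mono) auto
      then have lu: "ln x / 4 \<le> ln u" using ly by simp
      then have "(ln x / 4) ^ 3 \<le> ln u ^ 3" using lx by (intro power_mono) auto
      then have "real z \<le> ln u ^ 3" using z X'x x by simp
      then have "\<bar>sieve_sum z u\<bar> \<le> u * exp (- (k * sqrt (ln u)))" using u yX z by (intro K(3)) auto
      also have "\<dots> \<le> x * exp (- (k / 2 * sqrt (ln x)))"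
      proof (intro mult_mono)
        have "sqrt (ln x / 4) \<le> sqrt (ln u)" using lu by simp
        then have "sqrt (ln x) / 2 \<le> sqrt (ln u)" by (simp add: real_sqrt_divide)
        then have "k * (sqrt (ln x) / 2) \<le> k * sqrt (ln u)" using K by (intro mult_left_mono) auto
        then show "exp (- (k * sqrt (ln u))) \<le> exp (- (k / 2 * sqrt (ln x)))" by simp
      qed (use u x1 in auto)
      finally show ?thesis .
    qed
    have "\<bar>frac_sum z x\<bar> \<le> (2 * y x * (1 + ln (y x)) + 2 * sqrt (y x)) + 4 * (x * exp (- (k / 2 * sqrt (ln x)))) * (x / y x)"
      by (rule frac_sum_le[OF y1 yx S])
    also have "x / y x = exp (k / 4 * sqrt (ln x))" using x1 by (simp add: y_def exp_minus inverse_eq_divide)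
    finally show "\<bar>frac_sum z x\<bar> \<le> x * exp (- (k / 8 * sqrt (ln x)))" using X'x x by simp
  qed
qed

section \<open>Chebyshev's lower bound\<close>

text \<open>Legendre's formula in logarithmic form. From n to n + 1 the quotient by d increases
  exactly when d divides n + 1, and the corresponding values of \<open>mangoldt\<close> add up to ln
  (n + 1).\<close>

lemma ln_fact_mangoldt: "ln (fact n) = (\<Sum>d=1..n. mangoldt d * real (n div d))"
proof (induction n)
  case (Suc n)
  have "(\<Sum>d=1..Suc n. mangoldt d * real (Suc n div d)) =
      (\<Sum>d=1..Suc n. mangoldt d * real (n div d) + (if d dvd Suc n then mangoldt d else 0))"
    by (intro sum.cong refl) (auto simp: div_Suc dvd_eq_mod_eq_0 algebra_simps)
  also have "\<dots> = (\<Sum>d=1..Suc n. mangoldt d * real (n div d)) + (\<Sum>d=1..Suc n. if d dvd Suc n then mangoldt d else 0)"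
    by (rule sum.distrib)
  also have "(\<Sum>d=1..Suc n. mangoldt d * real (n div d)) = ln (fact n)"
    using Suc.IH by simp
  also have "(\<Sum>d=1..Suc n. if d dvd Suc n then mangoldt d else 0) = (\<Sum>d | d dvd Suc n. mangoldt d :: real)"
  proof -
    have "(\<Sum>d | d dvd Suc n. mangoldt d :: real) = (\<Sum>d\<in>{1..Suc n} \<inter> {d. d dvd Suc n}. mangoldt d)"
    proof (rule sum.cong)
      show "{d. d dvd Suc n} = {1..Suc n} \<inter> {d. d dvd Suc n}"
        by (auto dest: dvd_imp_le dvd_pos_nat[rotated] simp: Suc_le_eq)
    qed simp
    then show ?thesis by (simp add: sum.inter_restrict)
  qed
  also have "\<dots> = ln (real (Suc n))" by (subst mangoldt_sum) auto
  finally have "(\<Sum>d=1..Suc n. mangoldt d * real (Suc n div d)) = ln (fact n) + ln (real (Suc n))" .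
  also have "\<dots> = ln (fact (Suc n))" by (simp add: ln_mult del: of_nat_Suc)
  finally show ?case by simp
qed simp

text \<open>Chebyshev's argument: the central binomial coefficient is at least 2^n, and in its
  logarithm each \<open>mangoldt d\<close> has the multiplicity (2 * n) div d - 2 * (n div d), which
  is at most 1.\<close>

lemma sum_mangoldt_ge: "real n * ln 2 \<le> (\<Sum>d=1..2 * n. mangoldt d)"
proof -
  have "2 ^ n \<le> real (2 * n choose n)"
  proof (cases "n = 0")
    case False
    have "(real (2 * n) / real n) ^ n \<le> real (2 * n choose n)" by (rule binomial_ge_n_over_k_pow_k) simp
    then show ?thesis using False by simp
  qed simp
  then have "ln (2 ^ n) \<le> ln (real (2 * n choose n))" by (intro ln_mono) auto
  also have "real (2 * n choose n) = fact (2 * n) / (fact n * fact n)"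
    by (subst binomial_fact) (auto simp: mult_2)
  also have "ln \<dots> = ln (fact (2 * n)) - 2 * ln (fact n)" by (simp add: ln_div ln_mult)
  also have "ln (fact n) = (\<Sum>d=1..2 * n. mangoldt d * real (n div d))"
    unfolding ln_fact_mangoldt by (rule sum.mono_neutral_left) auto
  also have "ln (fact (2 * n)) - 2 * (\<Sum>d=1..2 * n. mangoldt d * real (n div d))
      = (\<Sum>d=1..2 * n. mangoldt d * (real (2 * n div d) - 2 * real (n div d)))"
    unfolding ln_fact_mangoldt by (simp add: sum_distrib_left right_diff_distrib mult_ac flip: sum_subtractf)
  also have "\<dots> \<le> (\<Sum>d=1..2 * n. mangoldt d * 1)"
  proof (intro sum_mono mult_left_mono mangoldt_nonneg)
    fix d assume "d \<in> {1..2 * n}"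
    then have d: "d > 0" by simp
    have "2 * n = 2 * (d * (n div d) + n mod d)" by simp
    also have "\<dots> = d * (2 * (n div d)) + 2 * (n mod d)" by (simp only: distrib_left mult.left_commute)
    also have "\<dots> < d * (2 * (n div d)) + d * 2" using d by simp
    also have "\<dots> = (2 * (n div d) + 2) * d" by (simp add: algebra_simps)
    finally have "2 * n div d < 2 * (n div d) + 2" using d by (subst div_less_iff_less_mult) auto
    then show "real (2 * n div d) - 2 * real (n div d) \<le> 1" by linarith
  qed
  finally show ?thesis by (simp add: ln_realpow)
qed

text \<open>A prime p has at most ln N / ln p powers up to N, each contributing ln p, hence
  contributes at most ln N in total.\<close>

lemma sum_mangoldt_le:
  assumes "N \<ge> 1"
  shows "(\<Sum>d=1..N. mangoldt d) \<le> real (card {p. prime p \<and> p \<le> N}) * ln (real N)"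
proof -
  let ?P = "{p. prime p \<and> p \<le> N}"
  define K where "K p = nat \<lfloor>ln (real N) / ln (real p)\<rfloor>" for p
  let ?I = "Sigma ?P (\<lambda>p. {1..K p})"
  have lnp: "ln (real p) > 0" if "prime p" for p using prime_gt_1_nat[OF that] by simp
  have sub: "{d\<in>{1..N}. primepow d} \<subseteq> (\<lambda>(p,k). p ^ k) ` ?I"
  proof
    fix d assume d: "d \<in> {d\<in>{1..N}. primepow d}"
    then obtain p k where pk: "prime p" "k > 0" "d = p ^ k" by (auto simp: primepow_def)
    have "p \<le> p ^ k" using pk prime_ge_1_nat[OF pk(1)] by (simp add: self_le_power)
    then have p: "p \<in> ?P" using pk d by auto
    have "ln (real (p ^ k)) \<le> ln (real N)"
      using d pk prime_gt_0_nat[OF pk(1)] by (intro ln_mono) auto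
    then have "real k \<le> ln (real N) / ln (real p)"
      using lnp[OF pk(1)] prime_gt_0_nat[OF pk(1)] by (simp add: ln_realpow pos_le_divide_eq)
    then have "k \<in> {1..K p}" using pk by (auto simp: K_def le_nat_floor)
    then have "(p, k) \<in> ?I" using p by simp
    then show "d \<in> (\<lambda>(p,k). p ^ k) ` ?I" using pk(3) by (auto intro!: image_eqI[of _ _ "(p, k)"])
  qed
  have fin: "finite ?I" by simp
  have "(\<Sum>d=1..N. mangoldt d :: real) = (\<Sum>d\<in>{d\<in>{1..N}. primepow d}. mangoldt d)"
    by (rule sum.mono_neutral_right) (auto simp: mangoldt_def)
  also have "\<dots> \<le> (\<Sum>d\<in>(\<lambda>(p,k). p ^ k) ` ?I. mangoldt d)"
    using fin by (intro sum_mono2 sub mangoldt_nonneg finite_imageI) auto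
  also have "\<dots> \<le> (\<Sum>i\<in>?I. mangoldt ((\<lambda>(p,k). p ^ k) i))"
    by (rule order_trans[OF sum_image_le[OF fin]]) (auto simp: mangoldt_nonneg o_def)
  also have "\<dots> = (\<Sum>p\<in>?P. \<Sum>k=1..K p. mangoldt (p ^ k))"
    by (subst sum.Sigma) (auto simp: case_prod_unfold)
  also have "\<dots> \<le> (\<Sum>p\<in>?P. ln (real N))"
  proof (rule sum_mono)
    fix p assume "p \<in> ?P"
    then have p: "prime p" by simp
    have "(\<Sum>k=1..K p. mangoldt (p ^ k) :: real) = (\<Sum>k=1..K p. ln (real p))"
      using p by (intro sum.cong) auto
    also have "\<dots> = real (K p) * ln (real p)" by simp
    also have "\<dots> \<le> ln (real N) / ln (real p) * ln (real p)"
      using lnp[OF p] assms by (intro mult_right_mono) (auto simp: K_def)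
    finally show "(\<Sum>k=1..K p. mangoldt (p ^ k)) \<le> ln (real N)" using lnp[OF p] by simp
  qed
  finally show ?thesis by simp
qed

lemma prime_count_ge:
  assumes "N \<ge> 1"
  shows "real (N div 2) * ln 2 \<le> real (card {p. prime p \<and> p \<le> N}) * ln (real N)"
proof -
  have "real (N div 2) * ln 2 \<le> (\<Sum>d=1..2 * (N div 2). mangoldt d)" by (rule sum_mangoldt_ge)
  also have "\<dots> \<le> (\<Sum>d=1..N. mangoldt d)"
    by (intro sum_mono2 mangoldt_nonneg) auto
  also have "\<dots> \<le> real (card {p. prime p \<and> p \<le> N}) * ln (real N)" by (rule sum_mangoldt_le[OF assms])
  finally show ?thesis .
qed

section \<open>The size of the j-th prime and of x\<close>

lemma prime_nth_prime: "prime (nth_prime j)"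
  using enumerate_in_set[OF primes_infinite, of "j - 1"] by (simp add: nth_prime_def)

lemma nth_prime_ge: "nth_prime j \<ge> j - 1"
  unfolding nth_prime_def by (rule le_enumerate) (rule primes_infinite)

lemma card_primes_le_nth_prime:
  assumes "j \<ge> 1" shows "card {p. prime p \<and> p \<le> nth_prime j} = j"
proof -
  let ?e = "enumerate {p::nat. prime p}"
  have "{p. prime p \<and> p \<le> ?e (j - 1)} = ?e ` {..j - 1}"
  proof safe
    fix p :: nat assume p: "prime p" "p \<le> ?e (j - 1)"
    then obtain i where i: "?e i = p" using enumerate_Ex[of "{p. prime p}" p] primes_infinite by auto
    have "i \<le> j - 1"
    proof (rule ccontr)
      assume "\<not> i \<le> j - 1"
      then have "?e (j - 1) < ?e i" by (intro enumerate_mono primes_infinite) simp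
      then show False using i p by simp
    qed
    then show "p \<in> ?e ` {..j - 1}" using i by auto
  next
    fix i assume "i \<le> j - 1"
    then show "?e i \<le> ?e (j - 1)" by (cases "i = j - 1") (auto intro!: less_imp_le enumerate_mono primes_infinite)
    show "prime (?e i)" using enumerate_in_set[OF primes_infinite, of i] by simp
  qed
  then have "card {p. prime p \<and> p \<le> ?e (j - 1)} = card {..j - 1}"
    by (simp only:) (rule card_image, rule strict_mono_imp_inj_on, simp add: strict_mono_enumerate primes_infinite)
  then show ?thesis using assms by (simp add: nth_prime_def)
qed

text \<open>Chebyshev's bound at N = p_j, where exactly j primes occur, gives p_j of order at most j
  * ln p_j. The integer form of p_j \<le> j^(3/2) leaves room for the logarithm.\<close>

lemma nth_prime_le: "\<forall>\<^sub>F j in sequentially. nth_prime j ^ 2 \<le> j ^ 3"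
proof -
  have "\<forall>\<^sub>F u::real in at_top. u ^ 2 * ln u ^ 3 \<le> ((u / 2 - 1) * ln 2) ^ 3" by real_asymp
  then obtain U where U: "\<And>u::real. u \<ge> U \<Longrightarrow> u ^ 2 * ln u ^ 3 \<le> ((u / 2 - 1) * ln 2) ^ 3"
    unfolding eventually_at_top_linorder by blast
  show ?thesis
  proof (rule eventually_sequentiallyI)
    fix j assume j: "j \<ge> nat \<lceil>U\<rceil> + 3"
    define p where "p = nth_prime j"
    have pr: "prime p" by (simp add: p_def prime_nth_prime)
    have pge: "p \<ge> j - 1" unfolding p_def by (rule nth_prime_ge)
    then have pU: "real p \<ge> U" using j by linarith
    have p2: "p \<ge> 2" using prime_ge_2_nat[OF pr] .
    have lp: "ln (real p) > 0" using p2 by simp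
    have "(real p / 2 - 1) * ln 2 \<le> real (p div 2) * ln 2" by (intro mult_right_mono) (linarith, simp)
    also have "\<dots> \<le> real j * ln (real p)"
      using prime_count_ge[of p] p2 card_primes_le_nth_prime[of j] j by (simp add: p_def)
    finally have "((real p / 2 - 1) * ln 2) ^ 3 \<le> (real j * ln (real p)) ^ 3"
      using p2 by (intro power_mono) auto
    then have "real p ^ 2 * ln (real p) ^ 3 \<le> real j ^ 3 * ln (real p) ^ 3"
      using U[OF pU] by (simp add: power_mult_distrib)
    then have "real p ^ 2 \<le> real j ^ 3" using lp by simp
    then show "nth_prime j ^ 2 \<le> j ^ 3" unfolding p_def by (metis of_nat_le_iff of_nat_power)
  qed
qed

text \<open>All but the primes 2 and 3 enter the product, each with at least the factor 5.\<close>

lemma L_prod_ge: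
  assumes "j \<ge> 1" shows "real (L_prod j) \<ge> 5 ^ j / 25"
proof -
  let ?A = "{p. prime p \<and> 5 \<le> p \<and> p \<le> nth_prime j}"
  have fin: "finite ?A" by (rule finite_subset[of _ "{..nth_prime j}"]) auto
  have "{p. prime p \<and> p \<le> nth_prime j} \<subseteq> ?A \<union> {2, 3}"
  proof safe
    fix p :: nat assume p: "prime p" "p \<le> nth_prime j" "p \<noteq> 2" "p \<notin> {}" "p \<noteq> 3"
    show "5 \<le> p"
    proof (rule ccontr)
      assume "\<not> 5 \<le> p"
      then have "p = 4" using p prime_ge_2_nat[OF p(1)] by linarith
      moreover have "\<not> prime (4::nat)" using prime_product[of 2 2] by auto
      ultimately show False using p by simp
    qed
  qed
  then have "card {p. prime p \<and> p \<le> nth_prime j} \<le> card (?A \<union> {2, 3})" using fin by (intro card_mono) auto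
  also have "\<dots> \<le> card ?A + card {2::nat, 3}" by (rule card_Un_le)
  finally have cA: "j \<le> card ?A + 2" using card_primes_le_nth_prime[OF assms] by simp
  have "(5::real) ^ j \<le> 5 ^ (card ?A + 2)" using cA by (intro power_increasing) auto
  also have "\<dots> = 25 * (\<Prod>p\<in>?A. 5)" by simp
  also have "(\<Prod>p\<in>?A. 5::real) \<le> (\<Prod>p\<in>?A. real p)" by (intro prod_mono) auto
  also have "\<dots> = real (L_prod j)" by (simp add: L_prod_def)
  finally show ?thesis by simp
qed

text \<open>The subtracted shift grows only polynomially in j. The base 3 is small enough to leave
  room below 5 and large enough that ln 3 \<ge> 1, so that j is at most ln x.\<close>

lemma x_param_ge: "\<forall>\<^sub>F j in sequentially. x_param j \<ge> 3 ^ j"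
proof -
  have "\<forall>\<^sub>F j in sequentially. nth_prime (Suc j) ^ 2 \<le> Suc j ^ 3"
    using nth_prime_le by (rule eventually_sequentially_Suc[THEN iffD2])
  moreover have "\<forall>\<^sub>F j::nat in sequentially. (3::real) ^ j \<le> 5 ^ j / 25 - (real j + 1) ^ 3 / 6" by real_asymp
  moreover have "\<forall>\<^sub>F j::nat in sequentially. j \<ge> 1" by (rule eventually_ge_at_top)
  ultimately show ?thesis
  proof eventually_elim
    case (elim j)
    have "real (nth_prime (Suc j)) ^ 2 \<le> (real j + 1) ^ 3"
      using of_nat_mono[OF elim(1), where 'a = real] by (simp add: add.commute)
    moreover have "r \<le> u - (v - 1) / 6"
      if "r \<le> t - w / 6" "v \<le> w" "t \<le> u" for r t u v w :: real
      using that by (simp add: field_simps)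
    ultimately have "3 ^ j \<le> real (L_prod j) - (real (nth_prime (Suc j)) ^ 2 - 1) / 6"
      using elim(2) L_prod_ge[OF elim(3)] by blast
    then show ?case by (simp add: x_param_def M_shift_def)
  qed
qed

section \<open>The twin prime remainder\<close>

lemma L_tail_eq: "L_tail j x = \<Prod>(prime_block (nth_prime j) (nat \<lfloor>x\<rfloor>))"
proof -
  have "real p \<le> x \<longleftrightarrow> p \<le> nat \<lfloor>x\<rfloor>" if "prime p" for p
    using prime_gt_0_nat[OF that] by linarith
  then have "{p. prime p \<and> nth_prime j < p \<and> real p \<le> x} = prime_block (nth_prime j) (nat \<lfloor>x\<rfloor>)"
    by (auto simp: prime_block_def)
  then show ?thesis by (simp add: L_tail_def)
qed

lemma dvd_L_tail_iff:
  assumes "real n \<le> x" shows "n dvd L_tail j x \<longleftrightarrow> n \<in> rough (nth_prime j)"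
  unfolding L_tail_eq using assms by (intro dvd_prod_prime_block_le) (simp add: le_nat_floor)

lemma legendre_diff: "legendre_rhs j - legendre_main j = - frac_sum (nth_prime j) (x_param j)"
proof -
  have set: "{n. real n \<le> x_param j \<and> n dvd L_tail j (x_param j)} = {n. n \<in> rough (nth_prime j) \<and> real n \<le> x_param j}"
    using dvd_L_tail_iff by auto
  show ?thesis
    unfolding legendre_rhs_def legendre_main_def set frac_sum_def
    by (simp add: sieve_coeff_def frac_def sum_negf[symmetric] right_diff_distrib flip: sum_subtractf)
qed

text \<open>The sums differ in two places: n = 1, the only rough number not exceeding p_j,
  contributes the fractional part of x, and n = x, if present, contributes the fractional part of 1,
  which is 0.\<close>

lemma frac_sum_trunc:
  assumes "x \<ge> 1"
  shows "\<bar>frac_sum (nth_prime j) x - (\<Sum>n | nth_prime j < n \<and> real n < x \<and> n dvd L_tail j x.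
     of_int (moebius_mu n) * 2 ^ num_prime_divisors n * frac (x / real n))\<bar> \<le> 1"
proof -
  define z where "z = nth_prime j"
  let ?g = "\<lambda>n. sieve_coeff n * frac (x / real n)"
  let ?A = "{n. n \<in> rough z \<and> real n \<le> x}"
  have fin: "finite ?A" by simp
  have one: "1 \<in> ?A" using assms by (auto simp: rough_def dest: not_prime_1[THEN notE])
  have gt: "z < n" if "n \<in> rough z" "n \<noteq> 1" for n
  proof -
    obtain p where p: "prime p" "p dvd n" using prime_factor_nat[OF \<open>n \<noteq> 1\<close>] by blast
    then have "z < p" using that by (auto simp: rough_def)
    moreover have "p \<le> n" using p rough_pos[OF that(1)] by (intro dvd_imp_le)
    ultimately show ?thesis by simp
  qed
  have "z \<ge> 1" unfolding z_def using prime_ge_1_nat[OF prime_nth_prime] .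
  have "frac_sum z x = ?g 1 + sum ?g (?A - {1})"
    unfolding frac_sum_def by (rule sum.remove[OF fin one])
  moreover have "sum ?g (?A - {1}) = (\<Sum>n | z < n \<and> real n < x \<and> n dvd L_tail j x. ?g n)"
  proof (rule sum.mono_neutral_right)
    show "finite (?A - {1})" using fin by simp
    show "{n. z < n \<and> real n < x \<and> n dvd L_tail j x} \<subseteq> ?A - {1}"
      using dvd_L_tail_iff[of _ x j] \<open>z \<ge> 1\<close> by (auto simp: z_def)
    show "\<forall>n\<in>?A - {1} - {n. z < n \<and> real n < x \<and> n dvd L_tail j x}. ?g n = 0"
    proof
      fix n assume n: "n \<in> ?A - {1} - {n. z < n \<and> real n < x \<and> n dvd L_tail j x}"
      then have "real n = x" using gt dvd_L_tail_iff[of n x j] by (force simp: z_def)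
      then show "?g n = 0" using assms by (simp add: frac_def)
    qed
  qed
  ultimately have "frac_sum z x - (\<Sum>n | z < n \<and> real n < x \<and> n dvd L_tail j x. ?g n) = frac x" by simp
  then show ?thesis using frac_ge_0[of x] frac_lt_1[of x] by (simp add: z_def sieve_coeff_def)
qed

text \<open>Uniformity in z pays off here: with z = p_j one has z \<le> j^2 and j \<le> ln x, so z
  is at most the square of ln x.\<close>

lemma frac_sum_nth_prime_bound:
  obtains k where "k > 0"
    "\<forall>\<^sub>F j in sequentially. \<bar>frac_sum (nth_prime j) (x_param j)\<bar> \<le> x_param j * exp (- (k * sqrt (ln (x_param j))))"
proof -
  obtain k X where K: "k > 0" "X \<ge> 1"
    "\<And>x z. x \<ge> X \<Longrightarrow> z \<ge> 1 \<Longrightarrow> real z \<le> (ln x)\<^sup>2 \<Longrightarrow> \<bar>frac_sum z x\<bar> \<le> x * exp (- (k * sqrt (ln x)))"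
    using frac_sum_bound by blast
  have "\<forall>\<^sub>F j::nat in sequentially. X \<le> 3 ^ j" by real_asymp
  moreover have "\<forall>\<^sub>F j::nat in sequentially. j \<ge> 1" by (rule eventually_ge_at_top)
  ultimately have "\<forall>\<^sub>F j in sequentially. \<bar>frac_sum (nth_prime j) (x_param j)\<bar> \<le> x_param j * exp (- (k * sqrt (ln (x_param j))))"
    using nth_prime_le x_param_ge
  proof eventually_elim
    case (elim j)
    have "exp 1 \<le> (3::real)" by (rule exp_le)
    then have l3: "ln (3::real) \<ge> 1" by (subst ln_ge_iff) auto
    have "real j * 1 \<le> real j * ln 3" using l3 by (intro mult_left_mono) auto
    also have "\<dots> = ln (3 ^ j)" by (simp add: ln_realpow)
    also have "\<dots> \<le> ln (x_param j)" using elim(4) by (intro ln_mono) auto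
    finally have jx: "real j \<le> ln (x_param j)" by simp
    have "nth_prime j ^ 2 \<le> (j ^ 2) ^ 2"
    proof -
      have "j ^ 3 * 1 \<le> j ^ 3 * j" using elim(2) by (intro mult_left_mono) auto
      also have "j ^ 3 * j = (j ^ 2) ^ 2" by (simp add: power2_eq_square power3_eq_cube)
      finally show ?thesis using elim(3) by simp
    qed
    then have "nth_prime j \<le> j ^ 2" by (rule power2_le_imp_le) simp
    then have "real (nth_prime j) \<le> real j ^ 2" by (metis of_nat_le_iff of_nat_power)
    also have "\<dots> \<le> (ln (x_param j))\<^sup>2" using jx by (intro power_mono) auto
    finally show ?case using elim prime_ge_1_nat[OF prime_nth_prime] by (intro K(3)) auto
  qed
  then show ?thesis using that K(1) by blast
qed

theorem theorem3p7:
  shows "\<exists>a b c \<alpha> :: real. 0 < a \<and> 0 < b \<and> b < c \<and> 1 < \<alpha> \<and> \<alpha> < 2 \<and>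
    (\<forall>R. twin_prime_remainder R \<longrightarrow>
      (let x = x_param; T = (\<lambda>j. exp (sqrt (c * ln (x j)))) in
        (\<lambda>j. - R j - (\<Sum>n | nth_prime j < n \<and> real n < x j \<and> n dvd L_tail j (x j).
            of_int (moebius_mu n) * 2 ^ num_prime_divisors n * frac (x j / real n))) \<in> O(\<lambda>_. 1)
        \<and> (\<exists>E1 E2 E3 E4 :: nat \<Rightarrow> real.
              E1 \<in> O(\<lambda>j. x j powr (1 + a / ln (T j)) * ln (T j) ^ 3 / T j)
            \<and> E2 \<in> O(\<lambda>j. x j * ln (x j) ^ 3 / T j)
            \<and> E3 \<in> O(\<lambda>j. x j powr (1 - b / ln (T j)) * ln (T j) ^ 3 * ln (x j) powr \<alpha>)
            \<and> E4 \<in> O(\<lambda>j. x j powr (1 + a / ln (T j)) * (ln (T j) ^ 2 * ln (x j) powr \<alpha>) / T j)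
            \<and> (\<forall>j. - R j = E1 j + E2 j + E3 j + E4 j))
        \<and> (\<lambda>j. - R j) \<in> O(\<lambda>j. x j * exp (- sqrt (c * ln (x j))) * ln (x j) ^ 3)))"
proof -
  obtain k where k: "k > 0"
    "\<forall>\<^sub>F j in sequentially. \<bar>frac_sum (nth_prime j) (x_param j)\<bar> \<le> x_param j * exp (- (k * sqrt (ln (x_param j))))"
    using frac_sum_nth_prime_bound by blast
  \<comment> \<open>With this c, T is exactly the factor exp (k * sqrt (ln x)) saved in the sum with
    fractional parts.\<close>
  define c where "c = k\<^sup>2"
  have c: "c > 0" using k by (simp add: c_def)
  have sq: "sqrt (c * u) = k * sqrt u" for u using k by (simp add: c_def real_sqrt_mult)
  have lim: "filterlim x_param at_top sequentially"
  proof (rule filterlim_at_top_mono[OF _ x_param_ge])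
    show "filterlim (\<lambda>j::nat. 3 ^ j :: real) at_top sequentially" by real_asymp
  qed
  \<comment> \<open>The target function is eventually at least 1, so the unspecified bounded part of
    R is absorbed into the O-term.\<close>
  have "\<forall>\<^sub>F x::real in at_top. x \<ge> 1 \<and> ln x ^ 3 \<ge> 1 \<and> x * exp (- (k * sqrt (ln x))) \<ge> 1"
    using k(1) by (intro eventually_conj; real_asymp)
  then have ev: "\<forall>\<^sub>F j in sequentially. x_param j \<ge> 1 \<and> ln (x_param j) ^ 3 \<ge> 1 \<and> x_param j * exp (- (k * sqrt (ln (x_param j)))) \<ge> 1"
    using lim by (rule eventually_compose_filterlim)
  have main: "(\<lambda>j. - R j - (\<Sum>n | nth_prime j < n \<and> real n < x_param j \<and> n dvd L_tail j (x_param j).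
            of_int (moebius_mu n) * 2 ^ num_prime_divisors n * frac (x_param j / real n))) \<in> O(\<lambda>_. 1)"
    "(\<lambda>j. - R j) \<in> O(\<lambda>j. x_param j * exp (- sqrt (c * ln (x_param j))) * ln (x_param j) ^ 3)"
    if R: "twin_prime_remainder R" for R
  proof -
    obtain K where K: "K > 0" "\<forall>\<^sub>F j in sequentially. norm (R j - (legendre_rhs j - legendre_main j)) \<le> K * norm (1::real)"
      using R unfolding twin_prime_remainder_def by (auto elim: landau_o.bigE)
    then have KR: "\<forall>\<^sub>F j in sequentially. \<bar>R j + frac_sum (nth_prime j) (x_param j)\<bar> \<le> K"
      by (simp add: legendre_diff)
    show "(\<lambda>j. - R j - (\<Sum>n | nth_prime j < n \<and> real n < x_param j \<and> n dvd L_tail j (x_param j).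
            of_int (moebius_mu n) * 2 ^ num_prime_divisors n * frac (x_param j / real n))) \<in> O(\<lambda>_. 1)"
    proof (rule bigoI[of _ "K + 1"])
      show "\<forall>\<^sub>F j in sequentially. norm (- R j - (\<Sum>n | nth_prime j < n \<and> real n < x_param j \<and> n dvd L_tail j (x_param j).
            of_int (moebius_mu n) * 2 ^ num_prime_divisors n * frac (x_param j / real n))) \<le> (K + 1) * norm (1::real)"
        using KR ev
      proof eventually_elim
        case (elim j)
        then show ?case using frac_sum_trunc[of "x_param j" j] by simp
      qed
    qed
    show "(\<lambda>j. - R j) \<in> O(\<lambda>j. x_param j * exp (- sqrt (c * ln (x_param j))) * ln (x_param j) ^ 3)"
    proof (rule bigoI[of _ "K + 1"])
      show "\<forall>\<^sub>F j in sequentially. norm (- R j) \<le> (K + 1) * norm (x_param j * exp (- sqrt (c * ln (x_param j))) * ln (x_param j) ^ 3)"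
        using KR ev k(2)
      proof eventually_elim
        case (elim j)
        define q where "q = x_param j * exp (- (k * sqrt (ln (x_param j))))"
        have q: "q \<ge> 1" "ln (x_param j) ^ 3 \<ge> 1" using elim by (auto simp: q_def)
        have "\<bar>R j\<bar> \<le> K + q" using elim by (simp add: q_def)
        also have "\<dots> \<le> (K + 1) * q" using mult_left_mono[of 1 q K] q K by (simp add: algebra_simps)
        also have "\<dots> \<le> (K + 1) * (q * ln (x_param j) ^ 3)"
          using q K mult_left_mono[of 1 "ln (x_param j) ^ 3" q] by (intro mult_left_mono) auto
        also have "q * ln (x_param j) ^ 3 = norm (q * ln (x_param j) ^ 3)"
          using q by (simp add: abs_mult)
        finally show ?case by (simp only: sq q_def[symmetric] norm_minus_cancel real_norm_def)
      qed
    qed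
  qed
  show ?thesis
  proof (intro exI conjI allI impI)
    show "0 < (1::real)" "0 < c / 2" "c / 2 < c" "1 < (3/2::real)" "3/2 < (2::real)" using c by auto
    fix R assume R: "twin_prime_remainder R"
    have e: "x_param j * ln (x_param j) ^ 3 / exp (sqrt (c * ln (x_param j)))
        = x_param j * exp (- sqrt (c * ln (x_param j))) * ln (x_param j) ^ 3" for j
      by (simp add: exp_minus field_simps)
    show "let x = x_param; T = (\<lambda>j. exp (sqrt (c * ln (x j)))) in
        (\<lambda>j. - R j - (\<Sum>n | nth_prime j < n \<and> real n < x j \<and> n dvd L_tail j (x j).
            of_int (moebius_mu n) * 2 ^ num_prime_divisors n * frac (x j / real n))) \<in> O(\<lambda>_. 1)
        \<and> (\<exists>E1 E2 E3 E4 :: nat \<Rightarrow> real.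
              E1 \<in> O(\<lambda>j. x j powr (1 + 1 / ln (T j)) * ln (T j) ^ 3 / T j)
            \<and> E2 \<in> O(\<lambda>j. x j * ln (x j) ^ 3 / T j)
            \<and> E3 \<in> O(\<lambda>j. x j powr (1 - c / 2 / ln (T j)) * ln (T j) ^ 3 * ln (x j) powr (3/2))
            \<and> E4 \<in> O(\<lambda>j. x j powr (1 + 1 / ln (T j)) * (ln (T j) ^ 2 * ln (x j) powr (3/2)) / T j)
            \<and> (\<forall>j. - R j = E1 j + E2 j + E3 j + E4 j))
        \<and> (\<lambda>j. - R j) \<in> O(\<lambda>j. x j * exp (- sqrt (c * ln (x j))) * ln (x j) ^ 3)"
      unfolding Let_def
    proof (intro conjI exI)
      show "(\<lambda>j. - R j) \<in> O(\<lambda>j. x_param j * ln (x_param j) ^ 3 / exp (sqrt (c * ln (x_param j))))"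
        unfolding e by (rule main(2)[OF R])
      show "\<forall>j. - R j = 0 + - R j + 0 + 0" by simp
    qed (use main[OF R] in simp_all)
  qed
qed

end
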